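(* Fix $d\ge 2$ and consider either of the two random models below (Model 1 or Model 2). Let $T_n$ be the minimal spanning tree of the resulting $n$-vertex network, and for $\delta>0$ let \[ \varepsilon_n(\delta):=\min\Big\{\frac{\mathrm{len}(T_n')-\mathrm{len}(T_n)}{n}\;:\; T_n' \text{ a spanning tree with } |T_n'\setminus T_n|\ge \delta n\Big\}. \] Then \[ \text{(a)}\quad \limsup_{\delta\downarrow 0}\,\delta^{-2}\,\limsup_{n\to\infty}\mathbb{E}\,\varepsilon_n(\delta)<\infty, \qquad \text{(b)}\quad \liminf_{\delta\downarrow 0}\,\delta^{-2}\,\liminf_{n\to\infty}\mathbb{E}\,\varepsilon_n(\delta)>0 . \]
   Context: A network is a graph whose edges $e$ have positive lengths $\mathrm{len}(e)$; a spanning tree $T$ is identified with its edge set and $\mathrm{len}(T)=\sum_{e\in T}\mathrm{len}(e)$; the minimal spanning tree (MST) is a spanning tree of minimal length (a.s. unique in both models since edge lengths are a.s. distinct). $T_n'\setminus T_n$ denotes the set of edges of $T_n'$ not in $T_n$. Model 1 (disordered lattice): the vertex set is $\{1,\dots,m\}^d$ with edges between pairs of vertices at Euclidean distance $1$, so $n=m^d$; edge lengths are i.i.d. random variables whose common distribution has finite mean and a bounded continuous density. Model 2 (random Euclidean): $n$ independent points uniformly distributed in the cube $[0,n^{1/d}]^d$, forming the complete graph on these points with Euclidean distances as edge lengths. *)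

theory Defs
  imports "HOL-Probability.Probability"
begin

section \<open>Deterministic part: spanning trees, MST, and epsilon_n(delta)\<close>

text \<open>Edges are two-element vertex sets; a set of edges T induces the symmetric
  adjacency relation edge_rel T.\<close>

definition edge_rel :: "'v set set \<Rightarrow> ('v \<times> 'v) set" where
  "edge_rel T = {(x, y). {x, y} \<in> T}"

definition connects :: "'v set \<Rightarrow> 'v set set \<Rightarrow> bool" where
  "connects V T \<longleftrightarrow> (\<forall>u\<in>V. \<forall>v\<in>V. (u, v) \<in> (edge_rel T)\<^sup>*)"

text \<open>Acyclic: no edge lies on a cycle, i.e. removing any edge {u,v} disconnects u from v.\<close>

definition acyclic_edges :: "'v set set \<Rightarrow> bool" where
  "acyclic_edges T \<longleftrightarrow>
     (\<forall>e\<in>T. \<forall>u v. e = {u, v} \<longrightarrow> (u, v) \<notin> (edge_rel (T - {e}))\<^sup>*)"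

definition spanning_tree :: "'v set \<Rightarrow> 'v set set \<Rightarrow> 'v set set \<Rightarrow> bool" where
  "spanning_tree V E T \<longleftrightarrow> T \<subseteq> E \<and> connects V T \<and> acyclic_edges T"

definition tree_len :: "('v set \<Rightarrow> real) \<Rightarrow> 'v set set \<Rightarrow> real" where
  "tree_len w T = (\<Sum>e\<in>T. w e)"

definition is_mst :: "'v set \<Rightarrow> 'v set set \<Rightarrow> ('v set \<Rightarrow> real) \<Rightarrow> 'v set set \<Rightarrow> bool" where
  "is_mst V E w T \<longleftrightarrow> spanning_tree V E T \<and>
     (\<forall>T'. spanning_tree V E T' \<longrightarrow> tree_len w T \<le> tree_len w T')"

definition mst :: "'v set \<Rightarrow> 'v set set \<Rightarrow> ('v set \<Rightarrow> real) \<Rightarrow> 'v set set" where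
  "mst V E w = (SOME T. is_mst V E w T)"

text \<open>epsilon_n(delta) for the network (V,E,w), n = card V.\<close>

definition eps :: "'v set \<Rightarrow> 'v set set \<Rightarrow> ('v set \<Rightarrow> real) \<Rightarrow> real \<Rightarrow> real" where
  "eps V E w \<delta> = Min {(tree_len w T' - tree_len w (mst V E w)) / real (card V) | T'.
       spanning_tree V E T' \<and> real (card (T' - mst V E w)) \<ge> \<delta> * real (card V)}"

section \<open>Model 1: disordered lattice\<close>

definition lattice_vertices :: "nat \<Rightarrow> (real ^ 'd::finite) set" where
  "lattice_vertices m = {x. \<forall>i. x $ i \<in> real ` {1..m}}"

definition lattice_edges :: "nat \<Rightarrow> (real ^ 'd::finite) set set" where
  "lattice_edges m = {{x, y} | x y. x \<in> lattice_vertices m \<and> y \<in> lattice_vertices m \<and> dist x y = 1}"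

text \<open>Admissible edge-length density: a probability density on the positive reals
  (lengths are positive), bounded, continuous, with finite mean.\<close>

definition edge_density :: "(real \<Rightarrow> real) \<Rightarrow> bool" where
  "edge_density f \<longleftrightarrow> f \<in> borel_measurable borel \<and> (\<forall>x. 0 \<le> f x) \<and> (\<forall>x\<le>0. f x = 0)
     \<and> (\<integral>\<^sup>+ x. ennreal (f x) \<partial>lborel) = 1
     \<and> bounded (range f) \<and> continuous_on {0<..} f
     \<and> integrable lborel (\<lambda>x. x * f x)"

definition lattice_measure :: "(real \<Rightarrow> real) \<Rightarrow> nat \<Rightarrow> ((real ^ 'd::finite) set \<Rightarrow> real) measure" where
  "lattice_measure f m = PiM (lattice_edges m) (\<lambda>_. density lborel (\<lambda>x. ennreal (f x)))"

definition expected_eps1 :: "'d::finite itself \<Rightarrow> (real \<Rightarrow> real) \<Rightarrow> nat \<Rightarrow> real \<Rightarrow> real" where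
  "expected_eps1 _ f m \<delta> =
     (\<integral> w. eps (lattice_vertices m :: (real ^ 'd) set) (lattice_edges m) w \<delta> \<partial>lattice_measure f m)"

section \<open>Model 2: random Euclidean\<close>

definition cube :: "nat \<Rightarrow> (real ^ 'd::finite) set" where
  "cube n = {x. \<forall>i. 0 \<le> x $ i \<and> x $ i \<le> real n powr (1 / real CARD('d))}"

definition points_measure :: "nat \<Rightarrow> (nat \<Rightarrow> real ^ 'd::finite) measure" where
  "points_measure n = PiM {..<n} (\<lambda>_. uniform_measure lborel (cube n))"

definition complete_edges :: "nat \<Rightarrow> nat set set" where
  "complete_edges n = {{i, j} | i j. i < n \<and> j < n \<and> i \<noteq> j}"

definition euclid_len :: "(nat \<Rightarrow> real ^ 'd::finite) \<Rightarrow> nat set \<Rightarrow> real" where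
  "euclid_len p e = Sup {dist (p i) (p j) | i j. i \<in> e \<and> j \<in> e}"

definition expected_eps2 :: "'d::finite itself \<Rightarrow> nat \<Rightarrow> real \<Rightarrow> real" where
  "expected_eps2 _ n \<delta> =
     (\<integral> p. eps {..<n} (complete_edges n) (euclid_len (p :: nat \<Rightarrow> real ^ 'd)) \<delta> \<partial>points_measure n)"

end

theory Submission
  imports Defs
begin

text \<open>
  Upper bound: the network contains order n vertex-disjoint short cycles isolated from the rest by longer edges, and
  the two longest edges of such a cycle differ by at most h with probability of order h. The minimal tree omits just the
  longest edge of each isolated cycle, and the swaps on different cycles are independent, so order hn swaps are available
  at cost at most h each; take h of order delta. A bounded-differences variance estimate shows that too few cycles
  are available only with probability O(1/n).

  Lower bound: by the exchange property, a tree with k edges outside the minimal tree exceeds its length by at least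
  x(k - N), where N counts the edges e whose length exceeds, by at most x, the minimax length of the paths joining the ends of e
  in the network without e. It suffices that E N is O(xn), and then to take x a small multiple of delta. On the lattice the
  minimax length is independent of the length of e, which has a bounded density. In the Euclidean model the minimax length is
  the length of an edge avoiding one of the ends of e; as a function of the position y of that end it is 1-Lipschitz, while
  this length does not depend on y, and such a function is within x of the distance to the other end only on a
  set of volume O(x) in every bounded shell. Long edges e are negligible because the ball halfway between their ends
  would have to be empty.
\<close>

section \<open>Spanning trees\<close>

text \<open>Three obstacles shape the development. \<open>eps\<close> is a \<open>Min\<close>, which
  says nothing on an empty set, so lower estimates need a tree far from the minimal one; disjoint
  cycles supply it for small \<open>\<delta>\<close>. \<open>mst\<close> is a choice among minimal
  trees, so the deterministic lemmas treat an arbitrary minimal tree, and measurability of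
  \<open>eps\<close> is derived from the set of all of them. Integrals of nonintegrable functions
  are 0, so integrable majorants must be exhibited.

  On the rare event that too few cycles are available only a crude bound is at hand: the total
  length on the lattice, where a finite mean forces a truncation, and the diameter in the Euclidean
  model, of order n^(1/d) against a probability of order 1/n.

  In the Euclidean lower bound a Lipschitz condition alone cannot suffice, since the distance itself
  is 1-Lipschitz. What helps is that, with the other points fixed, the relevant values of the
  minimax length form a finite set, because the edge realising it avoids the moving end. The size of
  this set grows with n, so the volume bound must not depend on it.\<close>

abbreviation conn :: "'v set set \<Rightarrow> 'v \<Rightarrow> 'v \<Rightarrow> bool" where
  "conn S u v \<equiv> (u, v) \<in> (edge_rel S)\<^sup>*"

lemma conn_sym: "conn S u v \<Longrightarrow> conn S v u"
proof -
  have "sym (edge_rel S)" by (auto simp: sym_def edge_rel_def insert_commute)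
  then show "conn S u v \<Longrightarrow> conn S v u" by (meson sym_rtrancl symE)
qed

lemma conn_mono: "conn S u v \<Longrightarrow> S \<subseteq> S' \<Longrightarrow> conn S' u v"
  by (rule subsetD[OF rtrancl_mono]) (auto simp: edge_rel_def)

lemma conn_edge: "{u, v} \<in> S \<Longrightarrow> conn S u v"
  by (auto simp: edge_rel_def)

lemma conn_trans: "conn S u v \<Longrightarrow> conn S v z \<Longrightarrow> conn S u z"
  by (rule rtrancl_trans)

lemma conn_subst:
  assumes "conn S x y" and "\<And>s t. {s, t} \<in> S \<Longrightarrow> conn R s t"
  shows "conn R x y"
  using assms(1) proof induction
  case (step y z)
  then have "conn R y z" using assms(2) by (simp add: edge_rel_def)
  then show ?case using step.IH conn_trans by metis
qed simp

text \<open>A walk through the new edge can be shortcut so that it crosses it at most once, in one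
  of the two directions. The cut arguments below rest on this trichotomy.\<close>

lemma conn_insert:
  assumes "conn (insert {a, b} S) x y"
  shows "conn S x y \<or> conn S x a \<and> conn S b y \<or> conn S x b \<and> conn S a y"
  using assms
proof induction
  case base
  then show ?case by simp
next
  case (step y z)
  then consider "{y, z} \<in> S" | "y = a" "z = b" | "y = b" "z = a"
    by (auto simp: edge_rel_def doubleton_eq_iff)
  then show ?case
    using step.IH by cases (auto intro: conn_trans conn_edge)
qed

lemma conn_crossing:
  assumes "conn S a b" "P a" "\<not> P b"
  shows "\<exists>s t. {s, t} \<in> S \<and> P s \<and> \<not> P t"
  using assms by induction (auto simp: edge_rel_def)

lemma conn_isolated:
  assumes "conn S u v" "v \<notin> \<Union>S"
  shows "u = v"
  using assms by (cases rule: rtrancl.cases) (auto simp: edge_rel_def)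

lemma acyclic_subset: "acyclic_edges T \<Longrightarrow> S \<subseteq> T \<Longrightarrow> acyclic_edges S"
  unfolding acyclic_edges_def by (meson Diff_mono conn_mono subset_iff order_refl)

lemma acyclicD: "acyclic_edges T \<Longrightarrow> {u, v} \<in> T \<Longrightarrow> \<not> conn (T - {{u, v}}) u v"
  unfolding acyclic_edges_def by blast

lemma acyclic_insert:
  assumes "acyclic_edges S" "\<not> conn S u v"
  shows "acyclic_edges (insert {u, v} S)"
  unfolding acyclic_edges_def
proof (intro ballI allI impI)
  fix e s t assume e: "e \<in> insert {u, v} S" "e = {s, t}"
  have nS: "{u, v} \<notin> S" using assms(2) conn_edge by metis
  show "\<not> conn (insert {u, v} S - {e}) s t"
  proof (cases "e = {u, v}")
    case True
    then have "insert {u, v} S - {e} = S" using nS by auto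
    then show ?thesis using True e assms(2) conn_sym by (metis doubleton_eq_iff)
  next
    case False
    then have eS: "e \<in> S" using e by auto
    then have na: "\<not> conn (S - {e}) s t" using assms(1) e acyclicD by metis
    have eq: "insert {u, v} S - {e} = insert {u, v} (S - {e})" using False by auto
    show ?thesis
    proof
      assume "conn (insert {u, v} S - {e}) s t"
      then have "conn (S - {e}) s u \<and> conn (S - {e}) v t \<or> conn (S - {e}) s v \<and> conn (S - {e}) u t"
        using na conn_insert unfolding eq by metis
      then have "conn S s u \<and> conn S v t \<or> conn S s v \<and> conn S u t"
        by (meson Diff_subset conn_mono)
      moreover have "conn S s t" using eS e conn_edge by metis
      ultimately show False using assms(2) conn_sym conn_trans by metis
    qed
  qed
qed

lemma acyclic_insert_leaf:
  assumes "acyclic_edges S" "v \<notin> \<Union>S" "u \<noteq> v"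
  shows "acyclic_edges (insert {u, v} S)"
  using acyclic_insert[OF assms(1)] conn_isolated[OF _ assms(2)] assms(3) by blast

lemma acyclic_insert_leaf':
  assumes "acyclic_edges S" "u \<notin> \<Union>S" "u \<noteq> v"
  shows "acyclic_edges (insert {u, v} S)"
  using acyclic_insert_leaf[OF assms(1,2)] assms(3) by (metis insert_commute)

lemma acyclic_empty: "acyclic_edges {}"
  by (simp add: acyclic_edges_def)

lemma acyclic_matching:
  assumes "\<And>e. e \<in> F \<Longrightarrow> \<exists>u v. u \<noteq> v \<and> e = {u, v}" "pairwise disjnt F"
  shows "acyclic_edges F"
  unfolding acyclic_edges_def
proof (intro ballI allI impI notI)
  fix e u v assume e: "e \<in> F" "e = {u, v}" "conn (F - {e}) u v"
  have "disjnt e g" if "g \<in> F - {e}" for g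
    using pairwiseD[OF assms(2) e(1)] that by blast
  then have "v \<notin> \<Union>(F - {e})"
    using e(2) by (force simp: disjnt_def)
  then have "u = v" using conn_isolated e(3) by metis
  then show False using assms(1)[OF e(1)] e(2) by (auto simp: doubleton_eq_iff)
qed

text \<open>A cycle given as a bare edge set, without an order of its vertices: deleting any edge
  leaves a forest that still joins the ends of that edge. These are the two facts that swaps along a
  cycle use. The empty set qualifies vacuously, hence the separate condition
  \<open>C \<noteq> {}\<close> later on.\<close>

definition cyc :: "'v set set \<Rightarrow> bool" where
  "cyc C \<longleftrightarrow> (\<forall>e\<in>C. acyclic_edges (C - {e}) \<and> (\<exists>u v. e = {v, u} \<and> conn (C - {e}) u v))"

lemma cyc_conn: "cyc C \<Longrightarrow> {u, v} \<in> C \<Longrightarrow> conn (C - {{u, v}}) u v"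
  unfolding cyc_def by (metis conn_sym doubleton_eq_iff)

lemma cyc_triangle:
  assumes "distinct [p, q, r]"
  shows "cyc {{p, q}, {q, r}, {r, p}}"
proof -
  have ac: "acyclic_edges {{a, b}, {b, c}}" if "distinct [a, b, c]" for a b c :: 'a
    using that by (intro acyclic_insert_leaf' acyclic_empty) auto
  have cn: "conn {{a, b}, {b, c}} a c" for a b c :: 'a
    by (rule conn_trans[where v = b]) (auto intro: conn_edge)
  have d: "{p, q} \<noteq> {q, r}" "{q, r} \<noteq> {r, p}" "{r, p} \<noteq> {p, q}"
    using assms by (auto simp: doubleton_eq_iff)
  have e1: "{{p, q}, {q, r}, {r, p}} - {{p, q}} = {{q, r}, {r, p}}"
    and e2: "{{p, q}, {q, r}, {r, p}} - {{q, r}} = {{r, p}, {p, q}}"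
    and e3: "{{p, q}, {q, r}, {r, p}} - {{r, p}} = {{p, q}, {q, r}}"
    using d by auto
  show ?thesis unfolding cyc_def
  proof (intro ballI)
    fix e assume "e \<in> {{p, q}, {q, r}, {r, p}}"
    then consider "e = {p, q}" | "e = {q, r}" | "e = {r, p}" by auto
    then show "acyclic_edges ({{p, q}, {q, r}, {r, p}} - {e}) \<and>
      (\<exists>u v. e = {v, u} \<and> conn ({{p, q}, {q, r}, {r, p}} - {e}) u v)"
    proof cases
      case 1 then show ?thesis using ac[of q r p] cn[of q p r] assms unfolding 1 e1 by (intro conjI exI[of _ q] exI[of _ p]) auto
    next
      case 2 then show ?thesis using ac[of r p q] cn[of r q p] assms unfolding 2 e2 by (intro conjI exI[of _ r] exI[of _ q]) auto
    next
      case 3 then show ?thesis using ac[of p q r] cn[of p r q] assms unfolding 3 e3 by (intro conjI exI[of _ p] exI[of _ r]) auto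
    qed
  qed
qed

text \<open>Deleting one edge leaves a path of three edges; the four cases are rotations of the one
  path handled by \<open>ac\<close> and \<open>cn\<close>.\<close>

lemma cyc_square:
  assumes "distinct [p, q, r, s]"
  shows "cyc {{p, q}, {q, r}, {r, s}, {s, p}}" (is "cyc ?C")
proof -
  have ac: "acyclic_edges {{a, b}, {b, c}, {c, d}}" if "distinct [a, b, c, d]" for a b c d :: 'a
    using that by (intro acyclic_insert_leaf' acyclic_empty) auto
  have cn: "conn {{a, b}, {b, c}, {c, d}} a d" for a b c d :: 'a
    by (rule conn_trans[where v = b], rule conn_edge, simp,
        rule conn_trans[where v = c]) (auto intro: conn_edge)
  have e1: "?C - {{p, q}} = {{q, r}, {r, s}, {s, p}}"
    and e2: "?C - {{q, r}} = {{r, s}, {s, p}, {p, q}}"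
    and e3: "?C - {{r, s}} = {{s, p}, {p, q}, {q, r}}"
    and e4: "?C - {{s, p}} = {{p, q}, {q, r}, {r, s}}"
    using assms by (auto simp: doubleton_eq_iff)
  show ?thesis unfolding cyc_def
  proof (intro ballI)
    fix e assume "e \<in> ?C"
    then consider "e = {p, q}" | "e = {q, r}" | "e = {r, s}" | "e = {s, p}" by auto
    then show "acyclic_edges (?C - {e}) \<and> (\<exists>u v. e = {v, u} \<and> conn (?C - {e}) u v)"
    proof cases
      case 1 then show ?thesis using ac[of q r s p] cn[of q p r s] assms unfolding 1 e1 by (intro conjI exI[of _ q] exI[of _ p]) auto
    next
      case 2 then show ?thesis using ac[of r s p q] cn[of r q s p] assms unfolding 2 e2 by (intro conjI exI[of _ r] exI[of _ q]) auto
    next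
      case 3 then show ?thesis using ac[of s p q r] cn[of s r p q] assms unfolding 3 e3 by (intro conjI exI[of _ s] exI[of _ r]) auto
    next
      case 4 then show ?thesis using ac[of p q r s] cn[of p s q r] assms unfolding 4 e4 by (intro conjI exI[of _ p] exI[of _ s]) auto
    qed
  qed
qed

text \<open>\<open>F\<close> is the tree path from \<open>a\<close> to \<open>b\<close>, obtained as
  a connecting subset of least cardinality. If \<open>a\<close> and \<open>b\<close> stayed joined
  without one of its edges \<open>f\<close>, the two remaining pieces of the path would join the
  ends of \<open>f\<close> in \<open>T - {f}\<close>, against acyclicity.\<close>

lemma acyclic_path_edges:
  assumes "finite T" "acyclic_edges T" "conn T a b" "\<And>e. e \<in> T \<Longrightarrow> \<exists>u v. e = {u, v}"
  shows "\<exists>F\<subseteq>T. conn F a b \<and> (\<forall>f\<in>F. \<not> conn (T - {f}) a b)"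
proof -
  obtain F where F: "F \<subseteq> T" "conn F a b" and min: "\<And>F'. F' \<subseteq> T \<Longrightarrow> conn F' a b \<Longrightarrow> card F \<le> card F'"
    using ex_has_least_nat[of "\<lambda>F. F \<subseteq> T \<and> conn F a b" T card] assms(3) by blast
  have "\<not> conn (T - {f}) a b" if f: "f \<in> F" for f
  proof
    assume c: "conn (T - {f}) a b"
    obtain s t where st: "f = {s, t}" using f F assms(4) by blast
    have fin: "finite F" using F(1) assms(1) finite_subset by blast
    have "\<not> conn (F - {f}) a b"
      using min[of "F - {f}"] F(1) card_Diff1_less[OF fin f] by (meson Diff_subset leD order_trans)
    moreover have "insert {s, t} (F - {f}) = F" using st f by auto
    ultimately have "conn (F - {f}) a s \<and> conn (F - {f}) t b \<or> conn (F - {f}) a t \<and> conn (F - {f}) s b"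
      using conn_insert[of a b s t "F - {f}"] F(2) by auto
    then have "conn (T - {f}) a s \<and> conn (T - {f}) t b \<or> conn (T - {f}) a t \<and> conn (T - {f}) s b"
      using F(1) by (meson Diff_mono conn_mono order_refl)
    then have "conn (T - {f}) s t" using c conn_sym conn_trans by metis
    then show False using acyclicD[OF assms(2)] st f F(1) by blast
  qed
  then show ?thesis using F by blast
qed

section \<open>Finite connected networks: exchange and extension of trees\<close>

locale network =
  fixes V :: "'v set" and E :: "'v set set"
  assumes finite_V: "finite V"
    and edge: "e \<in> E \<Longrightarrow> \<exists>u\<in>V. \<exists>v\<in>V. u \<noteq> v \<and> e = {u, v}"
    and connected: "connects V E"
begin

lemma finite_E: "finite E"
proof -
  have "E \<subseteq> Pow V" using edge by fastforce
  then show ?thesis using finite_V finite_subset by blast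
qed

lemma spanning_treeD:
  assumes "spanning_tree V E T"
  shows "T \<subseteq> E" "finite T" "acyclic_edges T" "u \<in> V \<Longrightarrow> v \<in> V \<Longrightarrow> conn T u v"
    "e \<in> T \<Longrightarrow> \<exists>u v. e = {u, v}"
proof -
  show "T \<subseteq> E" "acyclic_edges T" "u \<in> V \<Longrightarrow> v \<in> V \<Longrightarrow> conn T u v"
    using assms unfolding spanning_tree_def connects_def by auto
  then show "finite T" using finite_E finite_subset by blast
  show "e \<in> T \<Longrightarrow> \<exists>u v. e = {u, v}" using \<open>T \<subseteq> E\<close> edge by blast
qed

lemma finite_spanning_trees: "finite {T. spanning_tree V E T}"
  by (rule finite_subset[of _ "Pow E"]) (auto simp: spanning_tree_def finite_E)

lemma edge_in_V: "{u, v} \<in> E \<Longrightarrow> u \<in> V" "{u, v} \<in> E \<Longrightarrow> v \<in> V" "{u, v} \<in> E \<Longrightarrow> u \<noteq> v"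
  using edge[of "{u, v}"] by (auto simp: doubleton_eq_iff)

text \<open>\<open>T\<close> joins \<open>u\<close> and \<open>v\<close> but \<open>T - {f}\<close>
  does not, so the tree path between them crosses \<open>f\<close>. Going round through the new edge
  reconnects the ends of \<open>f\<close>, and the new edge closes no cycle.\<close>

lemma spanning_tree_swap:
  assumes T: "spanning_tree V E T" and f: "f \<in> T" and e: "{u, v} \<in> E" and nc: "\<not> conn (T - {f}) u v"
  shows "spanning_tree V E (insert {u, v} (T - {f}))"
proof -
  note TD = spanning_treeD[OF T]
  obtain a b where ab: "f = {a, b}" using TD(5) f by blast
  have Ti: "insert {a, b} (T - {f}) = T" using ab f by auto
  let ?N = "insert {u, v} (T - {f})"
  have "conn (T - {f}) u a \<and> conn (T - {f}) b v \<or> conn (T - {f}) u b \<and> conn (T - {f}) a v"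
    using conn_insert[of u v a b "T - {f}"] TD(4)[OF edge_in_V(1,2)[OF e]] nc unfolding Ti by blast
  then have "conn ?N u a \<and> conn ?N b v \<or> conn ?N u b \<and> conn ?N a v"
    by (meson conn_mono subset_insertI)
  moreover have "conn ?N u v" by (rule conn_edge) simp
  ultimately have ab': "conn ?N a b" by (meson conn_sym conn_trans)
  have "conn ?N x y" if "conn T x y" for x y
    using that
  proof (rule conn_subst)
    fix s t assume st: "{s, t} \<in> T"
    show "conn ?N s t"
    proof (cases "{s, t} = f")
      case True
      then show ?thesis using ab ab' conn_sym by (metis doubleton_eq_iff)
    next
      case False
      then show ?thesis using st by (intro conn_edge) auto
    qed
  qed
  then have "connects V ?N" using TD(4) unfolding connects_def by blast
  moreover have "acyclic_edges ?N"
    using acyclic_insert[OF acyclic_subset[OF TD(3)] nc] by blast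
  ultimately show ?thesis using TD(1) e unfolding spanning_tree_def by blast
qed

text \<open>Symmetric exchange: a single \<open>f\<close> serves both trees. Removing
  \<open>e\<close> from \<open>T'\<close> cuts the vertices in two, and the path of \<open>T\<close>
  between the ends of \<open>e\<close> has to cross this cut; any crossing edge works.\<close>

lemma spanning_tree_exchange:
  assumes T: "spanning_tree V E T" and T': "spanning_tree V E T'" and e: "e \<in> T'" "e \<notin> T"
  shows "\<exists>f\<in>T - T'. spanning_tree V E (insert e (T - {f})) \<and> spanning_tree V E (insert f (T' - {e}))"
proof -
  obtain a b where ab: "e = {a, b}" "a \<in> V" "b \<in> V"
    using edge e(1) spanning_treeD(1)[OF T'] by blast
  have nc: "\<not> conn (T' - {e}) a b"
    using acyclicD[OF spanning_treeD(3)[OF T']] ab e by blast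
  obtain F where F: "F \<subseteq> T" "conn F a b" "\<And>f. f \<in> F \<Longrightarrow> \<not> conn (T - {f}) a b"
    using acyclic_path_edges[of T a b] spanning_treeD[OF T] ab by metis
  obtain s t where st: "{s, t} \<in> F" "conn (T' - {e}) a s" "\<not> conn (T' - {e}) a t"
    using conn_crossing[OF F(2), of "conn (T' - {e}) a"] nc by auto
  have nst: "\<not> conn (T' - {e}) s t" using st conn_trans by metis
  have "{s, t} \<notin> T'" using nst conn_edge[of s t "T' - {e}"] st(1) F(1) e(2) by blast
  moreover have "spanning_tree V E (insert e (T - {{s, t}}))"
    using spanning_tree_swap[OF T _ _ F(3)] st(1) F(1) ab e spanning_treeD(1)[OF T'] by blast
  moreover have "spanning_tree V E (insert {s, t} (T' - {e}))"
    using spanning_tree_swap[OF T' e(1) _ nst] st(1) F(1) spanning_treeD(1)[OF T] by blast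
  ultimately show ?thesis using st(1) F(1) by blast
qed

text \<open>A forest of maximal size containing \<open>F\<close> connects everything, since
  otherwise some edge of the network leaving a component could be added. With \<open>F\<close> empty
  this yields the existence of spanning trees.\<close>

lemma extend_acyclic:
  assumes "F \<subseteq> E" "acyclic_edges F"
  shows "\<exists>T. F \<subseteq> T \<and> spanning_tree V E T"
proof -
  let ?P = "\<lambda>T. F \<subseteq> T \<and> T \<subseteq> E \<and> acyclic_edges T"
  obtain T where T: "?P T" and mx: "\<And>S. ?P S \<Longrightarrow> card S \<le> card T"
    using ex_has_greatest_nat[of ?P F card "Suc (card E)"] assms card_mono[OF finite_E]
    by (auto simp: less_Suc_eq_le)
  have "connects V T" unfolding connects_def
  proof (intro ballI, rule ccontr)
    fix u v assume uv: "u \<in> V" "v \<in> V" "\<not> conn T u v"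
    then obtain s t where st: "{s, t} \<in> E" "conn T u s" "\<not> conn T u t"
      using conn_crossing[of u v E "conn T u"] connected unfolding connects_def by blast
    have n: "\<not> conn T s t" using st conn_trans by metis
    have "card (insert {s, t} T) \<le> card T"
      using mx[of "insert {s, t} T"] T st acyclic_insert[OF _ n] by blast
    moreover have "{s, t} \<notin> T" using n conn_edge by metis
    moreover have "finite T" using T finite_E finite_subset by blast
    ultimately show False by simp
  qed
  then show ?thesis using T unfolding spanning_tree_def by blast
qed

lemma is_mst_mst: "is_mst V E w (mst V E w)"
proof -
  have "{T. spanning_tree V E T} \<noteq> {}" using extend_acyclic[OF _ acyclic_empty] by auto
  then obtain T where "spanning_tree V E T" "\<And>S. spanning_tree V E S \<Longrightarrow> tree_len w T \<le> tree_len w S"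
    using ex_min_if_finite[of "tree_len w ` {T. spanning_tree V E T}"] finite_spanning_trees
    by (auto simp: not_less)
  then show ?thesis unfolding mst_def by (intro someI[of "is_mst V E w" T]) (auto simp: is_mst_def)
qed

lemma tree_len_swap:
  assumes "finite T" "f \<in> T" "e \<notin> T"
  shows "tree_len w (insert e (T - {f})) = tree_len w T - w f + w e"
  using assms by (simp add: tree_len_def sum_diff1)

lemma mst_swap_le:
  assumes "is_mst V E w T" "f \<in> T" "e \<notin> T" "spanning_tree V E (insert e (T - {f}))"
  shows "w f \<le> w e"
  using assms tree_len_swap[OF spanning_treeD(2) assms(2,3), of w] unfolding is_mst_def by fastforce

text \<open>Each edge of the tree path between the ends of a non-tree edge can be swapped for that
  edge, so minimality makes it no longer.\<close>

lemma mst_path_le: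
  assumes T: "is_mst V E w T" and g: "{s, t} \<in> E" "{s, t} \<notin> T"
  shows "conn {f \<in> T. w f \<le> w {s, t}} s t"
proof -
  have sp: "spanning_tree V E T" using T by (simp add: is_mst_def)
  obtain F where F: "F \<subseteq> T" "conn F s t" "\<And>f. f \<in> F \<Longrightarrow> \<not> conn (T - {f}) s t"
    using acyclic_path_edges[of T s t] spanning_treeD[OF sp] edge_in_V[OF g(1)] by metis
  have "w f \<le> w {s, t}" if "f \<in> F" for f
    using mst_swap_le[OF T _ g(2) spanning_tree_swap[OF sp _ g(1) F(3)[OF that]]] that F(1) by blast
  then have "F \<subseteq> {f \<in> T. w f \<le> w {s, t}}" using F(1) by blast
  then show ?thesis by (rule conn_mono[OF F(2)])
qed

section \<open>Near ties and the length gap of far trees\<close>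

definition bypass :: "('v set \<Rightarrow> real) \<Rightarrow> real \<Rightarrow> 'v set \<Rightarrow> bool" where
  "bypass w l e \<longleftrightarrow> (\<exists>S u v. S \<subseteq> E - {e} \<and> e = {u, v} \<and> conn S u v \<and> (\<forall>g\<in>S. w g \<le> l))"

text \<open>If \<open>c\<close> is the minimax length of the paths joining the ends of
  \<open>e\<close> in the network without \<open>e\<close>, the condition reads
  \<open>c \<le> w e < c + x\<close>. Written through \<open>bypass\<close>, it also makes sense for
  an edge without any such path.\<close>

definition near_ties :: "('v set \<Rightarrow> real) \<Rightarrow> real \<Rightarrow> 'v set set" where
  "near_ties w x = {e \<in> E. bypass w (w e) e \<and> \<not> bypass w (w e - x) e}"

text \<open>A bypass of \<open>e\<close> at level \<open>w e - x\<close> would consist of edges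
  shorter than \<open>f\<close>. It would cross the cut left by removing \<open>f\<close> from
  \<open>T\<close>, and the crossing edge could replace \<open>f\<close> at a gain, against
  minimality.\<close>

lemma near_ties_swap:
  assumes T: "is_mst V E w T" and e: "e \<in> E" "e \<notin> T" and f: "f \<in> T"
    and sw: "spanning_tree V E (insert e (T - {f}))" and lt: "w e - w f < x"
  shows "e \<in> near_ties w x"
proof -
  have sp: "spanning_tree V E T" using T by (simp add: is_mst_def)
  obtain a b where ab: "e = {a, b}" using edge e(1) by blast
  have "conn {f \<in> T. w f \<le> w e} a b" using mst_path_le[OF T] e ab by blast
  then have "bypass w (w e) e"
    unfolding bypass_def using spanning_treeD(1)[OF sp] e ab
    by (intro exI[of _ "{f \<in> T. w f \<le> w e}"] exI[of _ a] exI[of _ b]) auto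
  moreover have "\<not> bypass w (w e - x) e"
  proof
    assume "bypass w (w e - x) e"
    then obtain S u v where S: "S \<subseteq> E - {e}" "e = {u, v}" "conn S u v" "\<And>g. g \<in> S \<Longrightarrow> w g \<le> w e - x"
      unfolding bypass_def by blast
    have "insert e (T - {f}) - {e} = T - {f}" using e by auto
    then have "\<not> conn (T - {f}) u v"
      using acyclicD[OF spanning_treeD(3)[OF sw], of u v] S(2) by auto
    then obtain s t where st: "{s, t} \<in> S" "conn (T - {f}) u s" "\<not> conn (T - {f}) u t"
      using conn_crossing[OF S(3), of "conn (T - {f}) u"] by blast
    then have n: "\<not> conn (T - {f}) s t" using conn_trans by metis
    have w: "w {s, t} < w f" using S(4)[OF st(1)] lt by simp
    then have "{s, t} \<notin> T" using n conn_edge[of s t "T - {f}"] by fastforce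
    then have "w f \<le> w {s, t}"
      using mst_swap_le[OF T f _ spanning_tree_swap[OF sp f _ n]] st(1) S(1) by blast
    then show False using w by simp
  qed
  ultimately show ?thesis using e unfolding near_ties_def by blast
qed

text \<open>Walk from \<open>T'\<close> to \<open>T\<close> by symmetric exchanges, removing one
  edge \<open>e\<close> outside \<open>T\<close> at a time. Each step shortens the tree by
  \<open>w e - w f\<close>, which is never negative and is at least \<open>x\<close> unless
  \<open>e\<close> is a near tie.\<close>

lemma mst_gap:
  assumes T: "is_mst V E w T" and x: "x \<ge> 0" and T': "spanning_tree V E T'"
  shows "x * real (card (T' - T - near_ties w x)) \<le> tree_len w T' - tree_len w T"
  using T'
proof (induction "card (T' - T)" arbitrary: T')
  case 0
  have "finite (T' - T)" using spanning_treeD(2)[OF 0(2)] by blast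
  then have "T' - T = {}" using 0(1) by simp
  then have "T' - T - near_ties w x = {}" by blast
  then have "card (T' - T - near_ties w x) = 0" by (simp only: card.empty)
  then show ?case using T 0(2) unfolding is_mst_def by simp
next
  case (Suc k)
  have sp: "spanning_tree V E T" using T by (simp add: is_mst_def)
  have fin: "finite T'" using spanning_treeD(2)[OF Suc(3)] .
  obtain e where e: "e \<in> T'" "e \<notin> T" using Suc(2) by (metis DiffE card.empty equals0I nat.distinct(1))
  then have eE: "e \<in> E" using spanning_treeD(1)[OF Suc(3)] by blast
  obtain f where f: "f \<in> T" "f \<notin> T'" and s1: "spanning_tree V E (insert e (T - {f}))"
    and s2: "spanning_tree V E (insert f (T' - {e}))"
    using spanning_tree_exchange[OF sp Suc(3) e] by blast
  let ?S = "insert f (T' - {e})"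
  have d: "?S - T = (T' - T) - {e}" using f e by auto
  then have "k = card (?S - T)" using Suc(2) e fin by simp
  from Suc(1)[OF this s2] have IH: "x * real (card (?S - T - near_ties w x)) \<le> tree_len w ?S - tree_len w T" .
  have len: "tree_len w ?S = tree_len w T' - w e + w f" using tree_len_swap[OF fin e(1) f(2)] .
  have le: "w f \<le> w e" using mst_swap_le[OF T f(1) e(2) s1] .
  show ?case
  proof (cases "e \<in> near_ties w x")
    case True
    then have "?S - T - near_ties w x = T' - T - near_ties w x" using d by auto
    then show ?thesis using IH len le by simp
  next
    case False
    then have "\<not> w e - w f < x" using near_ties_swap[OF T eE e(2) f(1) s1] by blast
    moreover have "T' - T - near_ties w x = insert e (?S - T - near_ties w x)" using d e False by auto
    moreover have "e \<notin> ?S - T - near_ties w x" "finite (?S - T - near_ties w x)" using d fin by auto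
    ultimately show ?thesis using IH len by (simp add: algebra_simps)
  qed
qed

section \<open>Isolated cycles and simultaneous swaps\<close>

lemma cycle_swap:
  assumes T: "spanning_tree V E T" and C: "cyc C" "C \<subseteq> E" "T \<inter> C = C - {e}" "e \<in> C" and c: "c \<in> C" "c \<noteq> e"
  shows "spanning_tree V E (insert e (T - {c}))"
proof -
  obtain u v where uv: "e = {u, v}" using edge C by blast
  obtain s t where st: "c = {s, t}" using edge C c by blast
  have cT: "c \<in> T" using C c by auto
  have "\<not> conn (C - {c} - {e}) u v"
    using acyclicD[of "C - {c}" u v] C c uv unfolding cyc_def by blast
  moreover have "C - {c} - {e} = C - {e} - {c}" by auto
  moreover have "conn (C - {e}) u v" using cyc_conn C uv by metis
  moreover have "insert {s, t} (C - {e} - {c}) = C - {e}" using c st by auto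
  ultimately have "conn (C - {e} - {c}) u s \<and> conn (C - {e} - {c}) t v \<or> conn (C - {e} - {c}) u t \<and> conn (C - {e} - {c}) s v"
    using conn_insert[of u v s t "C - {e} - {c}"] by metis
  moreover have "C - {e} - {c} \<subseteq> T - {c}" using C(3) by blast
  ultimately have "conn (T - {c}) u s \<and> conn (T - {c}) t v \<or> conn (T - {c}) u t \<and> conn (T - {c}) s v"
    by (meson conn_mono)
  then have "\<not> conn (T - {c}) u v"
    using acyclicD[OF spanning_treeD(3)[OF T]] cT st by (meson conn_sym conn_trans)
  then show ?thesis using spanning_tree_swap[OF T cT] uv C by auto
qed

lemma cycle_not_subset_tree:
  assumes T: "spanning_tree V E T" and C: "cyc C" "C \<noteq> {}" "C \<subseteq> E"
  shows "\<not> C \<subseteq> T"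
proof
  assume CT: "C \<subseteq> T"
  obtain e u v where e: "e \<in> C" "e = {u, v}" using C edge by blast
  have "conn (C - {e}) u v" using cyc_conn C e by metis
  then have "conn (T - {e}) u v" using CT by (meson Diff_mono conn_mono order_refl)
  then show False using acyclicD[OF spanning_treeD(3)[OF T]] e CT by blast
qed

text \<open>If a second edge \<open>c\<close> of \<open>C\<close> were missing too, the path of
  \<open>T\<close> joining its ends would use only edges no longer than \<open>c\<close>. By
  isolation, such edges touching \<open>W\<close> lie in \<open>C\<close>, so the path never leaves
  the cycle; but a cycle without two of its edges does not join the ends of either. That the missing
  edge is a longest one follows from the swaps along the cycle.\<close>

lemma mst_isolated_cycle:
  assumes T: "is_mst V E w T" and C: "cyc C" "C \<noteq> {}" "C \<subseteq> E" "C \<subseteq> Pow W"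
    and iso: "\<And>e. e \<in> E \<Longrightarrow> e \<inter> W \<noteq> {} \<Longrightarrow> e \<in> C \<or> (\<forall>c\<in>C. w c < w e)"
  shows "\<exists>e\<in>C. T \<inter> C = C - {e} \<and> (\<forall>c\<in>C. w c \<le> w e)"
proof -
  have sp: "spanning_tree V E T" using T by (simp add: is_mst_def)
  obtain e where e: "e \<in> C" "e \<notin> T" using cycle_not_subset_tree[OF sp C(1,2,3)] by blast
  have "c \<in> T" if c: "c \<in> C" "c \<noteq> e" for c
  proof (rule ccontr)
    assume cT: "c \<notin> T"
    obtain s t where st: "c = {s, t}" using c C edge by blast
    let ?H = "{f \<in> T. w f \<le> w c}"
    have HC: "f \<in> C" if "f \<in> ?H" "f \<inter> W \<noteq> {}" for f
      using iso[of f] that c(1) spanning_treeD(1)[OF sp] by fastforce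
    have sW: "s \<in> W" using c st C by blast
    have "conn ?H s t" using mst_path_le[OF T] c C st cT by blast
    then have "conn (?H \<inter> C) s t \<and> t \<in> W"
    proof induction
      case base
      then show ?case using sW by simp
    next
      case (step y z)
      then have yz: "{y, z} \<in> ?H" "y \<in> W" "conn (?H \<inter> C) s y" by (auto simp: edge_rel_def)
      then have yC: "{y, z} \<in> C" using HC by blast
      then have "z \<in> W" using C by blast
      moreover have "conn (?H \<inter> C) y z" using yz yC by (intro conn_edge) auto
      ultimately show ?case using conn_trans[OF yz(3)] by blast
    qed
    moreover have "?H \<inter> C \<subseteq> C - {e} - {c}" using e cT by auto
    ultimately have "conn (C - {e} - {c}) s t" using conn_mono by meson
    then show False using acyclicD[of "C - {e}" s t] C(1) c e st unfolding cyc_def by blast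
  qed
  then have TC: "T \<inter> C = C - {e}" using e by auto
  moreover have "w c \<le> w e" if c: "c \<in> C" for c
  proof (cases "c = e")
    case False
    then show ?thesis using mst_swap_le[OF T _ e(2) cycle_swap[OF sp C(1,3) TC e(1) c]] TC c by blast
  qed simp
  ultimately show ?thesis using e by blast
qed

text \<open>The swaps are made one after another. The equality of \<open>T'\<close> and
  \<open>T\<close> outside the cycles treated so far is the invariant that keeps every other cycle
  in the state \<open>C j - {e j}\<close>, so that its own swap remains admissible.\<close>

lemma swap_many:
  assumes T: "spanning_tree V E T" and J: "finite J"
    and C: "\<And>j. j \<in> J \<Longrightarrow> cyc (C j) \<and> C j \<subseteq> E \<and> e j \<in> C j \<and> T \<inter> C j = C j - {e j}"
    and disj: "\<And>i j. i \<in> J \<Longrightarrow> j \<in> J \<Longrightarrow> i \<noteq> j \<Longrightarrow> C i \<inter> C j = {}"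
    and c: "\<And>j. j \<in> J \<Longrightarrow> c j \<in> C j \<and> c j \<noteq> e j \<and> w (e j) \<le> w (c j) + h"
  shows "\<exists>T'. spanning_tree V E T' \<and> T' - T = e ` J \<and> card (e ` J) = card J
    \<and> T' - (\<Union>j\<in>J. C j) = T - (\<Union>j\<in>J. C j) \<and> tree_len w T' \<le> tree_len w T + h * real (card J)"
  using J C disj c
proof (induction J)
  case empty
  then show ?case using T by (intro exI[of _ T]) simp
next
  case (insert j J)
  obtain T' where T': "spanning_tree V E T'" "T' - T = e ` J" "card (e ` J) = card J"
    "T' - (\<Union>j\<in>J. C j) = T - (\<Union>j\<in>J. C j)" "tree_len w T' \<le> tree_len w T + h * real (card J)"
    using insert.IH[OF insert.prems(1)[OF insertI2] insert.prems(2)[OF insertI2 insertI2]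
        insert.prems(3)[OF insertI2]] by blast
  have "C j \<inter> C i = {}" if "i \<in> J" for i
    using insert.prems(2)[of j i] that insert.hyps(2) by blast
  then have dj: "C j \<inter> (\<Union>j\<in>J. C j) = {}" by blast
  have "X \<inter> C j = (X - (\<Union>j\<in>J. C j)) \<inter> C j" for X using dj by blast
  from this[of T'] this[of T] have TC: "T' \<inter> C j = C j - {e j}"
    unfolding T'(4) using insert.prems(1)[OF insertI1] by simp
  note Cj = insert.prems(1)[OF insertI1] and cj = insert.prems(3)[OF insertI1]
  have sw: "spanning_tree V E (insert (e j) (T' - {c j}))"
    using cycle_swap[OF T'(1) _ _ TC] Cj cj by blast
  have cT: "c j \<in> T'" "e j \<notin> T'" "c j \<in> T" "e j \<notin> T" using TC Cj cj by blast+
  have len: "tree_len w (insert (e j) (T' - {c j})) = tree_len w T' - w (c j) + w (e j)"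
    using tree_len_swap[OF spanning_treeD(2)[OF T'(1)] cT(1,2)] .
  have "e i \<in> C i" if "i \<in> J" for i using insert.prems(1)[of i] that by blast
  then have "e j \<notin> e ` J" using dj Cj by (metis Int_iff UN_I empty_iff imageE)
  moreover have "insert (e j) (T' - {c j}) - T = e ` insert j J" using T'(2) cT by auto
  moreover have "insert (e j) (T' - {c j}) - (\<Union>j\<in>insert j J. C j) = T - (\<Union>j\<in>insert j J. C j)"
  proof -
    have m: "e j \<in> C j" "c j \<in> C j" using Cj cj by simp_all
    have "insert (e j) (T' - {c j}) - (\<Union>j\<in>insert j J. C j) = (T' - (\<Union>j\<in>J. C j)) - C j"
      using m by auto
    also have "\<dots> = T - (\<Union>j\<in>insert j J. C j)" unfolding T'(4) by auto
    finally show ?thesis .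
  qed
  moreover have "tree_len w (insert (e j) (T' - {c j})) \<le> tree_len w T + h * real (card (insert j J))"
    using len T'(5) cj insert.hyps by (simp add: algebra_simps)
  ultimately show ?case using sw T'(3) insert.hyps by (intro exI[of _ "insert (e j) (T' - {c j})"]) simp
qed

text \<open>This is what makes the set under the minimum in \<open>eps\<close> nonempty. The tree
  misses an edge of each cycle; these edges lie in disjoint vertex sets, so they form a matching,
  hence a forest, which extends to a spanning tree.\<close>

lemma far_spanning_tree:
  assumes T: "spanning_tree V E T" and J: "finite J"
    and C: "\<And>j. j \<in> J \<Longrightarrow> cyc (C j) \<and> C j \<subseteq> E \<and> C j \<noteq> {} \<and> C j \<subseteq> Pow (W j)"
    and disj: "\<And>i j. i \<in> J \<Longrightarrow> j \<in> J \<Longrightarrow> i \<noteq> j \<Longrightarrow> W i \<inter> W j = {}"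
  shows "\<exists>T'. spanning_tree V E T' \<and> card J \<le> card (T' - T)"
proof -
  have "\<exists>e. e \<in> C j - T" if j: "j \<in> J" for j
    using cycle_not_subset_tree[OF T, of "C j"] C[OF j] by blast
  then obtain e where e: "\<And>j. j \<in> J \<Longrightarrow> e j \<in> C j - T" by metis
  have eE: "e j \<in> E" "e j \<subseteq> W j" if j: "j \<in> J" for j
    using e[OF j] C[OF j] by (meson DiffD1 PowD subsetD)+
  have ne: "e j \<noteq> {}" if "j \<in> J" for j using edge[OF eE(1)[OF that]] by auto
  have "inj_on e J"
    by (rule inj_onI) (metis disj eE(2) ne Int_greatest subset_empty)
  moreover have "acyclic_edges (e ` J)"
  proof (rule acyclic_matching)
    show "\<exists>u v. u \<noteq> v \<and> f = {u, v}" if "f \<in> e ` J" for f using that eE(1) edge by (metis imageE)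
    show "pairwise disjnt (e ` J)"
      unfolding pairwise_def disjnt_def
    proof (intro ballI impI)
      fix x y assume "x \<in> e ` J" "y \<in> e ` J" "x \<noteq> y"
      then obtain i j where ij: "i \<in> J" "j \<in> J" "x = e i" "y = e j" "i \<noteq> j" by auto
      show "x \<inter> y = {}" using disj[OF ij(1,2,5)] eE(2)[OF ij(1)] eE(2)[OF ij(2)] ij(3,4) by auto
    qed
  qed
  then obtain T' where T': "e ` J \<subseteq> T'" "spanning_tree V E T'"
    using extend_acyclic[of "e ` J"] eE(1) by (metis image_subsetI)
  moreover have "e ` J \<subseteq> T' - T" using T'(1) e by auto
  ultimately show ?thesis
    using card_mono[of "T' - T" "e ` J"] spanning_treeD(2)[OF T'(2)] card_image[of e J] by (metis finite_Diff)
qed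

section \<open>The minimum that defines \<open>eps\<close>\<close>

lemma finite_eps_set:
  "finite {(tree_len w T' - tree_len w (mst V E w)) / real (card V) | T'.
       spanning_tree V E T' \<and> real (card (T' - mst V E w)) \<ge> \<delta> * real (card V)}"
  using finite_spanning_trees by simp

lemma eps_le:
  assumes "spanning_tree V E T'" "real (card (T' - mst V E w)) \<ge> \<delta> * real (card V)"
  shows "eps V E w \<delta> \<le> (tree_len w T' - tree_len w (mst V E w)) / real (card V)"
  unfolding eps_def using assms by (intro Min_le finite_eps_set) blast

text \<open>The witness \<open>T0\<close> excludes the minimum of an empty set, about which nothing
  can be said.\<close>

lemma eps_ge:
  assumes "spanning_tree V E T0" "real (card (T0 - mst V E w)) \<ge> \<delta> * real (card V)"
    and "\<And>T'. spanning_tree V E T' \<Longrightarrow> real (card (T' - mst V E w)) \<ge> \<delta> * real (card V) \<Longrightarrow>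
      r \<le> (tree_len w T' - tree_len w (mst V E w)) / real (card V)"
  shows "r \<le> eps V E w \<delta>"
  unfolding eps_def using assms by (intro Min.boundedI finite_eps_set) blast+

end

section \<open>Bounded differences, measurability and scaled limits\<close>

text \<open>An Efron-Stein type bound by induction over the coordinates. Integrating out coordinate
  \<open>i\<close> splits the variance into the mean conditional variance, at most
  \<open>c\<^sup>2\<close>, and the variance of the conditional mean \<open>G\<close>, which
  inherits the bounded differences in the other coordinates.\<close>

lemma bounded_differences_variance:
  fixes M :: "'i \<Rightarrow> 'a measure" and F :: "('i \<Rightarrow> 'a) \<Rightarrow> real"
  assumes M: "\<And>i. prob_space (M i)" and "finite I"
    and "F \<in> borel_measurable (PiM I M)"
    and "\<And>x. x \<in> space (PiM I M) \<Longrightarrow> \<bar>F x\<bar> \<le> K"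
    and "\<And>i x y. i \<in> I \<Longrightarrow> x \<in> space (PiM I M) \<Longrightarrow> y \<in> space (M i) \<Longrightarrow> \<bar>F (x(i := y)) - F x\<bar> \<le> c"
  shows "(\<integral>x. (F x - (\<integral>x. F x \<partial>PiM I M))\<^sup>2 \<partial>PiM I M) \<le> real (card I) * c\<^sup>2"
  using assms(2-)
proof (induction I arbitrary: F)
  case empty
  have "F x - (\<integral>x. F x \<partial>PiM {} M) = 0" if "x \<in> space (PiM {} M)" for x
  proof -
    have "x = (\<lambda>_. undefined)" using that by (simp add: space_PiM)
    moreover have "(\<integral>x. F x \<partial>PiM {} M) = F (\<lambda>_. undefined)"
      by (simp add: PiM_empty lebesgue_integral_count_space_finite)
    ultimately show ?thesis by simp
  qed
  then have "(\<integral>x. (F x - (\<integral>x. F x \<partial>PiM {} M))\<^sup>2 \<partial>PiM {} M) = (\<integral>x. 0 \<partial>PiM {} M)"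
    by (intro Bochner_Integration.integral_cong) auto
  then show ?case by simp
next
  case (insert i I)
  interpret Mi: prob_space "M i" by (rule M)
  interpret PI: prob_space "PiM I M" by (rule prob_space_PiM) (rule M)
  interpret PJ: prob_space "PiM (insert i I) M" by (rule prob_space_PiM) (rule M)
  interpret product_prob_space M "insert i I" by (rule product_prob_spaceI) (rule M)
  note [measurable] = insert.prems(1)
  have sp: "x(i := y) \<in> space (PiM (insert i I) M)" if "x \<in> space (PiM I M)" "y \<in> space (M i)" for x y
    using that by (auto simp: space_PiM PiE_iff extensional_def)
  define G where "G x = (\<integral>y. F (x(i := y)) \<partial>M i)" for x
  have Fm2: "(\<lambda>(x, y). F (x(i := y))) \<in> borel_measurable (PiM I M \<Otimes>\<^sub>M M i)"
    using measurable_compose[OF measurable_add_dim insert.prems(1)] by (simp add: split_beta')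
  have Gm[measurable]: "G \<in> borel_measurable (PiM I M)"
    unfolding G_def using Fm2 by (rule Mi.borel_measurable_lebesgue_integral)
  have Fm1[measurable]: "(\<lambda>y. F (x(i := y))) \<in> borel_measurable (M i)" if "x \<in> space (PiM I M)" for x
    using measurable_Pair_compose_split[OF Fm2 measurable_const[OF that] measurable_ident_sets[OF refl]] by simp
  have Fi: "integrable (M i) (\<lambda>y. F (x(i := y)))" if "x \<in> space (PiM I M)" for x
    using insert.prems(2) sp[OF that] Fm1[OF that] by (intro Mi.integrable_const_bound[where B = K]) auto
  have K0: "0 \<le> K"
  proof -
    obtain x where "x \<in> space (PiM (insert i I) M)" using PJ.not_empty by blast
    then show ?thesis using insert.prems(2)[of x] by linarith
  qed
  have c0: "0 \<le> c"
  proof -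
    obtain x where x: "x \<in> space (PiM (insert i I) M)" using PJ.not_empty by blast
    obtain y where "y \<in> space (M i)" using Mi.not_empty by blast
    then show ?thesis using insert.prems(3)[OF insertI1 x] by fastforce
  qed
  have GK: "\<bar>G x\<bar> \<le> K" if x: "x \<in> space (PiM I M)" for x
  proof -
    have "\<bar>G x\<bar> \<le> (\<integral>y. \<bar>F (x(i := y))\<bar> \<partial>M i)" unfolding G_def by (rule integral_abs_bound)
    also have "\<dots> \<le> (\<integral>y. K \<partial>M i)"
      using Fi[OF x] insert.prems(2) sp[OF x] by (intro integral_mono) auto
    finally show ?thesis by (simp add: Mi.prob_space)
  qed
  have Gd: "\<bar>G (x(j := z)) - G x\<bar> \<le> c" if j: "j \<in> I" and x: "x \<in> space (PiM I M)" and z: "z \<in> space (M j)" for j x z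
  proof -
    have ij: "i \<noteq> j" using insert.hyps(2) j by auto
    have x': "x(j := z) \<in> space (PiM I M)" using x z j by (auto simp: space_PiM PiE_iff extensional_def)
    have "G (x(j := z)) - G x = (\<integral>y. F (x(j := z, i := y)) - F (x(i := y)) \<partial>M i)"
      unfolding G_def using Fi[OF x] Fi[OF x'] by simp
    also have "\<bar>\<dots>\<bar> \<le> (\<integral>y. \<bar>F (x(j := z, i := y)) - F (x(i := y))\<bar> \<partial>M i)" by (rule integral_abs_bound)
    also have "\<dots> \<le> (\<integral>y. c \<partial>M i)"
    proof (intro integral_mono)
      fix y assume y: "y \<in> space (M i)"
      show "\<bar>F (x(j := z, i := y)) - F (x(i := y))\<bar> \<le> c"
        using insert.prems(3)[OF insertI2[OF j] sp[OF x y] z] unfolding fun_upd_twist[OF ij] .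
    qed (use Fi[OF x] Fi[OF x'] in auto)
    finally show ?thesis by (simp add: Mi.prob_space)
  qed
  define \<mu> where "\<mu> = (\<integral>x. F x \<partial>PiM (insert i I) M)"
  have Fint: "integrable (PiM (insert i I) M) F"
    using insert.prems(2) by (intro PJ.integrable_const_bound[where B = K]) auto
  have \<mu>G: "\<mu> = (\<integral>x. G x \<partial>PiM I M)"
    unfolding \<mu>_def G_def using product_integral_insert[OF insert.hyps(1,2) Fint] .
  have \<mu>K: "\<bar>\<mu>\<bar> \<le> K"
  proof -
    have "\<bar>\<mu>\<bar> \<le> (\<integral>x. \<bar>F x\<bar> \<partial>PiM (insert i I) M)" unfolding \<mu>_def by (rule integral_abs_bound)
    also have "\<dots> \<le> (\<integral>x. K \<partial>PiM (insert i I) M)"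
      using Fint insert.prems(2) by (intro integral_mono) auto
    finally show ?thesis by (simp add: PJ.prob_space)
  qed
  have sq: "(a - \<mu>)\<^sup>2 \<le> (2 * K)\<^sup>2" if "\<bar>a\<bar> \<le> K" for a :: real
    using that \<mu>K K0 by (intro power2_le_iff_abs_le[THEN iffD2]) auto
  have "integrable (PiM (insert i I) M) (\<lambda>x. (F x - \<mu>)\<^sup>2)"
    using insert.prems(2) sq by (intro PJ.integrable_const_bound[where B = "(2 * K)\<^sup>2"]) auto
  from product_integral_insert[OF insert.hyps(1,2) this]
  have "(\<integral>x. (F x - \<mu>)\<^sup>2 \<partial>PiM (insert i I) M) = (\<integral>x. \<integral>y. (F (x(i := y)) - \<mu>)\<^sup>2 \<partial>M i \<partial>PiM I M)" .
  also have "\<dots> \<le> (\<integral>x. c\<^sup>2 + (G x - \<mu>)\<^sup>2 \<partial>PiM I M)"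
  proof (rule integral_mono')
    show "integrable (PiM I M) (\<lambda>x. c\<^sup>2 + (G x - \<mu>)\<^sup>2)"
      using GK sq by (intro PI.integrable_const_bound[where B = "c\<^sup>2 + (2 * K)\<^sup>2"]) auto
    fix x assume x: "x \<in> space (PiM I M)"
    let ?h = "\<lambda>y. F (x(i := y))"
    note [measurable] = Fm1[OF x]
    have hK: "\<bar>?h y\<bar> \<le> K" if "y \<in> space (M i)" for y using insert.prems(2)[OF sp[OF x that]] .
    have d: "\<bar>?h y - G x\<bar> \<le> c" if y: "y \<in> space (M i)" for y
    proof -
      have "?h y - G x = (\<integral>z. ?h y - ?h z \<partial>M i)"
        unfolding G_def using Fi[OF x] by (simp add: Mi.prob_space)
      also have "\<bar>\<dots>\<bar> \<le> (\<integral>z. \<bar>?h y - ?h z\<bar> \<partial>M i)" by (rule integral_abs_bound)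
      also have "\<dots> \<le> (\<integral>z. c \<partial>M i)"
      proof (intro integral_mono)
        fix z assume z: "z \<in> space (M i)"
        show "\<bar>?h y - ?h z\<bar> \<le> c"
          using insert.prems(3)[OF insertI1 sp[OF x z] y] unfolding fun_upd_upd .
      qed (use Fi[OF x] in auto)
      finally show ?thesis by (simp add: Mi.prob_space)
    qed
    have i2: "integrable (M i) (\<lambda>y. (?h y - G x)\<^sup>2)"
      using d c0 by (intro Mi.integrable_const_bound[where B = "c\<^sup>2"]) (auto simp: power2_le_iff_abs_le)
    \<comment> \<open>Expanded around the conditional mean, the cross term integrates to
      zero.\<close>
    have "(?h y - \<mu>)\<^sup>2 = (?h y - G x)\<^sup>2 + 2 * (G x - \<mu>) * (?h y - G x) + (G x - \<mu>)\<^sup>2" for y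
      by (simp add: power2_eq_square algebra_simps)
    then have "(\<integral>y. (?h y - \<mu>)\<^sup>2 \<partial>M i) = (\<integral>y. (?h y - G x)\<^sup>2 \<partial>M i) + 2 * (G x - \<mu>) * (\<integral>y. ?h y - G x \<partial>M i) + (G x - \<mu>)\<^sup>2"
      using i2 Fi[OF x] by (simp add: Mi.prob_space)
    also have "(\<integral>y. ?h y - G x \<partial>M i) = 0"
      unfolding G_def using Fi[OF x] by (simp add: Mi.prob_space)
    also have "(\<integral>y. (?h y - G x)\<^sup>2 \<partial>M i) \<le> (\<integral>y. c\<^sup>2 \<partial>M i)"
      using i2 d c0 by (intro integral_mono) (auto simp: power2_le_iff_abs_le)
    finally show "(\<integral>y. (?h y - \<mu>)\<^sup>2 \<partial>M i) \<le> c\<^sup>2 + (G x - \<mu>)\<^sup>2" by (simp add: Mi.prob_space del: fun_upd_apply)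
  qed simp
  also have "\<dots> = c\<^sup>2 + (\<integral>x. (G x - \<mu>)\<^sup>2 \<partial>PiM I M)"
  proof -
    have "integrable (PiM I M) (\<lambda>x. (G x - \<mu>)\<^sup>2)"
      using GK sq by (intro PI.integrable_const_bound[where B = "(2 * K)\<^sup>2"]) auto
    then show ?thesis by (simp add: PI.prob_space)
  qed
  also have "(\<integral>x. (G x - \<mu>)\<^sup>2 \<partial>PiM I M) \<le> real (card I) * c\<^sup>2"
    unfolding \<mu>G by (rule insert.IH[OF Gm GK Gd])
  finally show ?case using insert.hyps unfolding \<mu>_def by (simp add: algebra_simps)
qed

text \<open>Chebyshev: with mean at least \<open>2 * t\<close>, a value below \<open>t\<close>
  deviates from the mean by at least \<open>t\<close>. In both models there are order n coordinates,
  \<open>t\<close> is of order n and \<open>c\<close> is constant, so the bound is of order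
  1/n.\<close>

lemma bounded_differences_lower_tail:
  fixes M :: "'i \<Rightarrow> 'a measure" and F :: "('i \<Rightarrow> 'a) \<Rightarrow> real"
  assumes M: "\<And>i. prob_space (M i)" and I: "finite I"
    and F[measurable]: "F \<in> borel_measurable (PiM I M)"
    and K: "\<And>x. x \<in> space (PiM I M) \<Longrightarrow> \<bar>F x\<bar> \<le> K"
    and d: "\<And>i x y. i \<in> I \<Longrightarrow> x \<in> space (PiM I M) \<Longrightarrow> y \<in> space (M i) \<Longrightarrow> \<bar>F (x(i := y)) - F x\<bar> \<le> c"
    and t: "0 < t" "2 * t \<le> (\<integral>x. F x \<partial>PiM I M)"
  shows "measure (PiM I M) {x \<in> space (PiM I M). F x < t} \<le> real (card I) * c\<^sup>2 / t\<^sup>2"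
proof -
  interpret P: prob_space "PiM I M" by (rule prob_space_PiM) (rule M)
  let ?\<mu> = "\<integral>x. F x \<partial>PiM I M"
  have K0: "0 \<le> K"
  proof -
    obtain x where "x \<in> space (PiM I M)" using P.not_empty by blast
    then show ?thesis using K[of x] by linarith
  qed
  have "measure (PiM I M) {x \<in> space (PiM I M). F x < t}
      \<le> measure (PiM I M) {x \<in> space (PiM I M). \<bar>F x - ?\<mu>\<bar> \<ge> t}"
    using t by (intro P.finite_measure_mono) auto
  also have "\<dots> \<le> (\<integral>x. (F x - ?\<mu>)\<^sup>2 \<partial>PiM I M) / t\<^sup>2"
    using K K0 t by (intro P.Chebyshev_inequality P.integrable_const_bound[where B = "K\<^sup>2"])
       (auto simp: power2_le_iff_abs_le)
  also have "\<dots> \<le> real (card I) * c\<^sup>2 / t\<^sup>2"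
    using bounded_differences_variance[OF M I F K d] t by (intro divide_right_mono) auto
  finally show ?thesis .
qed

text \<open>\<open>mst\<close> is a choice, but it depends on the outcome only through the set
  \<open>S \<omega>\<close> of all minimal trees. This set takes finitely many values, and where it
  is constant the chosen tree is fixed, so that \<open>eps\<close> is there a minimum of finitely
  many measurable functions.\<close>

lemma (in network) borel_measurable_eps:
  assumes w: "\<And>e. e \<in> E \<Longrightarrow> (\<lambda>\<omega>. w \<omega> e) \<in> borel_measurable M"
  shows "(\<lambda>\<omega>. eps V E (w \<omega>) \<delta>) \<in> borel_measurable M"
proof -
  let ?T = "{T. spanning_tree V E T}"
  have len[measurable]: "(\<lambda>\<omega>. tree_len (w \<omega>) T) \<in> borel_measurable M" if "spanning_tree V E T" for T
    unfolding tree_len_def using spanning_treeD(1)[OF that] w by (intro borel_measurable_sum) blast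
  define S where "S \<omega> = {T. is_mst V E (w \<omega>) T}" for \<omega>
  define g where "g A \<omega> = Min ((\<lambda>T'. (tree_len (w \<omega>) T' - tree_len (w \<omega>) (SOME T. T \<in> A)) / real (card V)) `
    {T'. spanning_tree V E T' \<and> real (card (T' - (SOME T. T \<in> A))) \<ge> \<delta> * real (card V)})" for A \<omega>
  have ST: "S \<omega> \<subseteq> ?T" "S \<omega> \<noteq> {}" for \<omega>
    using is_mst_mst[of "w \<omega>"] by (auto simp: S_def is_mst_def)
  have "eps V E (w \<omega>) \<delta> = g (S \<omega>) \<omega>" for \<omega>
    unfolding eps_def g_def S_def mst_def mem_Collect_eq image_Collect by (rule arg_cong[of _ _ Min]) blast
  moreover have "(\<lambda>\<omega>. g (S \<omega>) \<omega>) \<in> borel_measurable M"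
  proof (rule measurable_compose_countable'[where I = "Pow ?T - {{}}"])
    show "countable (Pow ?T - {{}})"
      using finite_spanning_trees by (intro countable_finite) auto
    show "g A \<in> borel_measurable M" if "A \<in> Pow ?T - {{}}" for A
    proof -
      have "(SOME T. T \<in> A) \<in> A" using that by (intro some_in_eq[THEN iffD2]) auto
      then have "spanning_tree V E (SOME T. T \<in> A)" using that by auto
      note [measurable] = len[OF this]
      have "finite {T'. spanning_tree V E T' \<and> real (card (T' - (SOME T. T \<in> A))) \<ge> \<delta> * real (card V)}"
        by (rule finite_subset[OF _ finite_spanning_trees]) auto
      then show ?thesis unfolding g_def by (intro borel_measurable_Min) (auto intro!: borel_measurable_divide borel_measurable_diff len)
    qed
    show "S \<in> measurable M (count_space (Pow ?T - {{}}))"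
    proof (subst measurable_count_space_eq2)
      show "finite (Pow ?T - {{}})" using finite_spanning_trees by auto
      show "S \<in> space M \<rightarrow> Pow ?T - {{}} \<and> (\<forall>A\<in>Pow ?T - {{}}. S -` {A} \<inter> space M \<in> sets M)"
      proof (intro conjI ballI)
        show "S \<in> space M \<rightarrow> Pow ?T - {{}}" using ST by auto
        fix A assume A: "A \<in> Pow ?T - {{}}"
        \<comment> \<open>Whether \<open>S \<omega>\<close> equals \<open>A\<close> is decided by
          finitely many comparisons of tree lengths, which gives the measurability of
          \<open>S\<close>.\<close>
        have "S \<omega> = A \<longleftrightarrow> (\<forall>T\<in>?T. T \<in> A \<longleftrightarrow> (\<forall>T'\<in>?T. tree_len (w \<omega>) T \<le> tree_len (w \<omega>) T'))" for \<omega>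
        proof -
          have "S \<omega> = A \<longleftrightarrow> (\<forall>T\<in>?T. T \<in> A \<longleftrightarrow> T \<in> S \<omega>)" using ST(1)[of \<omega>] A by blast
          then show ?thesis by (auto simp: S_def is_mst_def)
        qed
        then have "S -` {A} \<inter> space M = {\<omega> \<in> space M. \<forall>T\<in>?T. T \<in> A \<longleftrightarrow> (\<forall>T'\<in>?T. tree_len (w \<omega>) T \<le> tree_len (w \<omega>) T')}"
          by auto
        also have "\<dots> \<in> sets M"
        proof (intro sets.sets_Collect_finite_All finite_spanning_trees)
          fix T assume T: "T \<in> ?T"
          have m: "{\<omega> \<in> space M. \<forall>T'\<in>?T. tree_len (w \<omega>) T \<le> tree_len (w \<omega>) T'} \<in> sets M"
            using T by (intro sets.sets_Collect_finite_All finite_spanning_trees borel_measurable_le len) auto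
          show "{\<omega> \<in> space M. (T \<in> A) = (\<forall>T'\<in>?T. tree_len (w \<omega>) T \<le> tree_len (w \<omega>) T')} \<in> sets M"
            using m sets.sets_Collect_neg[OF m] by (cases "T \<in> A") simp_all
        qed
        finally show "S -` {A} \<inter> space M \<in> sets M" .
      qed
    qed
  qed
  ultimately show ?thesis by simp
qed

lemma (in prob_space) expectation_card:
  assumes J: "finite J" and m: "\<And>j. j \<in> J \<Longrightarrow> {\<omega> \<in> space M. Q j \<omega>} \<in> events"
  shows "(\<lambda>\<omega>. real (card {j \<in> J. Q j \<omega>})) \<in> borel_measurable M"
    and "expectation (\<lambda>\<omega>. real (card {j \<in> J. Q j \<omega>})) = (\<Sum>j\<in>J. prob {\<omega> \<in> space M. Q j \<omega>})"
proof -
  have eq: "real (card {j \<in> J. Q j \<omega>}) = (\<Sum>j\<in>J. indicator {\<omega> \<in> space M. Q j \<omega>} \<omega>)" if "\<omega> \<in> space M" for \<omega>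
  proof -
    have "real (card {j \<in> J. Q j \<omega>}) = (\<Sum>j\<in>J. if Q j \<omega> then 1 else 0)"
      using J by (simp add: sum.If_cases Int_def)
    also have "\<dots> = (\<Sum>j\<in>J. indicator {\<omega> \<in> space M. Q j \<omega>} \<omega>)"
      using that by (intro sum.cong) (auto simp: indicator_def)
    finally show ?thesis .
  qed
  have "(\<lambda>\<omega>. \<Sum>j\<in>J. indicator {\<omega> \<in> space M. Q j \<omega>} \<omega> :: real) \<in> borel_measurable M"
    using m by (intro borel_measurable_sum borel_measurable_indicator)
  then show "(\<lambda>\<omega>. real (card {j \<in> J. Q j \<omega>})) \<in> borel_measurable M"
    using eq by (subst measurable_cong) auto
  have "expectation (\<lambda>\<omega>. real (card {j \<in> J. Q j \<omega>})) = expectation (\<lambda>\<omega>. \<Sum>j\<in>J. indicator {\<omega> \<in> space M. Q j \<omega>} \<omega>)"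
    using eq by (intro Bochner_Integration.integral_cong) auto
  also have "\<dots> = (\<Sum>j\<in>J. expectation (indicator {\<omega> \<in> space M. Q j \<omega>}))"
    using m by (intro Bochner_Integration.integral_sum integrable_real_indicator) (auto simp: emeasure_eq_measure)
  also have "\<dots> = (\<Sum>j\<in>J. prob {\<omega> \<in> space M. Q j \<omega>})"
    using m by (intro sum.cong) (auto simp: Int_absorb2)
  finally show "expectation (\<lambda>\<omega>. real (card {j \<in> J. Q j \<omega>})) = (\<Sum>j\<in>J. prob {\<omega> \<in> space M. Q j \<omega>})" .
qed

text \<open>The bound is asked only for large n at each fixed \<open>\<delta>\<close>, so error
  terms that vanish as n grows may carry constants depending on \<open>\<delta>\<close>.\<close>

lemma Limsup_scaled_finite:
  fixes F :: "nat \<Rightarrow> real \<Rightarrow> real"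
  assumes "0 < \<delta>0" and ev: "\<And>\<delta>. 0 < \<delta> \<Longrightarrow> \<delta> < \<delta>0 \<Longrightarrow> eventually (\<lambda>n. F n \<delta> \<le> C * \<delta>\<^sup>2) sequentially"
  shows "Limsup (at_right 0) (\<lambda>\<delta>::real. ereal (1 / \<delta>\<^sup>2) * limsup (\<lambda>n. ereal (F n \<delta>))) < \<infinity>"
proof -
  have "ereal (1 / \<delta>\<^sup>2) * limsup (\<lambda>n. ereal (F n \<delta>)) \<le> ereal C" if d: "0 < \<delta>" "\<delta> < \<delta>0" for \<delta>
  proof -
    have "limsup (\<lambda>n. ereal (F n \<delta>)) \<le> ereal (C * \<delta>\<^sup>2)"
      by (rule Limsup_bounded) (use ev[OF d] in simp)
    then have "ereal (1 / \<delta>\<^sup>2) * limsup (\<lambda>n. ereal (F n \<delta>)) \<le> ereal (1 / \<delta>\<^sup>2) * ereal (C * \<delta>\<^sup>2)"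
      by (intro ereal_mult_left_mono) auto
    then show ?thesis using d by simp
  qed
  then have "eventually (\<lambda>\<delta>. ereal (1 / \<delta>\<^sup>2) * limsup (\<lambda>n. ereal (F n \<delta>)) \<le> ereal C) (at_right 0)"
    using assms(1) unfolding eventually_at_right_field by blast
  then have "Limsup (at_right 0) (\<lambda>\<delta>::real. ereal (1 / \<delta>\<^sup>2) * limsup (\<lambda>n. ereal (F n \<delta>))) \<le> ereal C"
    by (rule Limsup_bounded)
  then show ?thesis using less_ereal.simps(4) by (metis ereal_less_PInfty order_le_less_trans)
qed

lemma Liminf_scaled_pos:
  fixes F :: "nat \<Rightarrow> real \<Rightarrow> real"
  assumes "0 < \<delta>0" "0 < c" and ev: "\<And>\<delta>. 0 < \<delta> \<Longrightarrow> \<delta> < \<delta>0 \<Longrightarrow> eventually (\<lambda>n. c * \<delta>\<^sup>2 \<le> F n \<delta>) sequentially"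
  shows "Liminf (at_right 0) (\<lambda>\<delta>::real. ereal (1 / \<delta>\<^sup>2) * liminf (\<lambda>n. ereal (F n \<delta>))) > 0"
proof -
  have "ereal c \<le> ereal (1 / \<delta>\<^sup>2) * liminf (\<lambda>n. ereal (F n \<delta>))" if d: "0 < \<delta>" "\<delta> < \<delta>0" for \<delta>
  proof -
    have "ereal (c * \<delta>\<^sup>2) \<le> liminf (\<lambda>n. ereal (F n \<delta>))"
      by (rule Liminf_bounded) (use ev[OF d] in simp)
    then have "ereal (1 / \<delta>\<^sup>2) * ereal (c * \<delta>\<^sup>2) \<le> ereal (1 / \<delta>\<^sup>2) * liminf (\<lambda>n. ereal (F n \<delta>))"
      by (intro ereal_mult_left_mono) auto
    then show ?thesis using d by simp
  qed
  then have "eventually (\<lambda>\<delta>. ereal c \<le> ereal (1 / \<delta>\<^sup>2) * liminf (\<lambda>n. ereal (F n \<delta>))) (at_right 0)"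
    using assms(1) unfolding eventually_at_right_field by blast
  then have "ereal c \<le> Liminf (at_right 0) (\<lambda>\<delta>::real. ereal (1 / \<delta>\<^sup>2) * liminf (\<lambda>n. ereal (F n \<delta>)))"
    by (rule Liminf_bounded)
  then show ?thesis using assms(2) by (metis ereal_less(2) order_less_le_trans)
qed

section \<open>Volume of the level sets of a Lipschitz function\<close>

lemma nn_integral_affine:
  fixes f :: "'a::euclidean_space \<Rightarrow> ennreal"
  assumes [measurable]: "f \<in> borel_measurable borel" and "c \<noteq> 0"
  shows "(\<integral>\<^sup>+ p. f p \<partial>lborel) = ennreal (\<bar>c\<bar> ^ DIM('a)) * (\<integral>\<^sup>+ p. f (t + c *\<^sub>R p) \<partial>lborel)"
  by (subst lborel_affine[OF assms(2), of t])
     (simp add: nn_integral_density nn_integral_distr nn_integral_cmult)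

lemma lipschitz_borel:
  fixes L :: "'a::euclidean_space \<Rightarrow> real"
  assumes "\<And>p q. \<bar>L p - L q\<bar> \<le> dist p q"
  shows "L \<in> borel_measurable borel"
proof (rule borel_measurable_continuous_onI, rule lipschitz_on_continuous_on)
  show "1-lipschitz_on UNIV L" using assms by (intro lipschitz_onI) (auto simp: dist_real_def)
qed

text \<open>On each level set the map $r \mapsto (1 + x/R) r - l(r)$ is affine of slope at least one, it is
  globally injective because $l$ is 1-Lipschitz, and it sends the set into $[0, 2x]$.\<close>

lemma lipschitz_levels_measure_real:
  fixes l :: "real \<Rightarrow> real"
  assumes lip: "\<And>s t. \<bar>l s - l t\<bar> \<le> \<bar>s - t\<bar>" and A: "finite A" and x: "0 < x" and R: "0 < R"
  shows "emeasure lborel {r \<in> {0..R}. 0 \<le> r - l r \<and> r - l r \<le> x \<and> l r \<in> A} \<le> ennreal (2 * x)"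
proof -
  have [measurable]: "l \<in> borel_measurable borel" using lip by (intro lipschitz_borel) (simp add: dist_real_def)
  \<comment> \<open>The slope must exceed one, since \<open>l\<close> may itself have slope one and
    injectivity would then fail. On an interval of length \<open>R\<close> the excess
    \<open>x / R\<close> displaces the values by at most \<open>x\<close>, which is the second
    \<open>x\<close> in the bound.\<close>
  define e where "e = x / R"
  define c where "c = 1 / (1 + e)"
  have e: "0 < e" using x R by (simp add: e_def)
  have c: "0 < c" "c \<le> 1" using e by (auto simp: c_def)
  define S where "S a = {r \<in> {0..R}. 0 \<le> r - l r \<and> r - l r \<le> x \<and> l r = a}" for a
  have [measurable]: "S a \<in> sets borel" for a unfolding S_def by measurable
  have eqS: "{r \<in> {0..R}. 0 \<le> r - l r \<and> r - l r \<le> x \<and> l r \<in> A} = (\<Union>a\<in>A. S a)"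
    by (auto simp: S_def)
  have psi: "y = (1 + e) * r - l r" if "r = c * a + c * y" "r \<in> S a" for y r a
  proof -
    have "(1 + e) * r = ((1 + e) * c) * (a + y)" unfolding that(1) by (simp add: algebra_simps)
    also have "(1 + e) * c = 1" using e by (simp add: c_def)
    finally show ?thesis using that(2) by (simp add: S_def)
  qed
  have inj: "r = r'" if "(1 + e) * r - l r = (1 + e) * r' - l r'" for r r'
  proof (rule ccontr)
    assume ne: "r \<noteq> r'"
    have "\<bar>l r - l r'\<bar> = (1 + e) * \<bar>r - r'\<bar>"
    proof -
      have "l r - l r' = (1 + e) * (r - r')" using that by (simp add: algebra_simps)
      then show ?thesis using e by (simp add: abs_mult)
    qed
    moreover have "e * \<bar>r - r'\<bar> > 0" using e ne by simp
    ultimately show False using lip[of r r'] by (simp add: algebra_simps)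
  qed
  \<comment> \<open>In the coordinate \<open>y = (1 + e) * r - l r\<close> the level sets for
    different \<open>a\<close> are disjoint, so the number of values in \<open>A\<close> does not
    enter the bound.\<close>
  have pt: "(\<Sum>a\<in>A. indicator (S a) (c * a + c * y)) \<le> (indicator {0..2 * x} y :: ennreal)" for y
  proof (cases "\<exists>a\<in>A. c * a + c * y \<in> S a")
    case True
    then obtain a where a: "a \<in> A" "c * a + c * y \<in> S a" by blast
    have other: "indicator (S b) (c * b + c * y) = (0::ennreal)" if "b \<in> A - {a}" for b
    proof -
      have "c * b + c * y \<notin> S b"
      proof
        assume b: "c * b + c * y \<in> S b"
        have "c * a + c * y = c * b + c * y" using inj psi[OF refl a(2)] psi[OF refl b] by metis
        then have "a = b" using c by simp
        then show False using that by simp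
      qed
      then show ?thesis by simp
    qed
    have "(\<Sum>b\<in>A. indicator (S b) (c * b + c * y)) = (indicator (S a) (c * a + c * y) :: ennreal)"
      using other a(1) by (subst sum.remove[OF A a(1)]) (simp add: sum.neutral)
    moreover have "y \<in> {0..2 * x}"
    proof -
      define r where "r = c * a + c * y"
      have r: "0 \<le> r" "r \<le> R" "0 \<le> r - l r" "r - l r \<le> x" using a(2) unfolding S_def r_def by auto
      have "y = e * r + (r - l r)" using psi[OF r_def] a(2) r_def by (simp add: algebra_simps)
      moreover have "0 \<le> e * r" "e * r \<le> e * R" using r e by auto
      moreover have "e * R = x" using R by (simp add: e_def)
      ultimately show ?thesis using r by simp
    qed
    ultimately show ?thesis using a by simp
  next
    case False
    then have "(\<Sum>a\<in>A. indicator (S a) (c * a + c * y)) = (0::ennreal)" by (intro sum.neutral) auto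
    then show ?thesis by simp
  qed
  have "emeasure lborel (\<Union>a\<in>A. S a) \<le> (\<Sum>a\<in>A. emeasure lborel (S a))"
    by (intro emeasure_subadditive_finite A) auto
  also have "\<dots> = (\<Sum>a\<in>A. ennreal c * (\<integral>\<^sup>+ y. indicator (S a) (c * a + c * y) \<partial>lborel))"
  proof (intro sum.cong refl)
    fix a
    have "emeasure lborel (S a) = (\<integral>\<^sup>+ y. indicator (S a) y \<partial>lborel)" by simp
    also have "\<dots> = ennreal c * (\<integral>\<^sup>+ y. indicator (S a) (c * a + c * y) \<partial>lborel)"
      using c by (subst nn_integral_real_affine[where t = "c * a" and c = c]) auto
    finally show "emeasure lborel (S a) = ennreal c * (\<integral>\<^sup>+ y. indicator (S a) (c * a + c * y) \<partial>lborel)" .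
  qed
  also have "\<dots> \<le> (\<Sum>a\<in>A. 1 * (\<integral>\<^sup>+ y. indicator (S a) (c * a + c * y) \<partial>lborel))"
    using c by (intro sum_mono mult_right_mono) auto
  also have "\<dots> = (\<integral>\<^sup>+ y. (\<Sum>a\<in>A. indicator (S a) (c * a + c * y)) \<partial>lborel)"
    by (simp add: nn_integral_sum)
  also have "\<dots> \<le> (\<integral>\<^sup>+ y. indicator {0..2 * x} y \<partial>lborel)"
    by (intro nn_integral_mono pt)
  also have "\<dots> = ennreal (2 * x)" using x by simp
  finally show ?thesis unfolding eqS .
qed

text \<open>Averaging over dilations about $c$ replaces polar coordinates.\<close>

lemma lipschitz_levels_measure_dyadic:
  fixes L :: "'a::euclidean_space \<Rightarrow> real"
  assumes lip: "\<And>p q. \<bar>L p - L q\<bar> \<le> dist p q" and A: "finite A" and x: "0 < x" and \<rho>: "0 < \<rho>"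
  shows "emeasure lborel {p. \<rho> \<le> dist c p \<and> dist c p \<le> 2 * \<rho> \<and> 0 \<le> dist c p - L p \<and> dist c p - L p \<le> x \<and> L p \<in> A}
    \<le> ennreal (4 * 4 ^ DIM('a) * unit_ball_vol DIM('a) * x * \<rho> ^ (DIM('a) - 1))" (is "emeasure lborel ?U \<le> _")
proof -
  have [measurable]: "L \<in> borel_measurable borel" using lip by (rule lipschitz_borel)
  have [measurable]: "A \<in> sets borel" using A by (simp add: finite_imp_closed)
  have Um[measurable]: "?U \<in> sets borel" by measurable
  let ?d = "DIM('a)"
  \<comment> \<open>Along the ray through \<open>p\<close> the one-dimensional bound applies to
    \<open>L\<close> as a function of the distance from \<open>c\<close>. Passing from dilation
    factor to distance divides by \<open>norm p\<close>, which is at least \<open>\<rho> / 2\<close>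
    whenever some dilation lands in the shell.\<close>
  have inner: "(\<integral>\<^sup>+ s. indicator {1..2} s * indicator ?U (c + s *\<^sub>R p) \<partial>lborel) \<le> ennreal (4 * x / \<rho>) * indicator (cball 0 (2 * \<rho>)) p" for p
  proof (cases "norm p < \<rho> / 2 \<or> 2 * \<rho> < norm p")
    case True
    have "indicator {1..2} s * indicator ?U (c + s *\<^sub>R p) = (0::ennreal)" for s :: real
    proof (cases "s \<in> {1..2}")
      case s: True
      have "c + s *\<^sub>R p \<notin> ?U"
      proof
        assume "c + s *\<^sub>R p \<in> ?U"
        then have "\<rho> \<le> s * norm p" "s * norm p \<le> 2 * \<rho>" using s by (auto simp: dist_norm)
        moreover have "1 * norm p \<le> s * norm p" "s * norm p \<le> 2 * norm p"
          using s by (intro mult_right_mono; simp)+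
        ultimately show False using True by linarith
      qed
      then show ?thesis by simp
    qed simp
    then show ?thesis by (simp only: nn_integral_const mult_zero_left zero_le)
  next
    case False
    define l where "l r = L (c + (r / norm p) *\<^sub>R p)" for r
    have np: "0 < norm p" using False \<rho> by auto
    have lipl: "\<bar>l s - l t\<bar> \<le> \<bar>s - t\<bar>" for s t
    proof -
      have "(s / norm p) *\<^sub>R p - (t / norm p) *\<^sub>R p = ((s - t) / norm p) *\<^sub>R p"
        by (simp add: scaleR_left_diff_distrib[symmetric] diff_divide_distrib)
      then have "dist (c + (s / norm p) *\<^sub>R p) (c + (t / norm p) *\<^sub>R p) = \<bar>s - t\<bar>"
        using np by (simp add: dist_norm)
      then show ?thesis using lip unfolding l_def by metis
    qed
    let ?S = "{r \<in> {0..2 * \<rho>}. 0 \<le> r - l r \<and> r - l r \<le> x \<and> l r \<in> A}"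
    have [measurable]: "l \<in> borel_measurable borel" using lipl by (intro lipschitz_borel) (simp add: dist_real_def)
    have [measurable]: "?S \<in> sets borel" by measurable
    have "(\<integral>\<^sup>+ s. indicator {1..2} s * indicator ?U (c + s *\<^sub>R p) \<partial>lborel) \<le> (\<integral>\<^sup>+ s. indicator ?S (0 + norm p * s) \<partial>lborel)"
    proof (intro nn_integral_mono)
      fix s :: real
      show "indicator {1..2} s * indicator ?U (c + s *\<^sub>R p) \<le> (indicator ?S (0 + norm p * s) :: ennreal)"
        using np by (auto simp: indicator_def l_def dist_norm mult.commute)
    qed
    also have "\<dots> = ennreal (1 / norm p) * (ennreal (norm p) * (\<integral>\<^sup>+ s. indicator ?S (0 + norm p * s) \<partial>lborel))"
      using np by (simp add: mult.assoc[symmetric] ennreal_mult[symmetric])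
    also have "ennreal (norm p) * (\<integral>\<^sup>+ s. indicator ?S (0 + norm p * s) \<partial>lborel) = emeasure lborel ?S"
    proof -
      have "emeasure lborel ?S = (\<integral>\<^sup>+ s. indicator ?S s \<partial>lborel)" by simp
      also have "\<dots> = ennreal \<bar>norm p\<bar> * (\<integral>\<^sup>+ s. indicator ?S (0 + norm p * s) \<partial>lborel)"
        using np by (intro nn_integral_real_affine) auto
      finally show ?thesis by simp
    qed
    also have "emeasure lborel ?S \<le> ennreal (2 * x)"
      using lipschitz_levels_measure_real[OF lipl A x, of "2 * \<rho>"] \<rho> by simp
    also have "ennreal (1 / norm p) * ennreal (2 * x) = ennreal (2 * x / norm p)"
      using np x by (simp add: ennreal_mult[symmetric])
    also have "\<dots> \<le> ennreal (4 * x / \<rho>)"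
      using np x \<rho> False by (intro ennreal_leI) (simp add: field_simps)
    finally show ?thesis using False by (simp add: mult_left_mono)
  qed
  \<comment> \<open>The volume is averaged over dilation factors \<open>s\<close> between 1 and 2,
    each costing a Jacobian of at most \<open>2 ^ ?d\<close>. After exchanging the integrals the
    inner one runs along a ray.\<close>
  have "emeasure lborel ?U = (\<integral>\<^sup>+ s. indicator {1..2::real} s * emeasure lborel ?U \<partial>lborel)"
    by (simp add: nn_integral_multc)
  also have "\<dots> \<le> (\<integral>\<^sup>+ s. ennreal (2 ^ ?d) * (\<integral>\<^sup>+ p. indicator {1..2} s * indicator ?U (c + s *\<^sub>R p) \<partial>lborel) \<partial>lborel)"
  proof (intro nn_integral_mono)
    fix s :: real
    show "indicator {1..2} s * emeasure lborel ?U \<le> ennreal (2 ^ ?d) * (\<integral>\<^sup>+ p. indicator {1..2} s * indicator ?U (c + s *\<^sub>R p) \<partial>lborel)"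
    proof (cases "s \<in> {1..2}")
      case True
      have "emeasure lborel ?U = (\<integral>\<^sup>+ p. indicator ?U p \<partial>lborel)" by simp
      also have "\<dots> = ennreal (\<bar>s\<bar> ^ ?d) * (\<integral>\<^sup>+ p. indicator ?U (c + s *\<^sub>R p) \<partial>lborel)"
        using True by (intro nn_integral_affine) auto
      also have "\<dots> \<le> ennreal (2 ^ ?d) * (\<integral>\<^sup>+ p. indicator ?U (c + s *\<^sub>R p) \<partial>lborel)"
        using True by (intro mult_right_mono ennreal_leI power_mono) auto
      finally show ?thesis using True by simp
    qed simp
  qed
  also have "\<dots> = ennreal (2 ^ ?d) * (\<integral>\<^sup>+ s. \<integral>\<^sup>+ p. indicator {1..2} s * indicator ?U (c + s *\<^sub>R p) \<partial>lborel \<partial>lborel)"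
    by (intro nn_integral_cmult) measurable
  also have "(\<integral>\<^sup>+ s. \<integral>\<^sup>+ p. indicator {1..2} s * indicator ?U (c + s *\<^sub>R p) \<partial>lborel \<partial>lborel)
      = (\<integral>\<^sup>+ p. \<integral>\<^sup>+ s. indicator {1..2} s * indicator ?U (c + s *\<^sub>R p) \<partial>lborel \<partial>lborel)"
    by (rule lborel_pair.Fubini'[symmetric]) measurable
  also have "\<dots> \<le> (\<integral>\<^sup>+ p. ennreal (4 * x / \<rho>) * indicator (cball 0 (2 * \<rho>)) p \<partial>(lborel :: 'a measure))"
    by (intro nn_integral_mono inner)
  also have "\<dots> = ennreal (4 * x / \<rho>) * emeasure lborel (cball (0::'a) (2 * \<rho>))"
    by (rule nn_integral_cmult_indicator) simp
  also have "emeasure lborel (cball (0::'a) (2 * \<rho>)) = ennreal (unit_ball_vol ?d * (2 * \<rho>) ^ ?d)"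
    using \<rho> by (intro emeasure_cball) auto
  also have "ennreal (2 ^ ?d) * (ennreal (4 * x / \<rho>) * ennreal (unit_ball_vol ?d * (2 * \<rho>) ^ ?d))
      = ennreal (2 ^ ?d * (4 * x / \<rho>) * (unit_ball_vol ?d * (2 * \<rho>) ^ ?d))"
  proof -
    have "ennreal a * (ennreal b * ennreal c) = ennreal (a * b * c)" if "0 \<le> a" "0 \<le> b" "0 \<le> c" for a b c
      using that by (simp add: ennreal_mult mult.assoc)
    then show ?thesis using x \<rho> by simp
  qed
  also have "2 ^ ?d * (4 * x / \<rho>) * (unit_ball_vol ?d * (2 * \<rho>) ^ ?d) = 4 * 4 ^ ?d * unit_ball_vol ?d * x * \<rho> ^ (?d - 1)"
  proof -
    have "\<rho> ^ ?d = \<rho> * \<rho> ^ (?d - 1)" by (metis DIM_positive power_minus_mult mult.commute)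
    moreover have "(4::real) ^ ?d = 2 ^ ?d * 2 ^ ?d" by (simp add: power_mult_distrib[symmetric])
    ultimately show ?thesis using \<rho> by (simp add: power_mult_distrib)
  qed
  finally show ?thesis by (simp add: mult_left_mono)
qed

text \<open>For \<open>q \<ge> 1\<close> the shell lies in a single dyadic one. The unit ball,
  \<open>q = 0\<close>, is cut into dyadic shells of radius \<open>\<rho>\<close> tending to 0,
  whose bounds of order \<open>x * \<rho> ^ (DIM('a) - 1)\<close> are summable because the dimension
  is at least two.\<close>

lemma lipschitz_levels_measure_shell:
  fixes L :: "'a::euclidean_space \<Rightarrow> real"
  assumes d: "2 \<le> DIM('a)"
    and lip: "\<And>p q. \<bar>L p - L q\<bar> \<le> dist p q" and A: "finite A" and x: "0 < x"
  shows "emeasure lborel {p. real q \<le> dist c p \<and> dist c p < real q + 1 \<and> 0 \<le> dist c p - L p \<and> dist c p - L p \<le> x \<and> L p \<in> A}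
    \<le> ennreal (4 * 4 ^ DIM('a) * unit_ball_vol DIM('a) * x * real (q + 1) ^ DIM('a))" (is "emeasure lborel ?V \<le> ennreal (?K * x * _ ^ ?d)")
proof -
  have [measurable]: "L \<in> borel_measurable borel" using lip by (rule lipschitz_borel)
  let ?U = "\<lambda>\<rho>. {p. \<rho> \<le> dist c p \<and> dist c p \<le> 2 * \<rho> \<and> 0 \<le> dist c p - L p \<and> dist c p - L p \<le> x \<and> L p \<in> A}"
  have [measurable]: "A \<in> sets borel" using A by (simp add: finite_imp_closed)
  have Um[measurable]: "?U \<rho> \<in> sets borel" for \<rho> by measurable
  have K: "0 \<le> ?K" by (simp add: unit_ball_vol_nonneg)
  show ?thesis
  proof (cases "q = 0")
    case False
    then have "?V \<subseteq> ?U (real q)" by auto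
    then have "emeasure lborel ?V \<le> emeasure lborel (?U (real q))" by (intro emeasure_mono) auto
    also have "\<dots> \<le> ennreal (?K * x * real q ^ (?d - 1))"
      using lipschitz_levels_measure_dyadic[OF lip A x, of "real q" c] False by simp
    also have "\<dots> \<le> ennreal (?K * x * real (q + 1) ^ ?d)"
    proof (intro ennreal_leI mult_left_mono)
      have "real q ^ (?d - 1) \<le> real (q + 1) ^ (?d - 1)" by (intro power_mono) auto
      also have "\<dots> \<le> real (q + 1) ^ ?d" by (intro power_increasing) auto
      finally show "real q ^ (?d - 1) \<le> real (q + 1) ^ ?d" .
    qed (use K x in auto)
    finally show ?thesis .
  next
    case True
    have "?V \<subseteq> {c} \<union> (\<Union>m. ?U ((1 / 2) ^ Suc m))"
    proof
      fix p assume p: "p \<in> ?V"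
      show "p \<in> {c} \<union> (\<Union>m. ?U ((1 / 2) ^ Suc m))"
      proof (cases "p = c")
        case ne: False
        then have pos: "0 < dist c p" by simp
        have "\<exists>m. (1 / 2) ^ m \<le> dist c p" using real_arch_pow_inv[OF pos, of "1 / 2"] by (auto intro: less_imp_le)
        then obtain m where m: "(1 / 2) ^ m \<le> dist c p" "\<And>k. k < m \<Longrightarrow> \<not> (1 / 2) ^ k \<le> dist c p"
          using exists_least_iff[of "\<lambda>m. (1 / 2) ^ m \<le> dist c p"] by blast
        have "m \<noteq> 0" using m(1) p True by (intro notI) auto
        then obtain k where k: "m = Suc k" using not0_implies_Suc by blast
        have "dist c p \<le> 2 * (1 / 2) ^ Suc k" using m(2)[of k] k by simp
        then have "p \<in> ?U ((1 / 2) ^ Suc k)" using m(1) p k by simp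
        then show ?thesis by blast
      qed simp
    qed
    then have "emeasure lborel ?V \<le> emeasure lborel ({c} \<union> (\<Union>m. ?U ((1 / 2) ^ Suc m)))"
      by (intro emeasure_mono) auto
    also have "\<dots> \<le> emeasure lborel {c} + emeasure lborel (\<Union>m. ?U ((1 / 2) ^ Suc m))"
      by (intro emeasure_subadditive) auto
    also have "\<dots> = emeasure lborel (\<Union>m. ?U ((1 / 2) ^ Suc m))" by simp
    also have "\<dots> \<le> (\<Sum>m. emeasure lborel (?U ((1 / 2) ^ Suc m)))"
      by (intro emeasure_subadditive_countably) auto
    also have "\<dots> \<le> (\<Sum>m. ennreal (?K * x * (1 / 2) ^ Suc m))"
    proof (intro suminf_le)
      fix m
      have "emeasure lborel (?U ((1 / 2) ^ Suc m)) \<le> ennreal (?K * x * ((1 / 2) ^ Suc m) ^ (?d - 1))"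
        by (rule lipschitz_levels_measure_dyadic[OF lip A x]) simp
      also have "\<dots> \<le> ennreal (?K * x * (1 / 2) ^ Suc m)"
      proof (intro ennreal_leI mult_left_mono)
        have "((1 / 2) ^ Suc m) ^ (?d - 1) \<le> ((1 / 2 :: real) ^ Suc m) ^ 1"
          using d by (intro power_decreasing power_le_one) auto
        then show "((1 / 2) ^ Suc m) ^ (?d - 1) \<le> ((1 / 2 :: real) ^ Suc m)" by simp
      qed (use K x in auto)
      finally show "emeasure lborel (?U ((1 / 2) ^ Suc m)) \<le> ennreal (?K * x * (1 / 2) ^ Suc m)" .
    qed auto
    also have "\<dots> = ennreal (?K * x * 1)"
    proof (intro suminf_ennreal_eq)
      show "(\<lambda>m. ?K * x * (1 / 2) ^ Suc m) sums (?K * x * 1)"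
        by (intro sums_mult power_half_series)
    qed (use K x in auto)
    finally show ?thesis using True by simp
  qed
qed

section \<open>Bounds for the cost of a far spanning tree\<close>

context network
begin

text \<open>Absolute values make this valid for every weight function, thus at every outcome; it
  leads to the integrable majorant of \<open>eps\<close> on the lattice.\<close>

lemma tree_len_diff_le:
  assumes "spanning_tree V E T'" "spanning_tree V E T"
  shows "tree_len w T' - tree_len w T \<le> (\<Sum>e\<in>E. \<bar>w e\<bar>)"
proof -
  note D = spanning_treeD[OF assms(1)] spanning_treeD[OF assms(2)]
  have "tree_len w T' - tree_len w T = tree_len w (T' - T) - tree_len w (T - T')"
    using D sum.Int_Diff[of T' w T] sum.Int_Diff[of T w T'] by (simp add: tree_len_def Int_commute)
  also have "\<dots> \<le> (\<Sum>e\<in>T' - T. \<bar>w e\<bar>) + (\<Sum>e\<in>T - T'. \<bar>w e\<bar>)"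
  proof -
    have "tree_len w (T' - T) \<le> (\<Sum>e\<in>T' - T. \<bar>w e\<bar>)" unfolding tree_len_def by (intro sum_mono) simp
    moreover have "- tree_len w (T - T') \<le> (\<Sum>e\<in>T - T'. \<bar>w e\<bar>)"
      unfolding tree_len_def sum_negf[symmetric] by (intro sum_mono) simp
    ultimately show ?thesis by simp
  qed
  also have "\<dots> = (\<Sum>e\<in>(T' - T) \<union> (T - T'). \<bar>w e\<bar>)"
    using D by (intro sum.union_disjoint[symmetric]) auto
  also have "\<dots> \<le> (\<Sum>e\<in>E. \<bar>w e\<bar>)"
    using D finite_E by (intro sum_mono2) auto
  finally show ?thesis .
qed

text \<open>Exchanges preserve the cardinality and lead from \<open>T'\<close> to \<open>T\<close>.
  In the complete graph the common size is then read off from a star.\<close>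

lemma card_spanning_tree_eq:
  assumes "spanning_tree V E T" "spanning_tree V E T'"
  shows "card T' = card T"
  using assms(2)
proof (induction "card (T' - T)" arbitrary: T')
  case 0
  then have sub: "T' \<subseteq> T" using spanning_treeD(2)[OF 0(2)] by auto
  have "T \<subseteq> T'"
  proof (rule subsetI, rule ccontr)
    fix e assume e: "e \<in> T" "e \<notin> T'"
    obtain u v where uv: "u \<in> V" "v \<in> V" "e = {u, v}" using edge spanning_treeD(1)[OF assms(1)] e(1) by blast
    have "T' \<subseteq> T - {e}" using sub e by blast
    with spanning_treeD(4)[OF 0(2) uv(1,2)] have "conn (T - {e}) u v" by (rule conn_mono)
    then show False using acyclicD[OF spanning_treeD(3)[OF assms(1)]] e uv by blast
  qed
  then show ?case using sub by simp
next
  case (Suc k)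
  have fin: "finite T'" using spanning_treeD(2)[OF Suc(3)] .
  obtain e where e: "e \<in> T'" "e \<notin> T" using Suc(2) by (metis DiffE card.empty equals0I nat.distinct(1))
  obtain f where f: "f \<in> T" "f \<notin> T'" and s2: "spanning_tree V E (insert f (T' - {e}))"
    using spanning_tree_exchange[OF assms(1) Suc(3) e] by blast
  have "insert f (T' - {e}) - T = (T' - T) - {e}" using f e by auto
  then have "k = card (insert f (T' - {e}) - T)" using Suc(2) e fin by simp
  from Suc(1)[OF this s2] have "card (insert f (T' - {e})) = card T" .
  moreover have "0 < card T'" using e fin card_gt_0_iff by blast
  ultimately show ?case using f e fin by simp
qed

text \<open>The possible bypasses form a finite family that does not depend on the weights. This
  makes \<open>bypass\<close> a finite combination of length comparisons, hence measurable, and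
  shows that at a given level it ignores the length of \<open>e\<close> itself.\<close>

definition bypasses :: "'v set \<Rightarrow> 'v set set set" where
  "bypasses e = {S. S \<subseteq> E - {e} \<and> (\<exists>u v. e = {u, v} \<and> conn S u v)}"

lemma finite_bypasses: "finite (bypasses e)"
  by (rule finite_subset[of _ "Pow E"]) (auto simp: bypasses_def finite_E)

lemma bypass_iff: "bypass w l e \<longleftrightarrow> (\<exists>S\<in>bypasses e. \<forall>g\<in>S. w g \<le> l)"
  unfolding bypass_def bypasses_def by blast

lemma sets_bypass:
  assumes w: "\<And>e. e \<in> E \<Longrightarrow> (\<lambda>\<omega>. w \<omega> e) \<in> borel_measurable M" and l: "l \<in> borel_measurable M"
  shows "{\<omega> \<in> space M. bypass (w \<omega>) (l \<omega>) e} \<in> sets M"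
  unfolding bypass_iff
proof (intro sets.sets_Collect_finite_Ex finite_bypasses sets.sets_Collect_finite_All borel_measurable_le w l)
  fix S g assume "S \<in> bypasses e" 
  then have S: "S \<subseteq> E" by (auto simp: bypasses_def)
  then show "finite S" using finite_E finite_subset by blast
  show "g \<in> S \<Longrightarrow> g \<in> E" using S by blast
qed

lemma sets_near_ties:
  assumes w: "\<And>e. e \<in> E \<Longrightarrow> (\<lambda>\<omega>. w \<omega> e) \<in> borel_measurable M"
  shows "{\<omega> \<in> space M. e \<in> near_ties (w \<omega>) x} \<in> sets M"
proof (cases "e \<in> E")
  case True
  note [measurable] = w[OF True]
  have "{\<omega> \<in> space M. e \<in> near_ties (w \<omega>) x}
      = {\<omega> \<in> space M. bypass (w \<omega>) (w \<omega> e) e} - {\<omega> \<in> space M. bypass (w \<omega>) (w \<omega> e - x) e}"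
    using True by (auto simp: near_ties_def)
  also have "\<dots> \<in> sets M"
    using True by (intro sets.Diff sets_bypass w borel_measurable_diff borel_measurable_const)
  finally show ?thesis .
next
  case False
  then have "{\<omega> \<in> space M. e \<in> near_ties (w \<omega>) x} = {}" by (auto simp: near_ties_def)
  then show ?thesis by (simp only: sets.empty_sets)
qed

lemma eps_lower:
  assumes ne: "V \<noteq> {}" and x: "0 \<le> x"
    and T0: "spanning_tree V E T0" "real (card (T0 - mst V E w)) \<ge> \<delta> * real (card V)"
  shows "x * (\<delta> - real (card (near_ties w x)) / real (card V)) \<le> eps V E w \<delta>"
proof (rule eps_ge[OF T0])
  fix T' assume T': "spanning_tree V E T'" "real (card (T' - mst V E w)) \<ge> \<delta> * real (card V)"
  let ?D = "T' - mst V E w"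
  have n: "0 < real (card V)" using ne finite_V by (simp add: card_gt_0_iff)
  have "finite (near_ties w x)" by (rule finite_subset[OF _ finite_E]) (auto simp: near_ties_def)
  then have "card ?D - card (near_ties w x) \<le> card (?D - near_ties w x)" by (rule diff_card_le_card_Diff)
  then have "\<delta> * real (card V) - real (card (near_ties w x)) \<le> real (card (?D - near_ties w x))" using T'(2) by simp
  then have "x * (\<delta> * real (card V) - real (card (near_ties w x))) \<le> x * real (card (?D - near_ties w x))"
    using x by (rule mult_left_mono)
  also have "\<dots> \<le> tree_len w T' - tree_len w (mst V E w)"
    by (rule mst_gap[OF is_mst_mst x T'(1)])
  finally show "x * (\<delta> - real (card (near_ties w x)) / real (card V)) \<le> (tree_len w T' - tree_len w (mst V E w)) / real (card V)"
    using n by (simp add: pos_le_divide_eq right_diff_distrib left_diff_distrib)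
qed

lemma eps_nonneg:
  assumes "spanning_tree V E T0" "real (card (T0 - mst V E w)) \<ge> \<delta> * real (card V)"
  shows "0 \<le> eps V E w \<delta>"
  by (rule eps_ge[OF assms]) (use is_mst_mst[of w] in \<open>auto simp: is_mst_def\<close>)

text \<open>\<open>gap\<close> speaks of a longest edge because that is the one the minimal tree
  omits. Disjointness of the vertex sets \<open>W\<close> is passed on to the edge sets
  \<open>C\<close>, as \<open>swap_many\<close> requires.\<close>

lemma eps_upper:
  assumes K: "finite K" "\<delta> * real (card V) \<le> real (card K)"
    and C: "\<And>j. j \<in> K \<Longrightarrow> cyc (C j)" "\<And>j. j \<in> K \<Longrightarrow> C j \<noteq> {}" "\<And>j. j \<in> K \<Longrightarrow> C j \<subseteq> E"
      "\<And>j. j \<in> K \<Longrightarrow> C j \<subseteq> Pow (W j)"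
    and disj: "\<And>i j. i \<in> K \<Longrightarrow> j \<in> K \<Longrightarrow> i \<noteq> j \<Longrightarrow> W i \<inter> W j = {}"
    and iso: "\<And>j e. j \<in> K \<Longrightarrow> e \<in> E \<Longrightarrow> e \<inter> W j \<noteq> {} \<Longrightarrow> e \<in> C j \<or> (\<forall>c\<in>C j. w c < w e)"
    and gap: "\<And>j e. j \<in> K \<Longrightarrow> e \<in> C j \<Longrightarrow> \<forall>c\<in>C j. w c \<le> w e \<Longrightarrow> \<exists>c\<in>C j. c \<noteq> e \<and> w e \<le> w c + h"
  shows "eps V E w \<delta> \<le> h * real (card K) / real (card V)"
proof -
  let ?T = "mst V E w"
  have sp: "spanning_tree V E ?T" using is_mst_mst by (simp add: is_mst_def)
  have "\<exists>e. e \<in> C j \<and> ?T \<inter> C j = C j - {e} \<and> (\<forall>c\<in>C j. w c \<le> w e)" if "j \<in> K" for j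
    using mst_isolated_cycle[OF is_mst_mst C(1-4)[OF that] iso[OF that]] by blast
  then obtain e where e: "\<And>j. j \<in> K \<Longrightarrow> e j \<in> C j \<and> ?T \<inter> C j = C j - {e j} \<and> (\<forall>c\<in>C j. w c \<le> w (e j))" by metis
  have "\<exists>c. c \<in> C j \<and> c \<noteq> e j \<and> w (e j) \<le> w c + h" if "j \<in> K" for j
    using gap[OF that, of "e j"] e[OF that] by blast
  then obtain c where c: "\<And>j. j \<in> K \<Longrightarrow> c j \<in> C j \<and> c j \<noteq> e j \<and> w (e j) \<le> w (c j) + h" by metis
  have dC: "C i \<inter> C j = {}" if "i \<in> K" "j \<in> K" "i \<noteq> j" for i j
  proof (rule ccontr)
    assume "C i \<inter> C j \<noteq> {}"
    then obtain g where g: "g \<in> C i" "g \<in> C j" by blast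
    then have "g \<subseteq> W i" "g \<subseteq> W j" using C(4) that by blast+
    moreover have "g \<noteq> {}" using edge[of g] C(3)[OF that(1)] g by blast
    ultimately show False using disj[OF that] by blast
  qed
  have Ce: "cyc (C j) \<and> C j \<subseteq> E \<and> e j \<in> C j \<and> ?T \<inter> C j = C j - {e j}" if "j \<in> K" for j
    using C(1,3)[OF that] e[OF that] by simp
  obtain T' where T': "spanning_tree V E T'" "T' - ?T = e ` K" "card (e ` K) = card K"
     "tree_len w T' \<le> tree_len w ?T + h * real (card K)"
    using swap_many[of "mst V E w" K C e c, OF sp K(1) Ce dC c] by blast
  have "eps V E w \<delta> \<le> (tree_len w T' - tree_len w ?T) / real (card V)"
    using T' K(2) by (intro eps_le) simp_all
  also have "\<dots> \<le> h * real (card K) / real (card V)"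
    using T'(4) by (intro divide_right_mono) simp_all
  finally show ?thesis .
qed

text \<open>The majorant \<open>Z\<close> provides integrability, so that the integral of
  \<open>eps\<close> is not 0 by mere convention. Taking expectations in \<open>eps_lower\<close>
  then replaces the number of near ties by its mean, which \<open>nt\<close> bounds.\<close>

lemma expected_eps_lower:
  assumes M: "prob_space M" and ne: "V \<noteq> {}" and x: "0 \<le> x"
    and w: "\<And>e. e \<in> E \<Longrightarrow> (\<lambda>\<omega>. w \<omega> e) \<in> borel_measurable M"
    and T0: "\<And>\<omega>. \<exists>T0. spanning_tree V E T0 \<and> real (card (T0 - mst V E (w \<omega>))) \<ge> \<delta> * real (card V)"
    and Z: "integrable M Z" "AE \<omega> in M. eps V E (w \<omega>) \<delta> \<le> Z \<omega>"
    and nt: "(\<Sum>e\<in>E. measure M {\<omega> \<in> space M. e \<in> near_ties (w \<omega>) x}) \<le> C * x * real (card V)"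
  shows "x * (\<delta> - C * x) \<le> (\<integral>\<omega>. eps V E (w \<omega>) \<delta> \<partial>M)"
proof -
  interpret prob_space M by (rule M)
  have n: "0 < real (card V)" using ne finite_V by (simp add: card_gt_0_iff)
  let ?S = "\<lambda>e. {\<omega> \<in> space M. e \<in> near_ties (w \<omega>) x}"
  have [measurable]: "?S e \<in> sets M" for e by (rule sets_near_ties[OF w])
  have int: "integrable M (\<lambda>\<omega>. eps V E (w \<omega>) \<delta>)"
  proof (rule Bochner_Integration.integrable_bound[OF Z(1)])
    show "(\<lambda>\<omega>. eps V E (w \<omega>) \<delta>) \<in> borel_measurable M" by (rule borel_measurable_eps[OF w])
    show "AE \<omega> in M. norm (eps V E (w \<omega>) \<delta>) \<le> norm (Z \<omega>)"
      using Z(2)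
    proof eventually_elim
      case (elim \<omega>)
      obtain T0' where "spanning_tree V E T0'" "real (card (T0' - mst V E (w \<omega>))) \<ge> \<delta> * real (card V)"
        using T0 by blast
      from eps_nonneg[OF this] show ?case using elim by simp
    qed
  qed
  let ?N = "\<lambda>\<omega>. real (card {e \<in> E. e \<in> near_ties (w \<omega>) x})"
  have nt_eq: "near_ties (w \<omega>) x = {e \<in> E. e \<in> near_ties (w \<omega>) x}" for \<omega> by (auto simp: near_ties_def)
  have N: "?N \<in> borel_measurable M" "expectation ?N = (\<Sum>e\<in>E. measure M (?S e))"
    using expectation_card[of E "\<lambda>e \<omega>. e \<in> near_ties (w \<omega>) x"] finite_E by simp_all
  have iN: "integrable M ?N"
    using finite_E by (intro integrable_const_bound[where B = "real (card E)"] N(1)) (auto intro!: card_mono)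
  have "x * (\<delta> - C * x) \<le> x * (\<delta> - expectation ?N / real (card V))"
    unfolding N(2) using nt n x by (intro mult_left_mono) (simp_all add: field_simps)
  also have "\<dots> = (\<integral>\<omega>. x * (\<delta> - ?N \<omega> / real (card V)) \<partial>M)"
    using iN by (simp add: prob_space)
  also have "\<dots> \<le> (\<integral>\<omega>. eps V E (w \<omega>) \<delta> \<partial>M)"
  proof (rule integral_mono)
    fix \<omega>
    obtain T0' where "spanning_tree V E T0'" "real (card (T0' - mst V E (w \<omega>))) \<ge> \<delta> * real (card V)"
      using T0 by blast
    from eps_lower[OF ne x this] show "x * (\<delta> - ?N \<omega> / real (card V)) \<le> eps V E (w \<omega>) \<delta>"
      unfolding nt_eq[symmetric] .
  qed (use iN int in auto)
  finally show ?thesis .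
qed

end

lemma card_filter_diff_le:
  assumes J: "finite J" and K: "K \<subseteq> J" "card K \<le> b" and eq: "\<And>j. j \<in> J - K \<Longrightarrow> P j \<longleftrightarrow> Q j"
  shows "\<bar>real (card {j \<in> J. P j}) - real (card {j \<in> J. Q j})\<bar> \<le> real b"
proof -
  have fin: "finite {j \<in> J. R j}" "finite K" for R using J K finite_subset by auto
  have "card {j \<in> J. R j} \<le> card {j \<in> J. R' j} + card K" if "\<And>j. j \<in> J - K \<Longrightarrow> R j \<longleftrightarrow> R' j" for R R'
  proof -
    have "card {j \<in> J. R j} \<le> card ({j \<in> J. R' j} \<union> K)"
      using that fin by (intro card_mono) auto
    also have "\<dots> \<le> card {j \<in> J. R' j} + card K" by (rule card_Un_le)
    finally show ?thesis .
  qed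
  from this[of P Q] this[of Q P] show ?thesis using eq K(2) by auto
qed

lemma card_disjoint_touching:
  assumes J: "finite J" and disj: "\<And>i j. i \<in> J \<Longrightarrow> j \<in> J \<Longrightarrow> i \<noteq> j \<Longrightarrow> W i \<inter> W j = {}"
    and A: "finite A"
  shows "card {j \<in> J. A \<inter> W j \<noteq> {}} \<le> card A"
proof -
  obtain f where f: "\<And>j. j \<in> {j \<in> J. A \<inter> W j \<noteq> {}} \<Longrightarrow> f j \<in> A \<inter> W j"
    using bchoice[of "{j \<in> J. A \<inter> W j \<noteq> {}}" "\<lambda>j a. a \<in> A \<inter> W j"] by blast
  have "inj_on f {j \<in> J. A \<inter> W j \<noteq> {}}"
  proof (rule inj_onI, rule ccontr)
    fix i j assume ij: "i \<in> {j \<in> J. A \<inter> W j \<noteq> {}}" "j \<in> {j \<in> J. A \<inter> W j \<noteq> {}}" "f i = f j" "i \<noteq> j"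
    then have "f i \<in> W i \<inter> W j" using f[OF ij(1)] f[OF ij(2)] by simp
    moreover have "W i \<inter> W j = {}" using disj ij by simp
    ultimately show False by simp
  qed
  then show ?thesis using f A by (intro card_inj_on_le) auto
qed

section \<open>The lattice\<close>

abbreviation ax :: "'d::finite \<Rightarrow> real ^ 'd" where "ax k \<equiv> axis k 1"

lemma lattice_vertices_iff:
  "x \<in> lattice_vertices m \<longleftrightarrow> (\<forall>k. \<exists>i::nat. x $ k = real i \<and> 1 \<le> i \<and> i \<le> m)"
  unfolding lattice_vertices_def by fastforce

lemma finite_lattice_vertices: "finite (lattice_vertices m :: (real ^ 'd::finite) set)"
proof -
  have "lattice_vertices m \<subseteq> (\<lambda>f. \<chi> i. f i) ` (Pi\<^sub>E (UNIV :: 'd set) (\<lambda>_. real ` {1..m}))"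
  proof
    fix x :: "real ^ 'd" assume "x \<in> lattice_vertices m"
    then have "(\<lambda>i. x $ i) \<in> Pi\<^sub>E UNIV (\<lambda>_. real ` {1..m})" by (auto simp: lattice_vertices_def)
    moreover have "x = (\<chi> i. x $ i)" by (simp add: vec_eq_iff)
    ultimately show "x \<in> (\<lambda>f. \<chi> i. f i) ` (Pi\<^sub>E UNIV (\<lambda>_. real ` {1..m}))" by blast
  qed
  then show ?thesis by (rule finite_subset) (intro finite_imageI finite_PiE; simp)
qed

text \<open>The diagonal already suffices: what matters later is that the number of vertices is
  positive and tends to infinity with \<open>m\<close>.\<close>

lemma card_lattice_vertices_ge: "m \<le> card (lattice_vertices m :: (real ^ 'd::finite) set)"
proof -
  have "card ((\<lambda>i. vec (real i) :: real ^ 'd) ` {1..m}) \<le> card (lattice_vertices m :: (real ^ 'd) set)"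
    by (intro card_mono finite_lattice_vertices) (auto simp: lattice_vertices_def)
  moreover have "inj_on (\<lambda>i. vec (real i) :: real ^ 'd) {1..m}"
    by (rule inj_onI) (simp add: vec_eq_iff)
  ultimately show ?thesis by (simp add: card_image)
qed

text \<open>The coordinate differences are integers whose squares sum to 1, so exactly one of them
  is 1 or -1; naming the lower end \<open>x\<close> gives the form \<open>x + ax k\<close>.\<close>

lemma lattice_edgeE:
  assumes "e \<in> lattice_edges m"
  obtains x k where "x \<in> lattice_vertices m" "x + ax k \<in> lattice_vertices m" "e = {x, x + ax k}"
proof -
  obtain x y where xy: "e = {x, y}" "x \<in> lattice_vertices m" "y \<in> lattice_vertices m" "dist x y = 1"
    using assms unfolding lattice_edges_def by blast
  define z where "z = y - x"
  have zint: "\<exists>i::int. z $ k = of_int i" for k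
  proof -
    obtain i j :: nat where "x $ k = real i" "y $ k = real j"
      using xy(2,3) unfolding lattice_vertices_iff by blast
    then have "z $ k = of_int (int j - int i)" by (simp add: z_def)
    then show ?thesis by blast
  qed
  have "norm z = 1" using xy(4) by (simp add: z_def dist_norm norm_minus_commute)
  then have "z \<bullet> z = 1" by (simp add: norm_eq_sqrt_inner)
  then have s: "(\<Sum>k\<in>UNIV. (z $ k)\<^sup>2) = 1" by (simp add: inner_vec_def power2_eq_square)
  have "\<exists>k. z $ k \<noteq> 0"
  proof (rule ccontr)
    assume "\<nexists>k. z $ k \<noteq> 0"
    then show False using s by simp
  qed
  then obtain k where k: "z $ k \<noteq> 0" by blast
  obtain i :: int where i: "z $ k = of_int i" using zint by blast
  have "1 \<le> i\<^sup>2" using k i by (simp add: int_one_le_iff_zero_less)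
  then have k1: "1 \<le> (z $ k)\<^sup>2" unfolding i by (metis of_int_1_le_iff of_int_power)
  have split: "(z $ k)\<^sup>2 + (\<Sum>j\<in>UNIV - {k}. (z $ j)\<^sup>2) = 1" using s by (subst sum.remove[symmetric]) auto
  have nn: "0 \<le> (\<Sum>j\<in>UNIV - {k}. (z $ j)\<^sup>2)" by (simp add: sum_nonneg)
  then have z0: "(\<Sum>j\<in>UNIV - {k}. (z $ j)\<^sup>2) = 0" and zk: "(z $ k)\<^sup>2 = 1" using split k1 by linarith+
  have other: "z $ j = 0" if "j \<noteq> k" for j
    using z0 that by (subst (asm) sum_nonneg_eq_0_iff) auto
  from zk consider "z $ k = 1" | "z $ k = - 1" by (auto simp: power2_eq_1_iff)
  then show ?thesis
  proof cases
    case 1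
    then have "z = ax k" using other by (simp add: vec_eq_iff axis_def)
    then have "y = x + ax k" by (simp add: z_def algebra_simps)
    then show ?thesis using that xy by blast
  next
    case 2
    then have "z = - ax k" using other by (simp add: vec_eq_iff axis_def)
    then have "x = y + ax k" by (simp add: z_def algebra_simps)
    then show ?thesis using that[of y k] xy by (simp add: insert_commute)
  qed
qed

lemma lattice_edgeI:
  assumes "x \<in> lattice_vertices m" "x + ax k \<in> lattice_vertices m"
  shows "{x, x + ax k} \<in> lattice_edges m"
  using assms unfolding lattice_edges_def by (fastforce simp: dist_norm)

lemma lattice_network:
  "network (lattice_vertices m :: (real ^ 'd::finite) set) (lattice_edges m)"
proof
  show "finite (lattice_vertices m :: (real ^ 'd) set)" by (rule finite_lattice_vertices)
  show "\<exists>u\<in>lattice_vertices m. \<exists>v\<in>lattice_vertices m. u \<noteq> v \<and> e = {u, v}" if e: "e \<in> lattice_edges m" for e :: "(real ^ 'd) set"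
  proof -
    obtain x k where xk: "x \<in> lattice_vertices m" "x + ax k \<in> lattice_vertices m" "e = {x, x + ax k}"
      using e by (rule lattice_edgeE)
    have "x \<noteq> x + ax k" by (auto simp: vec_eq_iff axis_def)
    then show ?thesis using xk by blast
  qed
  let ?E = "lattice_edges m :: (real ^ 'd) set set"
  \<comment> \<open>Descend to the corner \<open>vec 1\<close> one unit step at a time;
    \<open>N\<close> bounds the coordinate sum, which each step lowers by 1.\<close>
  have base: "conn ?E x (vec 1)" if "x \<in> lattice_vertices m" "(\<Sum>k\<in>UNIV. x $ k) \<le> real N" for x :: "real ^ 'd" and N
    using that
  proof (induction N arbitrary: x)
    case 0
    have "x $ k \<ge> 1" for k using 0(1) unfolding lattice_vertices_iff by (metis of_nat_1 of_nat_le_iff)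
    then have "(\<Sum>k\<in>(UNIV :: 'd set). 1) \<le> (\<Sum>k\<in>UNIV. x $ k)" by (intro sum_mono) auto
    moreover have "0 < real CARD('d)" by simp
    ultimately show ?case using 0(2) by simp
  next
    case (Suc N)
    show ?case
    proof (cases "x = vec 1")
      case False
      then obtain k where k: "x $ k \<noteq> 1" by (auto simp: vec_eq_iff)
      obtain i :: nat where i: "x $ k = real i" "1 \<le> i" "i \<le> m" using Suc.prems(1) unfolding lattice_vertices_iff by blast
      have i2: "2 \<le> i" using k i by (cases "i = 1") auto
      define y where "y = x - ax k"
      have xy: "x = y + ax k" by (simp add: y_def)
      have yV: "y \<in> lattice_vertices m"
        unfolding lattice_vertices_iff
      proof
        fix j
        show "\<exists>i::nat. y $ j = real i \<and> 1 \<le> i \<and> i \<le> m"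
        proof (cases "j = k")
          case True
          then show ?thesis using i i2 by (intro exI[of _ "i - 1"]) (auto simp: y_def)
        next
          case False
          then show ?thesis using Suc.prems(1) unfolding lattice_vertices_iff by (simp add: y_def axis_def)
        qed
      qed
      have "(\<Sum>k\<in>UNIV. x $ k) = (\<Sum>k\<in>UNIV. y $ k) + 1"
        unfolding xy by (simp add: sum.distrib axis_def)
      then have "conn ?E y (vec 1)" using Suc.IH[OF yV] Suc.prems(2) by simp
      moreover have "{y, x} \<in> ?E" using lattice_edgeI[of y m k] yV Suc.prems(1) xy by metis
      ultimately show ?thesis by (meson conn_edge conn_sym conn_trans)
    qed simp
  qed
  have "conn ?E x (vec 1)" if "x \<in> lattice_vertices m" for x
    using base[OF that] real_arch_simple by blast
  then show "connects (lattice_vertices m :: (real ^ 'd) set) (lattice_edges m)"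
    unfolding connects_def by (meson conn_sym conn_trans)
qed

lemma card_lattice_edges_le:
  "card (lattice_edges m :: (real ^ 'd::finite) set set) \<le> CARD('d) * card (lattice_vertices m :: (real ^ 'd) set)"
proof -
  have "lattice_edges m \<subseteq> (\<lambda>(x, k). {x, x + ax k}) ` (lattice_vertices m \<times> (UNIV :: 'd set))"
    by (auto elim!: lattice_edgeE)
  then have "card (lattice_edges m :: (real ^ 'd) set set) \<le> card ((lattice_vertices m :: (real ^ 'd) set) \<times> (UNIV :: 'd set))"
    by (rule surj_card_le[rotated]) (intro finite_cartesian_product finite_lattice_vertices finite)
  then show ?thesis by (simp add: card_cartesian_product mult.commute)
qed

locale lattice =
  fixes k0 k1 :: "'d::finite" and m :: nat
  assumes k01: "k0 \<noteq> k1" and m2: "2 \<le> m"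
begin

abbreviation "V \<equiv> lattice_vertices m :: (real ^ 'd) set"
abbreviation "E \<equiv> lattice_edges m :: (real ^ 'd) set set"

sublocale network V E by (rule lattice_network)

text \<open>Corners with odd coordinates in two fixed directions: the squares then occupy coordinate
  pairs 2i+1, 2i+2 and are pairwise disjoint, while \<open>2 * i + 2 \<le> m\<close> keeps them
  inside the lattice.\<close>

definition square_bases :: "(real ^ 'd) set" where
  "square_bases = {x \<in> V. \<exists>i j. x $ k0 = real (2 * i + 1) \<and> 2 * i + 2 \<le> m \<and> x $ k1 = real (2 * j + 1) \<and> 2 * j + 2 \<le> m}"

definition square :: "real ^ 'd \<Rightarrow> (real ^ 'd) set" where
  "square x = {x, x + ax k0, x + ax k0 + ax k1, x + ax k1}"

definition square_cycle :: "real ^ 'd \<Rightarrow> (real ^ 'd) set set" where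
  "square_cycle x = {{x, x + ax k0}, {x + ax k0, x + ax k0 + ax k1},
     {x + ax k0 + ax k1, x + ax k1}, {x + ax k1, x}}"

definition square_boundary :: "real ^ 'd \<Rightarrow> (real ^ 'd) set set" where
  "square_boundary x = {e \<in> E. e \<inter> square x \<noteq> {} \<and> e \<notin> square_cycle x}"

lemma finite_square_bases: "finite square_bases"
  unfolding square_bases_def using finite_V by simp

lemma square_distinct: "distinct [x, x + ax k0, x + ax k0 + ax k1, x + ax k1]"
proof -
  have "ax k0 \<noteq> 0" "ax k1 \<noteq> 0" "ax k0 + ax k1 \<noteq> 0" "ax k0 \<noteq> ax k1"
    using k01 by (auto simp: vec_eq_iff axis_def)
  then show ?thesis by auto
qed

lemma cyc_square_cycle: "cyc (square_cycle x)"
  unfolding square_cycle_def by (rule cyc_square[OF square_distinct])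

lemma square_subset:
  assumes "x \<in> square_bases"
  shows "square x \<subseteq> V"
proof -
  obtain i j where ij: "x $ k0 = real (2 * i + 1)" "2 * i + 2 \<le> m" "x $ k1 = real (2 * j + 1)" "2 * j + 2 \<le> m" and xV: "x \<in> V"
    using assms unfolding square_bases_def by blast
  have gen: "x + a *\<^sub>R ax k0 + b *\<^sub>R ax k1 \<in> V" if "a \<in> {0, 1}" "b \<in> {0, 1}" for a b :: real
    unfolding lattice_vertices_iff
  proof
    fix k
    consider "k = k0" | "k = k1" | "k \<noteq> k0" "k \<noteq> k1" by blast
    then show "\<exists>i::nat. (x + a *\<^sub>R ax k0 + b *\<^sub>R ax k1) $ k = real i \<and> 1 \<le> i \<and> i \<le> m"
    proof cases
      case 1
      then show ?thesis using ij that k01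
        by (intro exI[of _ "2 * i + 1 + nat \<lfloor>a\<rfloor>"]) (auto simp: axis_def)
    next
      case 2
      then show ?thesis using ij that k01
        by (intro exI[of _ "2 * j + 1 + nat \<lfloor>b\<rfloor>"]) (auto simp: axis_def)
    next
      case 3
      then show ?thesis using xV unfolding lattice_vertices_iff by (simp add: axis_def)
    qed
  qed
  show ?thesis using gen[of 0 0] gen[of 1 0] gen[of 1 1] gen[of 0 1] unfolding square_def by simp
qed

lemma square_cycle_subset:
  assumes "x \<in> square_bases"
  shows "square_cycle x \<subseteq> E"
proof -
  have "x \<in> V" "x + ax k0 \<in> V" "x + ax k0 + ax k1 \<in> V" "x + ax k1 \<in> V"
    using square_subset[OF assms] by (auto simp: square_def)
  then show ?thesis unfolding square_cycle_def
    using lattice_edgeI[of x m k0] lattice_edgeI[of "x + ax k0" m k1] lattice_edgeI[of "x + ax k1" m k0] lattice_edgeI[of x m k1]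
    by (auto simp: insert_commute add.commute add.left_commute)
qed

lemma square_cycle_Pow: "square_cycle x \<subseteq> Pow (square x)"
  unfolding square_cycle_def square_def by auto

lemma square_coords:
  assumes "z \<in> square x"
  shows "z $ k0 = x $ k0 \<or> z $ k0 = x $ k0 + 1" "z $ k1 = x $ k1 \<or> z $ k1 = x $ k1 + 1"
    "k \<noteq> k0 \<Longrightarrow> k \<noteq> k1 \<Longrightarrow> z $ k = x $ k"
proof -
  consider "z = x" | "z = x + ax k0" | "z = x + ax k0 + ax k1" | "z = x + ax k1"
    using assms unfolding square_def by blast
  then have "(z $ k0 = x $ k0 \<or> z $ k0 = x $ k0 + 1) \<and> (z $ k1 = x $ k1 \<or> z $ k1 = x $ k1 + 1)
    \<and> (k \<noteq> k0 \<longrightarrow> k \<noteq> k1 \<longrightarrow> z $ k = x $ k)"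
    using k01 by cases (simp_all add: axis_def)
  then show "z $ k0 = x $ k0 \<or> z $ k0 = x $ k0 + 1" "z $ k1 = x $ k1 \<or> z $ k1 = x $ k1 + 1"
    "k \<noteq> k0 \<Longrightarrow> k \<noteq> k1 \<Longrightarrow> z $ k = x $ k" by blast+
qed

lemma square_disjoint:
  assumes "x \<in> square_bases" "y \<in> square_bases" "x \<noteq> y"
  shows "square x \<inter> square y = {}"
proof (rule ccontr)
  assume "square x \<inter> square y \<noteq> {}"
  then obtain z where z: "z \<in> square x" "z \<in> square y" by blast
  obtain i j where ij: "x $ k0 = real (2 * i + 1)" "x $ k1 = real (2 * j + 1)"
    using assms unfolding square_bases_def by blast
  obtain i' j' where ij': "y $ k0 = real (2 * i' + 1)" "y $ k1 = real (2 * j' + 1)"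
    using assms unfolding square_bases_def by blast
  have "z $ k0 = real (2 * i + 1) \<or> z $ k0 = real (2 * i + 2)" "z $ k1 = real (2 * j + 1) \<or> z $ k1 = real (2 * j + 2)"
    using square_coords(1,2)[OF z(1)] unfolding ij by (elim disjE; simp)+
  moreover have "z $ k0 = real (2 * i' + 1) \<or> z $ k0 = real (2 * i' + 2)" "z $ k1 = real (2 * j' + 1) \<or> z $ k1 = real (2 * j' + 2)"
    using square_coords(1,2)[OF z(2)] unfolding ij' by (elim disjE; simp)+
  moreover have "i = i'" if r: "r = real (2 * i + 1) \<or> r = real (2 * i + 2)"
    "r = real (2 * i' + 1) \<or> r = real (2 * i' + 2)" for r i i'
  proof -
    obtain a where a: "a = 2 * i + 1 \<or> a = 2 * i + 2" "r = real a" using r(1) by blast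
    obtain b where b: "b = 2 * i' + 1 \<or> b = 2 * i' + 2" "r = real b" using r(2) by blast
    have "a = b" using a(2) b(2) by simp
    then show ?thesis using a(1) b(1) by presburger
  qed
  ultimately have "i = i'" "j = j'" by metis+
  moreover have "x $ k = y $ k" if "k \<noteq> k0" "k \<noteq> k1" for k
  proof -
    have "z $ k = x $ k" using square_coords(3)[OF z(1)] that by blast
    moreover have "z $ k = y $ k" using square_coords(3)[OF z(2)] that by blast
    ultimately show ?thesis by simp
  qed
  ultimately have "x $ k = y $ k" for k using ij ij' by (cases "k = k0"; cases "k = k1") auto
  then show False using assms(3) by (simp add: vec_eq_iff)
qed

text \<open>Every vertex is a base plus an offset from \<open>{0, 1, 2}\<close> in each of the two
  directions. The offset 2 reaches the last row when \<open>m\<close> is odd, which is why the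
  constant is 9 and not 4.\<close>

lemma card_V_le: "card V \<le> 9 * card square_bases"
proof -
  have "V \<subseteq> (\<lambda>(x, s, t). x + real s *\<^sub>R ax k0 + real t *\<^sub>R ax k1) ` (square_bases \<times> {0, 1, 2 :: nat} \<times> {0, 1, 2 :: nat})"
  proof
    fix z assume z: "z \<in> V"
    have dec: "\<exists>i s. s \<in> {0, 1, 2} \<and> v = 2 * i + 1 + s \<and> 2 * i + 2 \<le> m" if "1 \<le> v" "v \<le> m" for v :: nat
    proof -
      have "\<exists>i. 2 * i + 1 \<le> v \<and> v \<le> 2 * i + 3 \<and> 2 * i + 2 \<le> m" using that m2 by presburger
      then obtain i where i: "2 * i + 1 \<le> v" "v \<le> 2 * i + 3" "2 * i + 2 \<le> m" by blast
      then show ?thesis by (intro exI[of _ i] exI[of _ "v - (2 * i + 1)"]) auto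
    qed
    obtain v0 where v0: "z $ k0 = real v0" "1 \<le> v0" "v0 \<le> m" using z unfolding lattice_vertices_iff by blast
    obtain v1 where v1: "z $ k1 = real v1" "1 \<le> v1" "v1 \<le> m" using z unfolding lattice_vertices_iff by blast
    obtain i s where hs: "s \<in> {0, 1, 2}" "v0 = 2 * i + 1 + s" "2 * i + 2 \<le> m" using dec v0 by blast
    obtain j t where jt: "t \<in> {0, 1, 2}" "v1 = 2 * j + 1 + t" "2 * j + 2 \<le> m" using dec v1 by blast
    define x where "x = z - real s *\<^sub>R ax k0 - real t *\<^sub>R ax k1"
    have x0: "x $ k0 = real (2 * i + 1)" and x1: "x $ k1 = real (2 * j + 1)"
      using k01 v0 v1 hs jt by (auto simp: x_def axis_def)
    have "x \<in> V" unfolding lattice_vertices_iff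
    proof
      fix k
      consider "k = k0" | "k = k1" | "k \<noteq> k0" "k \<noteq> k1" by blast
      then show "\<exists>i::nat. x $ k = real i \<and> 1 \<le> i \<and> i \<le> m"
      proof cases
        case 1 then show ?thesis using x0 hs(3) by (intro exI[of _ "2 * i + 1"]) auto
      next
        case 2 then show ?thesis using x1 jt(3) by (intro exI[of _ "2 * j + 1"]) auto
      next
        case 3 then show ?thesis using z unfolding lattice_vertices_iff x_def by (simp add: axis_def)
      qed
    qed
    then have "x \<in> square_bases" using x0 x1 hs(3) jt(3) unfolding square_bases_def by blast
    moreover have "z = x + real s *\<^sub>R ax k0 + real t *\<^sub>R ax k1" by (simp add: x_def)
    ultimately show "z \<in> (\<lambda>(x, s, t). x + real s *\<^sub>R ax k0 + real t *\<^sub>R ax k1) ` (square_bases \<times> {0, 1, 2} \<times> {0, 1, 2})"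
      using hs(1) jt(1) by force
  qed
  then have "card V \<le> card (square_bases \<times> {0, 1, 2 :: nat} \<times> {0, 1, 2 :: nat})"
    by (rule surj_card_le[rotated]) (intro finite_cartesian_product finite_square_bases; simp)
  then show ?thesis by (simp add: card_cartesian_product)
qed

text \<open>Four corners, each with \<open>CARD('d)\<close> directions and two orientations.\<close>

lemma card_square_boundary_le: "card (square_boundary x) \<le> 8 * CARD('d)"
proof -
  have "square_boundary x \<subseteq> (\<lambda>(y, k, s). {y, y + s *\<^sub>R ax k}) ` (square x \<times> (UNIV :: 'd set) \<times> {1, - 1 :: real})"
  proof
    fix e assume e: "e \<in> square_boundary x"
    then have "e \<in> E" by (simp add: square_boundary_def)
    then obtain u k where uk: "e = {u, u + ax k}" by (rule lattice_edgeE)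
    from e uk consider "u \<in> square x" | "u + ax k \<in> square x" unfolding square_boundary_def by blast
    then show "e \<in> (\<lambda>(y, k, s). {y, y + s *\<^sub>R ax k}) ` (square x \<times> (UNIV :: 'd set) \<times> {1, - 1 :: real})"
    proof cases
      case 1
      then show ?thesis using uk by (intro image_eqI[where x = "(u, k, 1)"]) auto
    next
      case 2
      then show ?thesis using uk by (intro image_eqI[where x = "(u + ax k, k, - 1)"]) auto
    qed
  qed
  then have "card (square_boundary x) \<le> card (square x \<times> (UNIV :: 'd set) \<times> {1, - 1 :: real})"
    by (rule surj_card_le[rotated]) (intro finite_cartesian_product; simp add: square_def)
  also have "\<dots> \<le> 4 * (CARD('d) * 2)"
  proof -
    have "card (square x) \<le> card (set [x, x + ax k0, x + ax k0 + ax k1, x + ax k1])" by (simp add: square_def)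
    also have "\<dots> \<le> 4" using card_length[of "[x, x + ax k0, x + ax k0 + ax k1, x + ax k1]"] by simp
    finally show ?thesis unfolding card_cartesian_product by (intro mult_mono) auto
  qed
  finally show ?thesis by simp
qed

lemma far_tree_exists:
  assumes "\<delta> \<le> 1 / 9"
  shows "\<exists>T0. spanning_tree V E T0 \<and> real (card (T0 - mst V E w)) \<ge> \<delta> * real (card V)"
proof -
  have "spanning_tree V E (mst V E w)" using is_mst_mst by (simp add: is_mst_def)
  then obtain T0 where T0: "spanning_tree V E T0" "card square_bases \<le> card (T0 - mst V E w)"
    using far_spanning_tree[where C = square_cycle and W = square and J = square_bases]
      finite_square_bases cyc_square_cycle square_cycle_subset square_cycle_Pow square_disjoint
    unfolding square_cycle_def by (metis insert_not_empty)
  have "\<delta> * real (card V) \<le> 1 / 9 * real (card V)" using assms by (intro mult_right_mono) auto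
  also have "\<dots> \<le> real (card square_bases)" using card_V_le by simp
  finally show ?thesis using T0 by (meson of_nat_le_iff order_trans)
qed

end

section \<open>The disordered lattice\<close>

abbreviation length_measure :: "(real \<Rightarrow> real) \<Rightarrow> real measure" where
  "length_measure f \<equiv> density lborel (\<lambda>x. ennreal (f x))"

lemma edge_density_prob_space: "edge_density f \<Longrightarrow> prob_space (length_measure f)"
  by (intro prob_spaceI) (simp add: edge_density_def emeasure_density)

lemma edge_density_bounded:
  assumes "edge_density f"
  shows "\<exists>B>0. \<forall>x. f x \<le> B"
proof -
  have "bounded (range f)" using assms by (simp add: edge_density_def)
  then obtain b where b: "\<And>x. norm (f x) \<le> b" unfolding bounded_iff by blast
  have "f x \<le> \<bar>b\<bar> + 1" for x using b[of x] by simp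
  then show ?thesis by (intro exI[of _ "\<bar>b\<bar> + 1"]) auto
qed

text \<open>The length \<open>4 * \<eta>\<close> provides four consecutive windows of width
  \<open>\<eta>\<close>. In a good square two cycle edges fall in the first, two in the second and
  all other edges at the square in the fourth; the third keeps the cycle apart from its
  surroundings. The density is positive at some positive point and continuous there.\<close>

lemma edge_density_pos_interval:
  assumes "edge_density f"
  shows "\<exists>\<kappa>>0. \<exists>\<eta>>0. \<exists>t0. \<forall>y. t0 \<le> y \<longrightarrow> y \<le> t0 + 4 * \<eta> \<longrightarrow> \<kappa> \<le> f y"
proof -
  have "\<exists>t. f t > 0"
  proof (rule ccontr)
    assume "\<nexists>t. f t > 0"
    then have "f t = 0" for t using assms unfolding edge_density_def by (metis not_less order_antisym)
    then show False using assms unfolding edge_density_def by simp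
  qed
  then obtain t where t: "f t > 0" by blast
  then have t0: "t > 0" using assms unfolding edge_density_def by (metis less_irrefl not_less)
  have "isCont f t"
    using assms t0 unfolding edge_density_def by (simp add: continuous_on_eq_continuous_at)
  then obtain s where s: "s > 0" "\<And>y. \<bar>y - t\<bar> < s \<Longrightarrow> \<bar>f y - f t\<bar> < f t / 2"
    using t unfolding continuous_at_eps_delta dist_real_def by (metis half_gt_zero)
  have "f t / 2 \<le> f y" if y: "t \<le> y" "y \<le> t + 4 * (s / 8)" for y
  proof -
    have "\<bar>f y - f t\<bar> < f t / 2" using y s by simp
    then show ?thesis by linarith
  qed
  then show ?thesis using t s(1)
    by (intro exI[of _ "f t / 2"] exI[of _ "s / 8"] exI[of _ t] conjI) auto
qed

lemma length_measure_le:
  assumes "edge_density f" "\<And>x. f x \<le> B" "0 \<le> B" "a \<le> b"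
  shows "emeasure (length_measure f) {a..b} \<le> ennreal (B * (b - a))"
proof -
  have [measurable]: "f \<in> borel_measurable borel" using assms by (simp add: edge_density_def)
  have "emeasure (length_measure f) {a..b} = (\<integral>\<^sup>+ x. ennreal (f x) * indicator {a..b} x \<partial>lborel)"
    by (simp add: emeasure_density)
  also have "\<dots> \<le> (\<integral>\<^sup>+ x. ennreal B * indicator {a..b} x \<partial>lborel)"
    using assms by (intro nn_integral_mono mult_right_mono ennreal_leI) auto
  also have "\<dots> = ennreal B * emeasure lborel {a..b}" by (rule nn_integral_cmult_indicator) simp
  also have "\<dots> = ennreal (B * (b - a))" using assms by (simp add: ennreal_mult)
  finally show ?thesis .
qed

lemma length_measure_ge:
  assumes "edge_density f" "\<And>y. a \<le> y \<Longrightarrow> y \<le> b \<Longrightarrow> \<kappa> \<le> f y" "0 \<le> \<kappa>" "a \<le> b"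
  shows "\<kappa> * (b - a) \<le> measure (length_measure f) {a<..b}"
proof -
  interpret prob_space "length_measure f" using edge_density_prob_space assms(1) .
  have [measurable]: "f \<in> borel_measurable borel" using assms by (simp add: edge_density_def)
  have "ennreal (\<kappa> * (b - a)) = ennreal \<kappa> * emeasure lborel {a<..b}" using assms by (simp add: ennreal_mult)
  also have "\<dots> = (\<integral>\<^sup>+ x. ennreal \<kappa> * indicator {a<..b} x \<partial>lborel)" by (simp add: nn_integral_cmult_indicator)
  also have "\<dots> \<le> (\<integral>\<^sup>+ x. ennreal (f x) * indicator {a<..b} x \<partial>lborel)"
    using assms by (intro nn_integral_mono) (auto simp: indicator_def intro: ennreal_leI)
  also have "\<dots> = emeasure (length_measure f) {a<..b}" by (simp add: emeasure_density)
  finally show ?thesis by (simp add: emeasure_eq_measure)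
qed

locale random_lattice = lattice k0 k1 m for k0 k1 :: "'d::finite" and m :: nat +
  fixes f :: "real \<Rightarrow> real" and B \<kappa> t0 \<eta> :: real
  assumes density: "edge_density f"
    and B: "0 < B" "\<And>x. f x \<le> B"
    and \<kappa>: "0 < \<kappa>" "0 < \<eta>" "\<And>y. t0 \<le> y \<Longrightarrow> y \<le> t0 + 4 * \<eta> \<Longrightarrow> \<kappa> \<le> f y"
begin

abbreviation "\<mu> \<equiv> length_measure f"
abbreviation "P \<equiv> PiM E (\<lambda>_. \<mu>)"

sublocale product_prob_space "\<lambda>_. \<mu>" E
  by (rule product_prob_spaceI) (rule edge_density_prob_space[OF density])

lemma measurable_length [measurable]: "e \<in> E \<Longrightarrow> (\<lambda>\<omega>. \<omega> e) \<in> borel_measurable P"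
  using measurable_component_singleton[of e E "\<lambda>_. \<mu>"] by simp

lemma V_pos: "0 < card V" "V \<noteq> {}"
  using card_lattice_vertices_ge[of m, where ?'d = 'd] m2 by auto

lemma card_E_le: "real (card E) \<le> real CARD('d) * real (card V)"
  using card_lattice_edges_le[of m, where ?'d = 'd] by (metis of_nat_le_iff of_nat_mult)

text \<open>With all other lengths fixed, \<open>bypass\<close> at a given level does not depend on
  the length \<open>t\<close> of \<open>e\<close>, and it is monotone in the level. Hence two
  near-tie values of \<open>t\<close> differ by at most \<open>x\<close>. Centring an interval at
  any one of them gives length \<open>2 * x\<close>, and the density is at most
  \<open>B\<close>.\<close>

lemma near_ties_prob:
  assumes e: "e \<in> E" and x: "0 < x"
  shows "measure P {\<omega> \<in> space P. e \<in> near_ties \<omega> x} \<le> 2 * B * x"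
proof -
  let ?S = "{\<omega> \<in> space P. e \<in> near_ties \<omega> x}"
  have [measurable]: "?S \<in> sets P" by (rule sets_near_ties) simp
  have E: "insert e (E - {e}) = E" using e by auto
  have upd: "bypass (\<xi>(e := t)) l e \<longleftrightarrow> bypass \<xi> l e" for \<xi> t l
    unfolding bypass_iff by (intro bex_cong ball_cong refl) (auto simp: bypasses_def)
  have mono: "bypass \<xi> l e \<Longrightarrow> l \<le> l' \<Longrightarrow> bypass \<xi> l' e" for \<xi> l l'
    unfolding bypass_iff by (meson order_trans)
  have inner: "(\<integral>\<^sup>+ t. indicator ?S (\<xi>(e := t)) \<partial>\<mu>) \<le> ennreal (2 * B * x)" for \<xi>
  proof (cases "\<exists>t. \<xi>(e := t) \<in> ?S")
    case True
    then obtain s where s: "\<xi>(e := s) \<in> ?S" by blast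
    have cond: "bypass \<xi> t e \<and> \<not> bypass \<xi> (t - x) e" if "\<xi>(e := t) \<in> ?S" for t
      using that by (simp add: near_ties_def upd)
    have "indicator ?S (\<xi>(e := t)) \<le> (indicator {s - x..s + x} t :: ennreal)" for t
    proof (cases "\<xi>(e := t) \<in> ?S")
      case True
      have "\<not> t < s - x" using cond[OF True] cond[OF s] mono[of \<xi> t "s - x"] by auto
      moreover have "\<not> s < t - x" using cond[OF True] cond[OF s] mono[of \<xi> s "t - x"] by auto
      ultimately show ?thesis by (auto simp: indicator_def)
    qed simp
    then have "(\<integral>\<^sup>+ t. indicator ?S (\<xi>(e := t)) \<partial>\<mu>) \<le> (\<integral>\<^sup>+ t. indicator {s - x..s + x} t \<partial>\<mu>)"
      by (intro nn_integral_mono)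
    also have "\<dots> = emeasure \<mu> {s - x..s + x}" by simp
    also have "\<dots> \<le> ennreal (B * (s + x - (s - x)))"
      using B x by (intro length_measure_le density) auto
    finally show ?thesis by (simp add: algebra_simps)
  next
    case False
    have "indicator ?S (\<xi>(e := t)) = (0::ennreal)" for t
      by (rule indicator_simps(2)) (use False in blast)
    then show ?thesis by (simp only: nn_integral_const mult_zero_left zero_le)
  qed
  have "emeasure P ?S = (\<integral>\<^sup>+ \<omega>. indicator ?S \<omega> \<partial>PiM (insert e (E - {e})) (\<lambda>_. \<mu>))" unfolding E by simp
  also have "\<dots> = (\<integral>\<^sup>+ \<xi>. \<integral>\<^sup>+ t. indicator ?S (\<xi>(e := t)) \<partial>\<mu> \<partial>PiM (E - {e}) (\<lambda>_. \<mu>))"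
  proof (rule product_nn_integral_insert)
    show "indicator ?S \<in> borel_measurable (PiM (insert e (E - {e})) (\<lambda>_. \<mu>))" unfolding E by measurable
  qed (use finite_E in auto)
  also have "\<dots> \<le> (\<integral>\<^sup>+ \<omega>. ennreal (2 * B * x) \<partial>PiM (E - {e}) (\<lambda>_. \<mu>))"
    by (intro nn_integral_mono inner)
  also have "\<dots> = ennreal (2 * B * x)"
  proof -
    have "emeasure (PiM (E - {e}) (\<lambda>_. \<mu>)) (space (PiM (E - {e}) (\<lambda>_. \<mu>))) = 1"
      by (intro prob_space.emeasure_space_1 prob_space_PiM edge_density_prob_space density)
    then show ?thesis by simp
  qed
  finally show ?thesis using B x by (simp add: emeasure_eq_measure)
qed

definition total_length :: "((real ^ 'd) set \<Rightarrow> real) \<Rightarrow> real" where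
  "total_length \<omega> = (\<Sum>e\<in>E. \<bar>\<omega> e\<bar>) / real (card V)"

lemma eps_le_total_length:
  assumes "\<delta> \<le> 1 / 9"
  shows "eps V E \<omega> \<delta> \<le> total_length \<omega>"
proof -
  obtain T0 where T0: "spanning_tree V E T0" "real (card (T0 - mst V E \<omega>)) \<ge> \<delta> * real (card V)"
    using far_tree_exists[OF assms] by blast
  have "eps V E \<omega> \<delta> \<le> (tree_len \<omega> T0 - tree_len \<omega> (mst V E \<omega>)) / real (card V)" by (rule eps_le[OF T0])
  also have "\<dots> \<le> total_length \<omega>"
    unfolding total_length_def using is_mst_mst by (intro divide_right_mono tree_len_diff_le T0) (auto simp: is_mst_def)
  finally show ?thesis .
qed

lemma integrable_length: "integrable \<mu> (\<lambda>t. \<bar>t\<bar>)"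
proof -
  have [measurable]: "f \<in> borel_measurable borel" using density by (simp add: edge_density_def)
  have "integrable lborel (\<lambda>t. f t *\<^sub>R \<bar>t\<bar>)"
  proof (rule Bochner_Integration.integrable_cong[THEN iffD1, OF refl])
    show "integrable lborel (\<lambda>x. x * f x)" using density by (simp add: edge_density_def)
    show "t * f t = f t *\<^sub>R \<bar>t\<bar>" for t
      using density unfolding edge_density_def by (cases "t \<le> 0") auto
  qed
  then show ?thesis using density by (subst integrable_density) (auto simp: edge_density_def)
qed

lemma distr_length: "e \<in> E \<Longrightarrow> distr P \<mu> (\<lambda>\<omega>. \<omega> e) = \<mu>"
  by (rule distr_PiM_component) (use edge_density_prob_space[OF density] in auto)

lemma integrable_length_component:
  assumes "e \<in> E"
  shows "integrable P (\<lambda>\<omega>. \<bar>\<omega> e\<bar>)"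
proof -
  have "integrable (distr P \<mu> (\<lambda>\<omega>. \<omega> e)) (\<lambda>t. \<bar>t\<bar>)" unfolding distr_length[OF assms] by (rule integrable_length)
  then show ?thesis using assms by (subst (asm) integrable_distr_eq) auto
qed

lemma integrable_total_length: "integrable P total_length"
  unfolding total_length_def using integrable_length_component by auto

lemma expected_eps_ge:
  assumes \<delta>: "0 < \<delta>" "\<delta> \<le> 1 / 9"
  shows "\<delta>\<^sup>2 / (8 * real CARD('d) * B) \<le> (\<integral>\<omega>. eps V E \<omega> \<delta> \<partial>P)"
proof -
  let ?C = "2 * real CARD('d) * B"
  \<comment> \<open>The maximiser of \<open>x * (\<delta> - ?C * x)\<close>.\<close>
  define x where "x = \<delta> / (2 * ?C)"
  have C: "0 < ?C" using B by simp
  have x: "0 < x" using \<delta> C by (simp add: x_def)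
  have "x * (\<delta> - ?C * x) \<le> (\<integral>\<omega>. eps V E \<omega> \<delta> \<partial>P)"
  proof (rule expected_eps_lower[where Z = total_length])
    show "(\<Sum>e\<in>E. measure P {\<omega> \<in> space P. e \<in> near_ties \<omega> x}) \<le> ?C * x * real (card V)"
    proof -
      have "(\<Sum>e\<in>E. measure P {\<omega> \<in> space P. e \<in> near_ties \<omega> x}) \<le> (\<Sum>e\<in>E. 2 * B * x)"
        using near_ties_prob x by (intro sum_mono) auto
      also have "\<dots> = real (card E) * (2 * B * x)" by simp
      also have "\<dots> \<le> (real CARD('d) * real (card V)) * (2 * B * x)"
        using card_E_le B x by (intro mult_right_mono) auto
      finally show ?thesis by (simp add: mult_ac)
    qed
  qed (use V_pos x far_tree_exists[OF \<delta>(2)] integrable_total_length eps_le_total_length[OF \<delta>(2)] in \<open>auto intro: prob_space_axioms\<close>)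
  moreover have "x * (\<delta> - ?C * x) = \<delta>\<^sup>2 / (8 * real CARD('d) * B)"
    using C B unfolding x_def by (simp add: field_simps power2_eq_square)
  ultimately show ?thesis by simp
qed

section \<open>Good squares and their number\<close>

definition good :: "real \<Rightarrow> real ^ 'd \<Rightarrow> ((real ^ 'd) set \<Rightarrow> real) \<Rightarrow> bool" where
  "good h x \<omega> \<longleftrightarrow> \<omega> {x, x + ax k0} \<in> {t0<..t0 + \<eta>} \<and> \<omega> {x + ax k0, x + ax k0 + ax k1} \<in> {t0<..t0 + \<eta>}
     \<and> \<omega> {x + ax k0 + ax k1, x + ax k1} \<in> {t0 + \<eta><..t0 + 2 * \<eta>} \<and> \<omega> {x + ax k1, x} \<in> {t0 + \<eta><..t0 + 2 * \<eta>}
     \<and> \<bar>\<omega> {x + ax k0 + ax k1, x + ax k1} - \<omega> {x + ax k1, x}\<bar> \<le> h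
     \<and> (\<forall>g\<in>square_boundary x. \<omega> g \<in> {t0 + 3 * \<eta><..t0 + 4 * \<eta>})"

lemma square_cycle_edges:
  assumes "x \<in> square_bases"
  shows "{x, x + ax k0} \<in> E" "{x + ax k0, x + ax k0 + ax k1} \<in> E"
    "{x + ax k0 + ax k1, x + ax k1} \<in> E" "{x + ax k1, x} \<in> E"
  using square_cycle_subset[OF assms] by (auto simp: square_cycle_def)

lemma finite_square_boundary: "finite (square_boundary x)" "square_boundary x \<subseteq> E"
  using finite_E by (auto simp: square_boundary_def)

lemma sets_good:
  assumes "x \<in> square_bases"
  shows "{\<omega> \<in> space P. good h x \<omega>} \<in> sets P"
proof -
  note [measurable] = square_cycle_edges[OF assms, THEN measurable_length]
  have "{\<omega> \<in> space P. \<forall>g\<in>square_boundary x. \<omega> g \<in> {t0 + 3 * \<eta><..t0 + 4 * \<eta>}} \<in> sets P"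
  proof (intro sets.sets_Collect_finite_All finite_square_boundary)
    fix g assume "g \<in> square_boundary x"
    then have "g \<in> E" using finite_square_boundary(2) by blast
    note [measurable] = measurable_length[OF this]
    show "{\<omega> \<in> space P. \<omega> g \<in> {t0 + 3 * \<eta><..t0 + 4 * \<eta>}} \<in> sets P" by measurable
  qed
  then have [measurable]: "Measurable.pred P (\<lambda>\<omega>. \<forall>g\<in>square_boundary x. \<omega> g \<in> {t0 + 3 * \<eta><..t0 + 4 * \<eta>})"
    by (simp add: pred_def)
  show ?thesis unfolding good_def by measurable
qed

text \<open>Two short cycle edges and at most \<open>8 * CARD('d)\<close> boundary edges contribute
  a factor \<open>\<kappa> * \<eta>\<close> each. The pair of long edges contributes
  \<open>\<kappa>\<^sup>2 * \<eta> * h / 2\<close>: at least \<open>\<eta> / (2 * h)\<close> slots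
  of width \<open>h\<close>, each of probability at least
  \<open>(\<kappa> * h)\<^sup>2\<close>.\<close>

definition good_const :: real where
  "good_const = (\<kappa> * \<eta>) ^ (2 + 8 * CARD('d)) * \<kappa>\<^sup>2 * \<eta> / 2"

lemma good_const_pos: "0 < good_const"
  using \<kappa> by (simp add: good_const_def)

text \<open>The window of the two long edges is divided into slots of width \<open>h\<close>. If
  both lie in the same slot they differ by at most \<open>h\<close>; the events for different slots
  are disjoint, and each is a product event over the edges at the square.\<close>

lemma good_prob:
  assumes x: "x \<in> square_bases" and h: "0 < h" "h \<le> \<eta> / 2"
  shows "good_const * h \<le> measure P {\<omega> \<in> space P. good h x \<omega>}"
proof -
  let ?c1 = "{x, x + ax k0}" and ?c2 = "{x + ax k0, x + ax k0 + ax k1}"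
    and ?c3 = "{x + ax k0 + ax k1, x + ax k1}" and ?c4 = "{x + ax k1, x}"
  define J where "J = square_cycle x \<union> square_boundary x"
  define I where "I l = {t0 + \<eta> + real l * h<..t0 + \<eta> + real (Suc l) * h}" for l
  define X where "X l g = (if g \<in> {?c3, ?c4} then I l else if g \<in> {?c1, ?c2} then {t0<..t0 + \<eta>} else {t0 + 3 * \<eta><..t0 + 4 * \<eta>})" for l g
  define box where "box l = {\<omega> \<in> space P. \<forall>g\<in>J. \<omega> g \<in> X l g}" for l
  define n where "n = nat \<lfloor>\<eta> / h\<rfloor>"
  define q where "q = \<kappa> * \<eta>"
  have JE: "J \<subseteq> E" using square_cycle_subset[OF x] finite_square_boundary(2) by (simp add: J_def)
  have Jfin: "finite J" using JE finite_E finite_subset by blast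
  have Xm: "X l g \<in> sets \<mu>" for l g by (simp add: X_def I_def)
  have c34: "?c3 \<noteq> ?c4" "{?c3, ?c4} \<subseteq> J"
    using square_distinct[of x] by (auto simp: doubleton_eq_iff J_def square_cycle_def)
  \<comment> \<open>Here \<open>h \<le> \<eta> / 2\<close> ensures that rounding down loses at most
    half of the slots.\<close>
  have nb: "real n * h \<le> \<eta>" "\<eta> / (2 * h) \<le> real n"
  proof -
    have fl: "real n = of_int \<lfloor>\<eta> / h\<rfloor>" using h \<kappa> by (simp add: n_def)
    then have "real n \<le> \<eta> / h" by simp
    then show "real n * h \<le> \<eta>" using h by (simp add: field_simps)
    have "\<eta> / h - 1 \<le> real n" unfolding fl by linarith
    moreover have "1 \<le> \<eta> / (2 * h)" using h by (simp add: field_simps)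
    moreover have "\<eta> / h = \<eta> / (2 * h) + \<eta> / (2 * h)" by simp
    ultimately show "\<eta> / (2 * h) \<le> real n" by linarith
  qed
  have Il: "t0 + \<eta> + real (Suc l) * h \<le> t0 + 2 * \<eta>" if "l < n" for l
  proof -
    have "real (Suc l) * h \<le> real n * h" using that h by (intro mult_right_mono) auto
    then show ?thesis using nb by simp
  qed
  have I_sub: "I l \<subseteq> {t0 + \<eta><..t0 + 2 * \<eta>}" if "l < n" for l
  proof -
    have "0 \<le> real l * h" using h by simp
    then show ?thesis using Il[OF that] unfolding I_def by auto
  qed
  \<comment> \<open>\<open>q \<le> 1\<close> is wanted because the number of remaining factors is
    only bounded from above.\<close>
  have q: "0 < q" "q \<le> 1"
  proof -
    show "0 < q" using \<kappa> by (simp add: q_def)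
    have "\<kappa> * (t0 + \<eta> - t0) \<le> measure \<mu> {t0<..t0 + \<eta>}"
      using \<kappa> by (intro length_measure_ge density) auto
    also have "\<dots> \<le> 1" by (rule prob_space.prob_le_1[OF edge_density_prob_space[OF density]])
    finally show "q \<le> 1" by (simp add: q_def)
  qed
  have prob_box: "measure P (box l) \<ge> (\<kappa> * h)\<^sup>2 * q ^ (2 + 8 * CARD('d))" if l: "l < n" for l
  proof -
    have "emeasure P (box l) = (\<Prod>g\<in>J. emeasure \<mu> (X l g))"
      unfolding box_def by (rule emeasure_PiM_Collect[OF JE Jfin Xm])
    then have "measure P (box l) = (\<Prod>g\<in>J. measure \<mu> (X l g))"
      by (simp add: P.emeasure_eq_measure M.emeasure_eq_measure prod_ennreal prod_nonneg)
    also have "\<dots> = (\<Prod>g\<in>{?c3, ?c4}. measure \<mu> (X l g)) * (\<Prod>g\<in>J - {?c3, ?c4}. measure \<mu> (X l g))"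
      using prod.subset_diff[OF c34(2) Jfin] by (simp add: mult.commute)
    also have "(\<Prod>g\<in>{?c3, ?c4}. measure \<mu> (X l g)) = (measure \<mu> (I l))\<^sup>2"
      using c34(1) by (simp add: X_def power2_eq_square)
    also have "(measure \<mu> (I l))\<^sup>2 * (\<Prod>g\<in>J - {?c3, ?c4}. measure \<mu> (X l g)) \<ge> (\<kappa> * h)\<^sup>2 * q ^ (2 + 8 * CARD('d))"
    proof (intro mult_mono power_mono)
      have "\<kappa> * (t0 + \<eta> + real (Suc l) * h - (t0 + \<eta> + real l * h)) \<le> measure \<mu> (I l)"
        unfolding I_def
      proof (intro length_measure_ge density \<kappa>(3))
        fix y assume y: "t0 + \<eta> + real l * h \<le> y" "y \<le> t0 + \<eta> + real (Suc l) * h"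
        have "0 \<le> real l * h" using h by simp
        then show "t0 \<le> y" "y \<le> t0 + 4 * \<eta>" using y Il[OF l] \<kappa>(2) by linarith+
      qed (use \<kappa> h in \<open>auto intro: mult_right_mono\<close>)
      then show "\<kappa> * h \<le> measure \<mu> (I l)" by (simp add: algebra_simps)
      have "q ^ (2 + 8 * CARD('d)) \<le> q ^ card (J - {?c3, ?c4})"
      proof (rule power_decreasing)
        have "J - {?c3, ?c4} \<subseteq> {?c1, ?c2} \<union> square_boundary x" unfolding J_def square_cycle_def by auto
        then have "card (J - {?c3, ?c4}) \<le> card ({?c1, ?c2} \<union> square_boundary x)"
          using finite_square_boundary by (intro card_mono) auto
        also have "\<dots> \<le> card {?c1, ?c2} + card (square_boundary x)" by (rule card_Un_le)
        also have "\<dots> \<le> 2 + 8 * CARD('d)" using card_square_boundary_le[of x] by (intro add_mono) (auto simp: card_insert_if)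
        finally show "card (J - {?c3, ?c4}) \<le> 2 + 8 * CARD('d)" .
      qed (use q in auto)
      also have "q ^ card (J - {?c3, ?c4}) = (\<Prod>g\<in>J - {?c3, ?c4}. q)" by simp
      also have "\<dots> \<le> (\<Prod>g\<in>J - {?c3, ?c4}. measure \<mu> (X l g))"
      proof (rule prod_mono)
        fix g assume g: "g \<in> J - {?c3, ?c4}"
        have "\<kappa> * (t0 + \<eta> - t0) \<le> measure \<mu> {t0<..t0 + \<eta>}"
          using \<kappa> by (intro length_measure_ge density) auto
        moreover have "\<kappa> * (t0 + 4 * \<eta> - (t0 + 3 * \<eta>)) \<le> measure \<mu> {t0 + 3 * \<eta><..t0 + 4 * \<eta>}"
          using \<kappa> by (intro length_measure_ge density) auto
        ultimately show "0 \<le> q \<and> q \<le> measure \<mu> (X l g)" using g q by (auto simp: X_def q_def)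
      qed
      finally show "q ^ (2 + 8 * CARD('d)) \<le> (\<Prod>g\<in>J - {?c3, ?c4}. measure \<mu> (X l g))" .
    qed (use \<kappa> h q in auto)
    finally show ?thesis .
  qed
  have sub: "(\<Union>l\<in>{..<n}. box l) \<subseteq> {\<omega> \<in> space P. good h x \<omega>}"
  proof
    fix \<omega> assume "\<omega> \<in> (\<Union>l\<in>{..<n}. box l)"
    then obtain l where l: "l < n" and \<omega>: "\<omega> \<in> space P" "\<And>g. g \<in> J \<Longrightarrow> \<omega> g \<in> X l g" unfolding box_def by auto
    have J: "?c1 \<in> J" "?c2 \<in> J" "?c3 \<in> J" "?c4 \<in> J" by (auto simp: J_def square_cycle_def)
    have d: "?c1 \<noteq> ?c3" "?c1 \<noteq> ?c4" "?c2 \<noteq> ?c3" "?c2 \<noteq> ?c4"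
      using square_distinct[of x] by (auto simp: doubleton_eq_iff)
    have 34: "\<omega> ?c3 \<in> I l" "\<omega> ?c4 \<in> I l" using \<omega>(2)[OF J(3)] \<omega>(2)[OF J(4)] by (simp_all add: X_def)
    have 12: "\<omega> ?c1 \<in> {t0<..t0 + \<eta>}" "\<omega> ?c2 \<in> {t0<..t0 + \<eta>}"
      using \<omega>(2)[OF J(1)] \<omega>(2)[OF J(2)] d unfolding X_def by (simp_all only: insert_iff empty_iff simp_thms if_True if_False)
    have "\<bar>\<omega> ?c3 - \<omega> ?c4\<bar> \<le> h" using 34 unfolding I_def by (auto simp: algebra_simps)
    moreover have "\<omega> g \<in> {t0 + 3 * \<eta><..t0 + 4 * \<eta>}" if g: "g \<in> square_boundary x" for g
    proof -
      have "g \<notin> square_cycle x" using g by (simp add: square_boundary_def)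
      then have "g \<notin> {?c3, ?c4}" "g \<notin> {?c1, ?c2}" by (auto simp: square_cycle_def)
      then have "X l g = {t0 + 3 * \<eta><..t0 + 4 * \<eta>}" unfolding X_def by (simp only: if_False)
      then show ?thesis using \<omega>(2)[of g] g by (simp add: J_def)
    qed
    ultimately show "\<omega> \<in> {\<omega> \<in> space P. good h x \<omega>}"
      unfolding good_def using \<omega>(1) 12 34 I_sub[OF l] by blast
  qed
  have box_sets: "box l \<in> sets P" for l
    unfolding box_def
  proof (intro sets.sets_Collect_finite_All Jfin)
    fix g assume "g \<in> J"
    then have "g \<in> E" using JE by blast
    note [measurable] = measurable_length[OF this]
    have [measurable]: "X l g \<in> sets borel" using Xm by simp
    show "{\<omega> \<in> space P. \<omega> g \<in> X l g} \<in> sets P" by measurable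
  qed
  have disj: "disjoint_family_on box {..<n}"
    unfolding disjoint_family_on_def
  proof (intro ballI impI)
    fix l l' :: nat assume ll: "l \<noteq> l'"
    have "I l \<inter> I l' = {}" if "l < l'" for l l'
    proof -
      have "real (Suc l) * h \<le> real l' * h" using that h by (intro mult_right_mono) auto
      then show ?thesis unfolding I_def by auto
    qed
    then have I: "I l \<inter> I l' = {}" using ll by (metis Int_commute linorder_neqE_nat)
    show "box l \<inter> box l' = {}"
    proof (rule ccontr)
      assume "box l \<inter> box l' \<noteq> {}"
      then obtain \<omega> where "\<omega> ?c3 \<in> X l ?c3" "\<omega> ?c3 \<in> X l' ?c3" using c34 unfolding box_def by blast
      then show False using I by (auto simp: X_def)
    qed
  qed
  have "good_const * h = \<eta> / (2 * h) * ((\<kappa> * h)\<^sup>2 * q ^ (2 + 8 * CARD('d)))"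
    using h by (simp add: good_const_def q_def power2_eq_square)
  also have "\<dots> \<le> real n * ((\<kappa> * h)\<^sup>2 * q ^ (2 + 8 * CARD('d)))"
    using nb q by (intro mult_right_mono) auto
  also have "\<dots> \<le> (\<Sum>l<n. measure P (box l))"
    using prob_box by (intro sum_bounded_below[where A = "{..<n}", simplified]) auto
  also have "\<dots> = measure P (\<Union>l\<in>{..<n}. box l)"
    using box_sets disj by (intro finite_measure_finite_Union[symmetric]) auto
  also have "\<dots> \<le> measure P {\<omega> \<in> space P. good h x \<omega>}"
    using sub by (intro finite_measure_mono sets_good x)
  finally show ?thesis .
qed

end

text \<open>With only a finite mean, the total length on an event of small probability is controlled
  by truncation: lengths up to \<open>k\<close> are charged to the probability of the event, longer
  ones to this tail.\<close>

lemma integral_tail_tendsto_zero: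
  fixes M :: "real measure"
  assumes sets: "sets M = sets borel" and int: "integrable M (\<lambda>t. \<bar>t\<bar>)"
  shows "(\<lambda>k::nat. \<integral>t. \<bar>t\<bar> * indicator {t. real k < \<bar>t\<bar>} t \<partial>M) \<longlonglongrightarrow> 0"
proof -
  note [measurable_cong] = sets
  have "(\<lambda>k::nat. \<integral>t. \<bar>t\<bar> * indicator {t. real k < \<bar>t\<bar>} t \<partial>M) \<longlonglongrightarrow> (\<integral>t. 0 \<partial>M)"
  proof (rule integral_dominated_convergence[where w = "\<lambda>t. \<bar>t\<bar>"])
    show "AE t in M. (\<lambda>k::nat. \<bar>t\<bar> * indicator {t. real k < \<bar>t\<bar>} t) \<longlonglongrightarrow> 0"
    proof (rule AE_I2)
      fix t :: real
      obtain k0 :: nat where k0: "\<bar>t\<bar> \<le> real k0" using real_arch_simple by blast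
      have "\<forall>\<^sub>F k in sequentially. \<bar>t\<bar> * indicator {t. real k < \<bar>t\<bar>} t = 0"
        using eventually_ge_at_top[of k0] by eventually_elim (use k0 in \<open>auto simp: indicator_def\<close>)
      then show "(\<lambda>k::nat. \<bar>t\<bar> * indicator {t. real k < \<bar>t\<bar>} t) \<longlonglongrightarrow> 0"
        by (rule tendsto_eventually)
    qed
  qed (use int in \<open>auto simp: indicator_def\<close>)
  then show ?thesis by simp
qed

context random_lattice
begin

lemma good_update:
  assumes "e \<inter> square x = {}"
  shows "good h x (\<xi>(e := y)) \<longleftrightarrow> good h x \<xi>"
proof -
  have *: "(\<xi>(e := y)) g = \<xi> g" if "g \<inter> square x \<noteq> {}" for g
    using assms that by (cases "g = e") auto
  have "{x, x + ax k0} \<inter> square x \<noteq> {}" "{x + ax k0, x + ax k0 + ax k1} \<inter> square x \<noteq> {}"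
    "{x + ax k0 + ax k1, x + ax k1} \<inter> square x \<noteq> {}" "{x + ax k1, x} \<inter> square x \<noteq> {}"
    by (auto simp: square_def)
  note ** = this[THEN *]
  have "(\<forall>g\<in>square_boundary x. (\<xi>(e := y)) g \<in> {t0 + 3 * \<eta><..t0 + 4 * \<eta>})
      \<longleftrightarrow> (\<forall>g\<in>square_boundary x. \<xi> g \<in> {t0 + 3 * \<eta><..t0 + 4 * \<eta>})"
    using * by (intro ball_cong refl) (simp add: square_boundary_def)
  then show ?thesis unfolding good_def ** by simp
qed

lemma eps_le_good:
  assumes h: "0 \<le> h" and k: "\<delta> * real (card V) \<le> real k" "k \<le> card {x \<in> square_bases. good h x \<omega>}"
  shows "eps V E \<omega> \<delta> \<le> h * real k / real (card V)"
proof -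
  obtain K where K: "K \<subseteq> {x \<in> square_bases. good h x \<omega>}" "card K = k" "finite K"
    using obtain_subset_with_card_n[OF k(2)] by blast
  have sub: "x \<in> square_bases" "good h x \<omega>" if "x \<in> K" for x using K(1) that by auto
  have "eps V E \<omega> \<delta> \<le> h * real (card K) / real (card V)"
  proof (rule eps_upper[where C = square_cycle and W = square])
    show "finite K" "\<delta> * real (card V) \<le> real (card K)" using K k by auto
    show "square_cycle x \<noteq> {}" for x by (simp add: square_cycle_def)
    show "e \<in> square_cycle x \<or> (\<forall>c\<in>square_cycle x. \<omega> c < \<omega> e)"
      if "x \<in> K" "e \<in> E" "e \<inter> square x \<noteq> {}" for x e
    proof (cases "e \<in> square_cycle x")
      case False
      then have "e \<in> square_boundary x" using that by (simp add: square_boundary_def)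
      then have "t0 + 3 * \<eta> < \<omega> e" using sub(2)[OF that(1)] by (auto simp: good_def)
      moreover have "\<omega> c \<le> t0 + 2 * \<eta>" if c: "c \<in> square_cycle x" for c
        using sub(2)[OF \<open>x \<in> K\<close>] c \<kappa>(2) unfolding good_def square_cycle_def by auto
      ultimately show ?thesis using \<kappa>(2) by fastforce
    qed simp
    show "\<exists>c\<in>square_cycle x. c \<noteq> e \<and> \<omega> e \<le> \<omega> c + h"
      if x: "x \<in> K" and e: "e \<in> square_cycle x" for x e
    proof -
      let ?c1 = "{x, x + ax k0}" and ?c2 = "{x + ax k0, x + ax k0 + ax k1}"
        and ?c3 = "{x + ax k0 + ax k1, x + ax k1}" and ?c4 = "{x + ax k1, x}"
      have g: "\<omega> ?c1 \<le> t0 + \<eta>" "\<omega> ?c2 \<le> t0 + \<eta>" "t0 + \<eta> < \<omega> ?c3" "\<bar>\<omega> ?c3 - \<omega> ?c4\<bar> \<le> h"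
        using sub(2)[OF x] unfolding good_def by auto
      have d: "?c1 \<noteq> ?c3" "?c2 \<noteq> ?c3" "?c4 \<noteq> ?c3"
        using square_distinct[of x] by (auto simp: doubleton_eq_iff)
      have m: "?c3 \<in> square_cycle x" "?c4 \<in> square_cycle x" by (auto simp: square_cycle_def)
      \<comment> \<open>The two short edges are shorter than \<open>?c3\<close>, which is a trivial
        witness for them; the bound by \<open>h\<close> is used for the long pair.\<close>
      from e consider "e = ?c1" | "e = ?c2" | "e = ?c3" | "e = ?c4" unfolding square_cycle_def by blast
      then show ?thesis
      proof cases
        case 1 then show ?thesis using g h d m by (intro bexI[of _ ?c3]) auto
      next
        case 2 then show ?thesis using g h d m by (intro bexI[of _ ?c3]) auto
      next
        case 3 then show ?thesis using g h d m by (intro bexI[of _ ?c4]) auto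
      next
        case 4 then show ?thesis using g h d m by (intro bexI[of _ ?c3]) auto
      qed
    qed
  qed (use sub cyc_square_cycle square_cycle_subset square_cycle_Pow square_disjoint in auto)
  then show ?thesis using K by simp
qed

text \<open>The factor 36 makes the mean at least
  \<open>card V / 9 * (good_const * h) = 4 * \<delta> * card V\<close>, twice the threshold, and the
  bound on \<open>\<delta>\<close> is what \<open>h \<le> \<eta> / 2\<close> requires. An edge has
  two ends and so meets at most two of the disjoint squares, whence the difference bound 2.\<close>

lemma bad_prob:
  assumes \<delta>: "0 < \<delta>" "\<delta> \<le> \<eta> * good_const / 72" and h: "h = 36 * \<delta> / good_const"
  shows "measure P {\<omega> \<in> space P. real (card {x \<in> square_bases. good h x \<omega>}) < 2 * \<delta> * real (card V)}
    \<le> real CARD('d) / (\<delta>\<^sup>2 * real (card V))"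
proof -
  let ?N = "\<lambda>\<omega>. real (card {x \<in> square_bases. good h x \<omega>})"
  let ?n = "real (card V)"
  have n: "0 < ?n" using V_pos by simp
  have hp: "0 < h" "h \<le> \<eta> / 2" using \<delta> good_const_pos unfolding h by (auto simp: field_simps)
  have Nm: "?N \<in> borel_measurable P" and EN: "P.expectation ?N = (\<Sum>x\<in>square_bases. P.prob {\<omega> \<in> space P. good h x \<omega>})"
    using P.expectation_card[of square_bases "\<lambda>x \<omega>. good h x \<omega>"] finite_square_bases sets_good by auto
  have "4 * \<delta> * ?n = (1 / 9 * ?n) * (good_const * h)" using good_const_pos by (simp add: h)
  also have "\<dots> \<le> real (card square_bases) * (good_const * h)"
    using card_V_le good_const_pos hp by (intro mult_right_mono) auto
  also have "\<dots> \<le> P.expectation ?N"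
    unfolding EN using good_prob[OF _ hp] by (intro sum_bounded_below) auto
  finally have mean: "2 * (2 * \<delta> * ?n) \<le> P.expectation ?N" by simp
  have "measure P {\<omega> \<in> space P. ?N \<omega> < 2 * \<delta> * ?n} \<le> real (card E) * 2\<^sup>2 / (2 * \<delta> * ?n)\<^sup>2"
  proof (rule bounded_differences_lower_tail[where K = "real (card square_bases)"])
    show "\<bar>?N \<omega>\<bar> \<le> real (card square_bases)" for \<omega>
      using finite_square_bases by (simp add: card_mono)
    show "\<bar>?N (\<xi>(e := y)) - ?N \<xi>\<bar> \<le> 2" if e: "e \<in> E" for e \<xi> y
    proof -
      have "\<bar>?N (\<xi>(e := y)) - ?N \<xi>\<bar> \<le> real 2"
      proof (rule card_filter_diff_le[where K = "{x \<in> square_bases. e \<inter> square x \<noteq> {}}"])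
        obtain u v where uv: "e = {u, v}" using edge[OF e] by blast
        have "card {x \<in> square_bases. e \<inter> square x \<noteq> {}} \<le> card e"
          by (rule card_disjoint_touching) (use finite_square_bases square_disjoint uv in auto)
        also have "\<dots> \<le> 2" unfolding uv by (simp add: card_insert_if)
        finally show "card {x \<in> square_bases. e \<inter> square x \<noteq> {}} \<le> 2" .
        show "good h x (\<xi>(e := y)) \<longleftrightarrow> good h x \<xi>" if "x \<in> square_bases - {x \<in> square_bases. e \<inter> square x \<noteq> {}}" for x
          using good_update that by blast
      qed (use finite_square_bases in auto)
      then show ?thesis by simp
    qed
  qed (use Nm mean \<delta> n finite_E edge_density_prob_space[OF density] in auto)
  also have "\<dots> \<le> (real CARD('d) * ?n) * 2\<^sup>2 / (2 * \<delta> * ?n)\<^sup>2"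
    using card_E_le by (intro divide_right_mono mult_right_mono) auto
  also have "\<dots> = real CARD('d) / (\<delta>\<^sup>2 * ?n)"
    using n \<delta> by (simp add: field_simps power2_eq_square)
  finally show ?thesis .
qed

text \<open>Off the bad event, rounding \<open>\<delta> * card V\<close> up to an integer at most
  doubles it, by the assumption on \<open>card V\<close>, so the cost is at most
  \<open>h * (2 * \<delta>)\<close>. On the bad event the total length takes over, truncated at
  \<open>k\<close>.\<close>

lemma expected_eps_le:
  fixes k :: nat
  assumes \<delta>: "0 < \<delta>" "\<delta> \<le> 1 / 9" "\<delta> \<le> \<eta> * good_const / 72" and n: "1 / \<delta> \<le> real (card V)"
  shows "(\<integral>\<omega>. eps V E \<omega> \<delta> \<partial>P) \<le> 72 / good_const * \<delta>\<^sup>2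
    + real CARD('d) * (real k * (real CARD('d) / (\<delta>\<^sup>2 * real (card V))) + (\<integral>t. \<bar>t\<bar> * indicator {t. real k < \<bar>t\<bar>} t \<partial>\<mu>))"
proof -
  let ?n = "real (card V)" and ?dm = "real CARD('d)"
  define h where "h = 36 * \<delta> / good_const"
  define A where "A = {\<omega> \<in> space P. real (card {x \<in> square_bases. good h x \<omega>}) < 2 * \<delta> * ?n}"
  define \<tau> where "\<tau> = (\<integral>t. \<bar>t\<bar> * indicator {t. real k < \<bar>t\<bar>} t \<partial>\<mu>)"
  have hp: "0 \<le> h" using \<delta> good_const_pos by (simp add: h_def)
  have np: "0 < ?n" using V_pos by simp
  have Am[measurable]: "A \<in> sets P"
  proof -
    have [measurable]: "(\<lambda>\<omega>. real (card {x \<in> square_bases. good h x \<omega>})) \<in> borel_measurable P"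
      using P.expectation_card(1)[of square_bases "\<lambda>x \<omega>. good h x \<omega>"] finite_square_bases sets_good by auto
    show ?thesis unfolding A_def by measurable
  qed
  have pt: "eps V E \<omega> \<delta> \<le> 72 / good_const * \<delta>\<^sup>2 + total_length \<omega> * indicator A \<omega>" if \<omega>: "\<omega> \<in> space P" for \<omega>
  proof (cases "\<omega> \<in> A")
    case True
    have "0 \<le> 72 / good_const * \<delta>\<^sup>2" using good_const_pos by simp
    then show ?thesis using eps_le_total_length[OF \<delta>(2), of \<omega>] True by simp
  next
    case False
    define c where "c = nat \<lceil>\<delta> * ?n\<rceil>"
    have c1: "\<delta> * ?n \<le> real c" unfolding c_def by linarith
    have "real c \<le> \<delta> * ?n + 1" using \<delta> np unfolding c_def by (simp add: of_nat_nat ceiling_le_iff)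
    moreover have "1 \<le> \<delta> * ?n" using n \<delta> by (simp add: field_simps)
    ultimately have c2: "real c \<le> 2 * \<delta> * ?n" by simp
    have "2 * \<delta> * ?n \<le> real (card {x \<in> square_bases. good h x \<omega>})" using False \<omega> by (simp add: A_def)
    then have "c \<le> card {x \<in> square_bases. good h x \<omega>}" using c2 by linarith
    then have "eps V E \<omega> \<delta> \<le> h * real c / ?n" by (rule eps_le_good[OF hp c1])
    also have "\<dots> \<le> h * (2 * \<delta> * ?n) / ?n" using c2 hp by (intro divide_right_mono mult_left_mono) auto
    also have "\<dots> = 72 / good_const * \<delta>\<^sup>2" using np by (simp add: h_def power2_eq_square)
    finally show ?thesis using False by simp
  qed
  have intA: "integrable P (\<lambda>\<omega>. \<bar>\<omega> e\<bar> * indicator A \<omega>)" if "e \<in> E" for e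
    using integrable_length_component[OF that] by (rule integrable_mult_indicator[OF Am, unfolded real_scaleR_def, THEN Bochner_Integration.integrable_cong[THEN iffD1, rotated 2]]) (auto simp: mult.commute)
  \<comment> \<open>\<open>A\<close> may depend on the length of \<open>e\<close>, so the
    expectation does not factor; splitting the length at \<open>k\<close> gets around this.\<close>
  have eA: "(\<integral>\<omega>. \<bar>\<omega> e\<bar> * indicator A \<omega> \<partial>P) \<le> real k * P.prob A + \<tau>" if e: "e \<in> E" for e
  proof -
    note [measurable] = measurable_length[OF e]
    have i1: "integrable P (\<lambda>\<omega>. real k * indicator A \<omega>)" by (intro integrable_mult_right integrable_real_indicator) (auto simp: P.emeasure_eq_measure)
    have i2: "integrable P (\<lambda>\<omega>. \<bar>\<omega> e\<bar> * indicator {t. real k < \<bar>t\<bar>} (\<omega> e))"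
      by (rule Bochner_Integration.integrable_bound[OF integrable_length_component[OF e]]) (auto simp: indicator_def)
    have "(\<integral>\<omega>. \<bar>\<omega> e\<bar> * indicator A \<omega> \<partial>P) \<le> (\<integral>\<omega>. real k * indicator A \<omega> + \<bar>\<omega> e\<bar> * indicator {t. real k < \<bar>t\<bar>} (\<omega> e) \<partial>P)"
      using i1 i2 intA[OF e] by (intro integral_mono) (auto simp: indicator_def)
    also have "\<dots> = real k * P.prob A + (\<integral>\<omega>. \<bar>\<omega> e\<bar> * indicator {t. real k < \<bar>t\<bar>} (\<omega> e) \<partial>P)"
      using i1 i2 by (simp add: A_def Int_absorb2)
    also have "(\<integral>\<omega>. \<bar>\<omega> e\<bar> * indicator {t. real k < \<bar>t\<bar>} (\<omega> e) \<partial>P) = (\<integral>t. \<bar>t\<bar> * indicator {t. real k < \<bar>t\<bar>} t \<partial>distr P \<mu> (\<lambda>\<omega>. \<omega> e))"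
      by (subst integral_distr) auto
    finally show ?thesis unfolding distr_length[OF e] \<tau>_def .
  qed
  have \<tau>: "0 \<le> \<tau>" unfolding \<tau>_def by (intro integral_nonneg_AE) auto
  have tot: "total_length \<omega> * indicator A \<omega> = (\<Sum>e\<in>E. \<bar>\<omega> e\<bar> * indicator A \<omega>) / ?n" for \<omega>
    by (simp add: total_length_def sum_distrib_right)
  have itot: "integrable P (\<lambda>\<omega>. total_length \<omega> * indicator A \<omega>)"
    unfolding tot using intA by (intro integrable_divide Bochner_Integration.integrable_sum) auto
  have "(\<integral>\<omega>. eps V E \<omega> \<delta> \<partial>P) \<le> (\<integral>\<omega>. 72 / good_const * \<delta>\<^sup>2 + total_length \<omega> * indicator A \<omega> \<partial>P)"
  proof (rule integral_mono')
    show "0 \<le> 72 / good_const * \<delta>\<^sup>2 + total_length \<omega> * indicator A \<omega>" for \<omega>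
      using good_const_pos by (auto simp: total_length_def indicator_def intro!: sum_nonneg divide_nonneg_nonneg add_nonneg_nonneg)
  qed (use itot pt in auto)
  also have "\<dots> = 72 / good_const * \<delta>\<^sup>2 + (\<Sum>e\<in>E. (\<integral>\<omega>. \<bar>\<omega> e\<bar> * indicator A \<omega> \<partial>P)) / ?n"
    using itot intA by (simp add: P.prob_space tot)
  also have "(\<Sum>e\<in>E. (\<integral>\<omega>. \<bar>\<omega> e\<bar> * indicator A \<omega> \<partial>P)) \<le> real (card E) * (real k * P.prob A + \<tau>)"
    using eA by (intro sum_bounded_above) auto
  also have "real (card E) * (real k * P.prob A + \<tau>) \<le> (?dm * ?n) * (real k * (?dm / (\<delta>\<^sup>2 * ?n)) + \<tau>)"
    using card_E_le \<tau> bad_prob[OF \<delta>(1,3) h_def] unfolding A_def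
    by (intro mult_mono add_mono mult_left_mono add_nonneg_nonneg mult_nonneg_nonneg) auto
  finally show ?thesis using np by (simp add: \<tau>_def divide_right_mono mult.assoc)
qed

end

lemma card2_distinct:
  assumes "CARD('d::finite) \<ge> 2"
  obtains k0 k1 :: "'d::finite" where "k0 \<noteq> k1"
proof -
  have "\<not> (\<forall>x y :: 'd. x = y)"
  proof
    assume a: "\<forall>x y :: 'd. x = y"
    have "CARD('d) \<le> 1" by (rule card_le_Suc0_iff_eq[THEN iffD2, unfolded One_nat_def[symmetric]]) (use a in auto)
    then show False using assms by simp
  qed
  then show ?thesis using that by blast
qed

lemma disordered_lattice_scaling:
  assumes d: "CARD('d::finite) \<ge> 2" and f: "edge_density f"
  shows "Limsup (at_right 0) (\<lambda>\<delta>::real. ereal (1 / \<delta>\<^sup>2) *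
      limsup (\<lambda>m. ereal (expected_eps1 TYPE('d) f m \<delta>))) < \<infinity>"
    and "Liminf (at_right 0) (\<lambda>\<delta>::real. ereal (1 / \<delta>\<^sup>2) *
      liminf (\<lambda>m. ereal (expected_eps1 TYPE('d) f m \<delta>))) > 0"
proof -
  obtain k0 k1 :: 'd where k01: "k0 \<noteq> k1" using card2_distinct[OF d] .
  obtain B where B: "0 < B" "\<And>x. f x \<le> B" using edge_density_bounded[OF f] by auto
  obtain \<kappa> t0 \<eta> where \<kappa>: "0 < \<kappa>" "0 < \<eta>" "\<And>y. t0 \<le> y \<Longrightarrow> y \<le> t0 + 4 * \<eta> \<Longrightarrow> \<kappa> \<le> f y"
    using edge_density_pos_interval[OF f] by metis
  have rl: "random_lattice k0 k1 m f B \<kappa> t0 \<eta>" if "2 \<le> m" for m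
    using k01 that f B \<kappa> by unfold_locales auto
  let ?c = "(\<kappa> * \<eta>) ^ (2 + 8 * CARD('d)) * \<kappa>\<^sup>2 * \<eta> / 2" and ?dm = "real CARD('d)"
  have c: "0 < ?c" using \<kappa> by simp
  have gc: "random_lattice.good_const TYPE('d) \<kappa> \<eta> = ?c"
    using random_lattice.good_const_def[OF rl[of 2]] by simp
  show "Limsup (at_right 0) (\<lambda>\<delta>::real. ereal (1 / \<delta>\<^sup>2) * limsup (\<lambda>m. ereal (expected_eps1 TYPE('d) f m \<delta>))) < \<infinity>"
  proof (rule Limsup_scaled_finite)
    show "0 < min (1 / 9) (\<eta> * ?c / 72)" using c \<kappa> by simp
    fix \<delta> :: real assume \<delta>: "0 < \<delta>" "\<delta> < min (1 / 9) (\<eta> * ?c / 72)"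
    have int: "integrable (length_measure f) (\<lambda>t. \<bar>t\<bar>)" using random_lattice.integrable_length[OF rl[of 2]] by simp
    have "(\<lambda>k::nat. ?dm * (\<integral>t. \<bar>t\<bar> * indicator {t. real k < \<bar>t\<bar>} t \<partial>length_measure f)) \<longlonglongrightarrow> ?dm * 0"
      by (intro tendsto_mult_left integral_tail_tendsto_zero int) simp
    then have "\<forall>\<^sub>F k::nat in sequentially. ?dm * (\<integral>t. \<bar>t\<bar> * indicator {t. real k < \<bar>t\<bar>} t \<partial>length_measure f) < \<delta>\<^sup>2"
      by (rule order_tendstoD(2)) (use \<delta> in simp)
    then obtain k :: nat where k: "?dm * (\<integral>t. \<bar>t\<bar> * indicator {t. real k < \<bar>t\<bar>} t \<partial>length_measure f) < \<delta>\<^sup>2"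
      by (meson eventually_sequentially order_refl)
    \<comment> \<open>The order of choices is \<open>\<delta>\<close>, then the truncation
      \<open>k\<close>, then the size of the lattice. The tail costs one
      \<open>\<delta>\<^sup>2\<close>, and \<open>m0\<close> makes the truncated part cost at most
      another.\<close>
    obtain m0 :: nat where m0: "max (1 / \<delta>) (?dm * real k * ?dm / \<delta>\<^sup>2 / \<delta>\<^sup>2) \<le> real m0" using real_arch_simple by blast
    show "\<forall>\<^sub>F m in sequentially. expected_eps1 TYPE('d) f m \<delta> \<le> (72 / ?c + 2) * \<delta>\<^sup>2"
      using eventually_ge_at_top[of "max 2 m0"]
    proof eventually_elim
      case (elim m)
      let ?n = "real (card (lattice_vertices m :: (real ^ 'd) set))"
      have mn: "real m \<le> ?n" using card_lattice_vertices_ge[of m, where ?'d = 'd] by simp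
      have n0: "0 < ?n" using mn elim by simp
      have n1: "1 / \<delta> \<le> ?n" "?dm * real k * ?dm / \<delta>\<^sup>2 / \<delta>\<^sup>2 \<le> ?n" using m0 mn elim by auto
      have m2: "2 \<le> m" using elim by simp
      have "expected_eps1 TYPE('d) f m \<delta> \<le> 72 / ?c * \<delta>\<^sup>2 + ?dm * (real k * (?dm / (\<delta>\<^sup>2 * ?n)) + (\<integral>t. \<bar>t\<bar> * indicator {t. real k < \<bar>t\<bar>} t \<partial>length_measure f))"
        unfolding expected_eps1_def lattice_measure_def
        using random_lattice.expected_eps_le[OF rl[OF m2], of \<delta> k] \<delta> n1 unfolding gc by simp
      moreover have "?dm * (real k * (?dm / (\<delta>\<^sup>2 * ?n))) \<le> \<delta>\<^sup>2"
        using n1(2) n0 \<delta> by (simp add: field_simps)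
      ultimately show ?case using k by (simp add: algebra_simps)
    qed
  qed
  show "Liminf (at_right 0) (\<lambda>\<delta>::real. ereal (1 / \<delta>\<^sup>2) * liminf (\<lambda>m. ereal (expected_eps1 TYPE('d) f m \<delta>))) > 0"
  proof (rule Liminf_scaled_pos)
    show "(0::real) < 1 / 9" by simp
    show "0 < 1 / (8 * ?dm * B)" using B by simp
    fix \<delta> :: real assume \<delta>: "0 < \<delta>" "\<delta> < 1 / 9"
    show "\<forall>\<^sub>F m in sequentially. 1 / (8 * ?dm * B) * \<delta>\<^sup>2 \<le> expected_eps1 TYPE('d) f m \<delta>"
      using eventually_ge_at_top[of 2]
    proof eventually_elim
      case (elim m)
      show ?case unfolding expected_eps1_def lattice_measure_def
        using random_lattice.expected_eps_ge[OF rl[OF elim], of \<delta>] \<delta> by simp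
    qed
  qed
qed

section \<open>The random Euclidean model: lower bound\<close>

context network
begin

section \<open>The minimax length as a function of the weights\<close>

definition crit :: "('v set \<Rightarrow> real) \<Rightarrow> 'v set \<Rightarrow> real" where
  "crit w e = Min ((\<lambda>S. Max (w ` S)) ` bypasses e)"

lemma bypassesD:
  assumes "S \<in> bypasses e" "e \<in> E"
  shows "finite S" "S \<noteq> {}" "S \<subseteq> E - {e}"
proof -
  show S: "S \<subseteq> E - {e}" using assms by (simp add: bypasses_def)
  then show "finite S" using finite_E finite_subset by blast
  obtain u v where uv: "e = {u, v}" "conn S u v" using assms by (auto simp: bypasses_def)
  have "u \<noteq> v" using edge_in_V(3) assms(2) uv by blast
  then show "S \<noteq> {}" using uv(2) conn_isolated[of u v "{}"] by auto
qed

lemma bypass_iff_crit: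
  assumes "e \<in> E" "bypasses e \<noteq> {}"
  shows "bypass w l e \<longleftrightarrow> crit w e \<le> l"
proof -
  have "crit w e \<le> l \<longleftrightarrow> (\<exists>S\<in>bypasses e. Max (w ` S) \<le> l)"
    unfolding crit_def using finite_bypasses assms(2) by (simp add: Min_le_iff)
  also have "\<dots> \<longleftrightarrow> bypass w l e"
    unfolding bypass_iff using bypassesD[OF _ assms(1)] by (intro bex_cong refl) (simp add: Max_le_iff)
  finally show ?thesis by simp
qed

lemma crit_in_lengths:
  assumes "e \<in> E" "bypasses e \<noteq> {}"
  shows "crit w e \<in> w ` (E - {e})"
proof -
  have "crit w e \<in> (\<lambda>S. Max (w ` S)) ` bypasses e"
    unfolding crit_def using finite_bypasses assms(2) by (intro Min_in) auto
  then obtain S where S: "S \<in> bypasses e" "crit w e = Max (w ` S)" by blast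
  have "Max (w ` S) \<in> w ` S" using bypassesD[OF S(1) assms(1)] by (intro Max_in) auto
  then show ?thesis using S bypassesD(3)[OF S(1) assms(1)] by auto
qed

text \<open>If no length rises by more than \<open>D\<close>, a bypass at level l remains a bypass
  at level l + D; this is used in both directions between \<open>w\<close> and
  \<open>w'\<close>.\<close>

lemma crit_lipschitz:
  assumes "e \<in> E" "bypasses e \<noteq> {}" and d: "\<And>g. g \<in> E \<Longrightarrow> \<bar>w g - w' g\<bar> \<le> D"
  shows "\<bar>crit w e - crit w' e\<bar> \<le> D"
proof -
  have "crit v' e \<le> crit v e + D" if "\<And>g. g \<in> E \<Longrightarrow> v' g \<le> v g + D" for v v'
  proof -
    have "bypass v (crit v e) e" using bypass_iff_crit[OF assms(1,2)] by blast
    then obtain S where S: "S \<in> bypasses e" "\<And>g. g \<in> S \<Longrightarrow> v g \<le> crit v e" unfolding bypass_iff by blast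
    have "v' g \<le> crit v e + D" if g: "g \<in> S" for g
    proof -
      have "g \<in> E" using bypassesD(3)[OF S(1) assms(1)] g by blast
      then show ?thesis using that S(2)[OF g] \<open>\<And>g. g \<in> E \<Longrightarrow> v' g \<le> v g + D\<close>[of g] by linarith
    qed
    then have "bypass v' (crit v e + D) e" unfolding bypass_iff using S(1) by blast
    then show ?thesis using bypass_iff_crit[OF assms(1,2)] by blast
  qed
  from this[of w' w] this[of w w'] show ?thesis using d by (fastforce simp: abs_le_iff)
qed

lemma borel_measurable_crit:
  assumes e: "e \<in> E" and w: "\<And>e. e \<in> E \<Longrightarrow> (\<lambda>\<omega>. w \<omega> e) \<in> borel_measurable M"
  shows "(\<lambda>\<omega>. crit (w \<omega>) e) \<in> borel_measurable M"
  unfolding crit_def using bypassesD[OF _ e] w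
  by (intro borel_measurable_Min finite_bypasses borel_measurable_Max) blast+

end

lemma euclid_len_pair: "euclid_len p {i, j} = dist (p i) (p j)"
proof -
  have "{dist (p a) (p b) | a b. a \<in> {i, j} \<and> b \<in> {i, j}}
      = {dist (p i) (p i), dist (p i) (p j), dist (p j) (p i), dist (p j) (p j)}"
    by blast
  then have "{dist (p a) (p b) | a b. a \<in> {i, j} \<and> b \<in> {i, j}} = {0, dist (p i) (p j)}"
    by (auto simp: dist_commute)
  then show ?thesis unfolding euclid_len_def by (simp add: cSup_eq_Max)
qed

lemma cube_eq_cbox: "cube n = cbox 0 (vec (real n powr (1 / real CARD('d))) :: real ^ 'd::finite)"
  by (auto simp: cube_def mem_box_cart)

lemma emeasure_cbox_cart:
  fixes a b :: "real ^ 'd::finite"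
  assumes "\<And>k. b $ k - a $ k = s" "0 \<le> s"
  shows "emeasure lborel (cbox a b) = ennreal (s ^ CARD('d))"
proof -
  have "(b - a) \<bullet> i = s" if "i \<in> Basis" for i
    using that assms(1) by (auto simp: Basis_vec_def inner_axis)
  moreover have "a \<bullet> i \<le> b \<bullet> i" if "i \<in> Basis" for i
  proof -
    have "0 \<le> (b - a) \<bullet> i" using calculation[OF that] assms(2) by simp
    then show ?thesis by (simp add: inner_diff_left)
  qed
  ultimately show ?thesis using assms(2) by (subst emeasure_lborel_cbox) (simp_all add: prod_ennreal)
qed

text \<open>With three points every edge has a bypass through a third vertex, so \<open>crit\<close>
  is a minimum over a nonempty set.\<close>

locale random_points =
  fixes n :: nat and dim :: "'d::finite itself"
  assumes n3: "3 \<le> n"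
begin

abbreviation "V \<equiv> {..<n}"
abbreviation "E \<equiv> complete_edges n"
abbreviation cb :: "(real ^ 'd) set" where "cb \<equiv> cube n"
abbreviation U :: "(real ^ 'd) measure" where "U \<equiv> uniform_measure lborel cb"
abbreviation P :: "(nat \<Rightarrow> real ^ 'd) measure" where "P \<equiv> PiM V (\<lambda>_. U)"

definition side :: real where "side = real n powr (1 / real CARD('d))"

lemma side_pos: "0 < side" and side_power: "side ^ CARD('d) = real n"
  using n3 by (auto simp: side_def powr_power)

lemma edge_iff: "{i, j} \<in> E \<longleftrightarrow> i < n \<and> j < n \<and> i \<noteq> j"
  by (auto simp: complete_edges_def doubleton_eq_iff)

sublocale network V E
proof
  show "\<exists>u\<in>V. \<exists>v\<in>V. u \<noteq> v \<and> e = {u, v}" if "e \<in> E" for e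
    using that unfolding complete_edges_def by blast
  have "conn E u v" if "u \<in> V" "v \<in> V" for u v
    using that conn_edge[of u v E] by (cases "u = v") (auto simp: edge_iff)
  then show "connects V E" unfolding connects_def by blast
qed simp

lemma cb_sets [measurable]: "cb \<in> sets borel"
  unfolding cube_eq_cbox by simp

lemma emeasure_cb: "emeasure lborel cb = ennreal (real n)"
  unfolding cube_eq_cbox side_def[symmetric] using emeasure_cbox_cart[of "vec side :: real ^ 'd" 0 side] side_pos side_power by simp

lemma prob_space_U: "prob_space U"
  using n3 by (intro prob_space_uniform_measure) (auto simp: emeasure_cb)

sublocale product_prob_space "\<lambda>_. U" V
  by (rule product_prob_spaceI) (rule prob_space_U)

lemma emeasure_U: "A \<in> sets borel \<Longrightarrow> emeasure U A = emeasure lborel (cb \<inter> A) / ennreal (real n)"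
  by (subst emeasure_uniform_measure) (auto simp: emeasure_cb)

lemma measurable_point': "i \<in> I \<Longrightarrow> (\<lambda>p. p i) \<in> borel_measurable (PiM I (\<lambda>_. U))"
  using measurable_component_singleton[of i I "\<lambda>_. U"] by simp

lemma sets_Collect_point:
  assumes "i \<in> I" "A \<in> sets borel"
  shows "{p \<in> space (PiM I (\<lambda>_. U)). p i \<in> A} \<in> sets (PiM I (\<lambda>_. U))"
proof -
  have "{p \<in> space (PiM I (\<lambda>_. U)). p i \<in> A} = (\<lambda>p. p i) -` A \<inter> space (PiM I (\<lambda>_. U))" by auto
  then show ?thesis using measurable_sets[OF measurable_point'[OF assms(1)] assms(2)] by simp
qed

lemma measurable_point [measurable]: "i < n \<Longrightarrow> (\<lambda>p. p i) \<in> borel_measurable P"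
  by (rule measurable_point') simp

lemma measurable_euclid_len [measurable]:
  assumes "e \<in> E"
  shows "(\<lambda>p. euclid_len p e) \<in> borel_measurable P"
proof -
  obtain i j where "i < n" "j < n" "e = {i, j}" using assms unfolding complete_edges_def by blast
  then show ?thesis by (simp add: euclid_len_pair)
qed

lemma bypasses_third:
  assumes "i < n" "j < n" "k < n" "i \<noteq> j" "k \<noteq> i" "k \<noteq> j"
  shows "{{i, k}, {k, j}} \<in> bypasses {i, j}"
proof -
  have "conn {{i, k}, {k, j}} i j"
    by (rule conn_trans[where v = k]) (auto intro: conn_edge)
  moreover have "{{i, k}, {k, j}} \<subseteq> E - {{i, j}}" using assms by (auto simp: edge_iff doubleton_eq_iff)
  ultimately show ?thesis unfolding bypasses_def by blast
qed

lemma bypasses_nonempty: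
  assumes "i < n" "j < n" "i \<noteq> j"
  shows "bypasses {i, j} \<noteq> {}"
proof -
  have "card {i, j} < card V" using n3 by (simp add: card_insert_if)
  then obtain k where "k < n" "k \<noteq> i" "k \<noteq> j"
    using card_mono[of "{i, j}" V] by (metis finite.emptyI finite.insertI insertCI lessThan_iff not_le subsetI)
  then show ?thesis using bypasses_third[OF assms(1,2)] assms(3) by blast
qed

text \<open>The near-tie event on the pair $\{i,j\}$ in which the critical length is realised by an edge avoiding
  $j$, so that it can be integrated out over the position of $j$.\<close>

definition tie_event :: "real \<Rightarrow> nat \<Rightarrow> nat \<Rightarrow> (nat \<Rightarrow> real ^ 'd) set" where
  "tie_event x i j = {p \<in> space P. p i \<in> cb \<and> p j \<in> cb \<and> {i, j} \<in> near_ties (euclid_len p) x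
     \<and> (\<exists>g\<in>{g \<in> E. j \<notin> g}. crit (euclid_len p) {i, j} = euclid_len p g)}"

lemma sets_tie_event:
  assumes "i < n" "j < n" "i \<noteq> j"
  shows "tie_event x i j \<in> sets P"
proof -
  have e: "{i, j} \<in> E" using assms by (simp add: edge_iff)
  note [measurable] = measurable_point[OF assms(1)] measurable_point[OF assms(2)] borel_measurable_crit[OF e measurable_euclid_len]
  have [measurable]: "Measurable.pred P (\<lambda>p. {i, j} \<in> near_ties (euclid_len p) x)"
    unfolding pred_def using sets_near_ties[of euclid_len P "{i, j}" x] by simp
  have "{p \<in> space P. \<exists>g\<in>{g \<in> E. j \<notin> g}. crit (euclid_len p) {i, j} = euclid_len p g} \<in> sets P"
    using finite_E by (intro sets.sets_Collect_finite_Ex) auto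
  then have [measurable]: "Measurable.pred P (\<lambda>p. \<exists>g\<in>{g \<in> E. j \<notin> g}. crit (euclid_len p) {i, j} = euclid_len p g)"
    by (simp add: pred_def)
  show ?thesis unfolding tie_event_def by measurable
qed

text \<open>The edge realising the minimax length is not \<open>{i, j}\<close> itself, so it avoids
  \<open>i\<close> or \<open>j\<close>, and the end that it avoids can play the role of the moving
  point. Points outside the cube form a null set.\<close>

lemma near_ties_prob_le:
  assumes "i < n" "j < n" "i \<noteq> j"
  shows "measure P {p \<in> space P. {i, j} \<in> near_ties (euclid_len p) x}
    \<le> measure P (tie_event x i j) + measure P (tie_event x j i)"
proof -
  let ?O = "\<lambda>i. {p \<in> space P. p i \<in> - cb}"
  have e: "{i, j} \<in> E" using assms by (simp add: edge_iff)
  have O: "measure P (?O i) = 0" "?O i \<in> sets P" if i: "i < n" for i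
  proof -
    note [measurable] = measurable_point[OF i]
    show "?O i \<in> sets P" by measurable
    have "emeasure P (?O i) = emeasure U (- cb)"
      using i by (intro emeasure_PiM_Collect_single) auto
    also have "\<dots> = 0" by (subst emeasure_U) auto
    finally show "measure P (?O i) = 0" by (simp add: measure_def)
  qed
  have sub: "{p \<in> space P. {i, j} \<in> near_ties (euclid_len p) x} \<subseteq> (tie_event x i j \<union> tie_event x j i) \<union> (?O i \<union> ?O j)"
  proof
    fix p assume p: "p \<in> {p \<in> space P. {i, j} \<in> near_ties (euclid_len p) x}"
    obtain g where g: "g \<in> E" "g \<noteq> {i, j}" "crit (euclid_len p) {i, j} = euclid_len p g"
      using crit_in_lengths[OF e bypasses_nonempty[OF assms]] by blast
    obtain a b where "g = {a, b}" using g(1) unfolding complete_edges_def by blast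
    then have "j \<notin> g \<or> i \<notin> g" using g(2) assms(3) by (auto simp: doubleton_eq_iff)
    then show "p \<in> (tie_event x i j \<union> tie_event x j i) \<union> (?O i \<union> ?O j)"
    proof (cases "p i \<in> cb \<and> p j \<in> cb")
      case True
      have p': "p \<in> space P" "{i, j} \<in> near_ties (euclid_len p) x" using p by auto
      show ?thesis
      proof (cases "j \<notin> g")
        case j: True
        then have "p \<in> tie_event x i j" unfolding tie_event_def using True p' g by blast
        then show ?thesis by blast
      next
        case False
        then have i: "i \<notin> g" using \<open>j \<notin> g \<or> i \<notin> g\<close> by blast
        have "{j, i} = {i, j}" by blast
        then have "p \<in> tie_event x j i" unfolding tie_event_def using True p' g(1,3) i by auto
        then show ?thesis by blast
      qed
    next
      case False
      then show ?thesis using p by blast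
    qed
  qed
  have s: "tie_event x i j \<in> sets P" "tie_event x j i \<in> sets P" using sets_tie_event assms by auto
  have "measure P {p \<in> space P. {i, j} \<in> near_ties (euclid_len p) x} \<le> measure P ((tie_event x i j \<union> tie_event x j i) \<union> (?O i \<union> ?O j))"
    using sub s O(2) assms by (intro P.finite_measure_mono) auto
  also have "\<dots> \<le> measure P (tie_event x i j \<union> tie_event x j i) + measure P (?O i \<union> ?O j)"
    using s O(2) assms by (intro measure_Un_le) auto
  also have "measure P (?O i \<union> ?O j) \<le> measure P (?O i) + measure P (?O j)"
    using O(2) assms by (intro measure_Un_le) auto
  also have "measure P (tie_event x i j \<union> tie_event x j i) \<le> measure P (tie_event x i j) + measure P (tie_event x j i)"
    using s by (intro measure_Un_le) auto
  finally show ?thesis using O(1) assms by simp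
qed

section \<open>Empty grid cells halfway along a long edge\<close>

definition grid :: "nat \<Rightarrow> nat" where "grid q = nat \<lceil>4 * real CARD('d) * side / real q\<rceil>"
definition cell_side :: "nat \<Rightarrow> real" where "cell_side q = side / real (grid q)"
definition cell :: "nat \<Rightarrow> ('d \<Rightarrow> nat) \<Rightarrow> (real ^ 'd) set" where
  "cell q z = cbox (\<chi> k. cell_side q * real (z k)) (\<chi> k. cell_side q * real (z k + 1))"
text \<open>The cell enlarged by \<open>q + 1\<close> on every side, enough to contain the ends of
  an edge shorter than \<open>q + 1\<close> whose midpoint lies in the cell.\<close>

definition near_cell :: "nat \<Rightarrow> ('d \<Rightarrow> nat) \<Rightarrow> (real ^ 'd) set" where
  "near_cell q z = cbox (\<chi> k. cell_side q * real (z k) - real (q + 1)) (\<chi> k. cell_side q * real (z k + 1) + real (q + 1))"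
definition cells :: "nat \<Rightarrow> ('d \<Rightarrow> nat) set" where "cells q = Pi\<^sub>E UNIV (\<lambda>_. {..<grid q})"

text \<open>The factor 4 in \<open>grid\<close> bounds the diameter of a cell by
  \<open>q / 4\<close>, through the sum of the coordinate differences. The assumption on
  \<open>q\<close> reflects that an edge of this length fits into the cube; it keeps the rounding in
  \<open>grid\<close> from shrinking the cells by more than a constant factor.\<close>

lemma grid_bounds:
  assumes "1 \<le> q" "real q \<le> real CARD('d) * side"
  shows "0 < grid q" "real q / (8 * real CARD('d)) \<le> cell_side q" "cell_side q \<le> real q / (4 * real CARD('d))" "0 < cell_side q"
proof -
  let ?d = "real CARD('d)"
  have d: "0 < ?d" by simp
  have a: "1 \<le> ?d * side / real q" using assms by (simp add: field_simps)
  have g1: "4 * ?d * side / real q \<le> real (grid q)" unfolding grid_def by linarith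
  have "0 \<le> 4 * ?d * side / real q" using side_pos by simp
  then have "real (grid q) \<le> 4 * ?d * side / real q + 1" unfolding grid_def by linarith
  also have "\<dots> \<le> 4 * ?d * side / real q + ?d * side / real q" by (rule add_left_mono[OF a])
  also have "\<dots> \<le> 8 * ?d * side / real q" using assms side_pos by (simp add: field_simps)
  finally have g2: "real (grid q) \<le> 8 * ?d * side / real q" .
  have "0 < 4 * ?d * side / real q" using assms side_pos by simp
  then have gp: "0 < real (grid q)" using g1 by linarith
  then show "0 < grid q" by simp
  show "real q / (8 * ?d) \<le> cell_side q"
    using g2 gp assms side_pos d unfolding cell_side_def by (simp add: field_simps)
  show "cell_side q \<le> real q / (4 * ?d)"
    using g1 gp assms side_pos d unfolding cell_side_def by (simp add: field_simps)
  show "0 < cell_side q" using gp side_pos by (simp add: cell_side_def)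
qed

lemma cell_subset:
  assumes "0 < grid q" "z \<in> cells q"
  shows "cell q z \<subseteq> cb"
proof
  fix y assume y: "y \<in> cell q z"
  show "y \<in> cb" unfolding cube_def side_def[symmetric]
  proof (intro CollectI allI)
    fix k
    have "cell_side q * real (z k) \<le> y $ k" "y $ k \<le> cell_side q * real (z k + 1)" using y by (auto simp: cell_def mem_box_cart)
    moreover have "cell_side q * real (z k + 1) \<le> cell_side q * real (grid q)"
    proof (intro mult_left_mono)
      have "z k < grid q" using assms(2) by (auto simp: cells_def)
      then show "real (z k + 1) \<le> real (grid q)" by simp
    qed (use side_pos in \<open>simp add: cell_side_def\<close>)
    moreover have "cell_side q * real (grid q) = side" using assms by (simp add: cell_side_def)
    moreover have "0 \<le> cell_side q * real (z k)" using side_pos by (simp add: cell_side_def)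
    ultimately show "0 \<le> y $ k \<and> y $ k \<le> side" by linarith
  qed
qed

lemma cell_cover:
  assumes "0 < grid q" "y \<in> cb"
  shows "\<exists>z\<in>cells q. y \<in> cell q z"
proof -
  let ?s = "cell_side q"
  have s: "0 < ?s" using assms(1) side_pos by (simp add: cell_side_def)
  have y: "0 \<le> y $ k" "y $ k \<le> side" for k using assms(2) by (auto simp: cube_def side_def)
  have "\<exists>z<grid q. ?s * real z \<le> y $ k \<and> y $ k \<le> ?s * real (z + 1)" for k
  proof (cases "y $ k = side")
    case True
    have "?s * real (grid q) = side" using assms by (simp add: cell_side_def)
    then show ?thesis using True assms(1) s
      by (intro exI[of _ "grid q - 1"]) (auto simp: of_nat_diff algebra_simps)
  next
    case False
    define z where "z = nat \<lfloor>y $ k / ?s\<rfloor>"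
    have z: "real z = of_int \<lfloor>y $ k / ?s\<rfloor>" using y s by (simp add: z_def)
    have 1: "real z \<le> y $ k / ?s" and 2: "y $ k / ?s \<le> real z + 1" unfolding z by linarith+
    have "y $ k / ?s < real (grid q)"
      using False y[of k] s assms(1) side_pos by (simp add: cell_side_def field_simps)
    then have "real z < real (grid q)" using 1 by linarith
    moreover have "?s * real z \<le> y $ k" using 1 s by (simp add: field_simps)
    moreover have "y $ k \<le> ?s * (real z + 1)" using 2 s by (simp add: field_simps)
    ultimately have "real z < real (grid q)" "?s * real z \<le> y $ k" "y $ k \<le> ?s * (real z + 1)" by simp_all
    then show ?thesis by (intro exI[of _ z]) (simp add: add.commute)
  qed
  then obtain z where z: "\<And>k. z k < grid q" "\<And>k. ?s * real (z k) \<le> y $ k" "\<And>k. y $ k \<le> ?s * real (z k + 1)" by metis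
  then show ?thesis by (intro bexI[of _ z]) (auto simp: cell_def cells_def mem_box_cart)
qed

text \<open>The midpoint of the edge is random. A fixed grid replaces the ball around it by one of
  finitely many deterministic cells, so that a union bound applies.\<close>

definition empty_cell_event :: "nat \<Rightarrow> nat \<Rightarrow> nat \<Rightarrow> (nat \<Rightarrow> real ^ 'd) set" where
  "empty_cell_event q i j = (\<Union>z\<in>cells q. {\<xi> \<in> space (PiM (V - {j}) (\<lambda>_. U)).
     \<forall>k\<in>V - {j}. \<xi> k \<in> (if k = i then near_cell q z else - cell q z)})"

lemma finite_cells: "finite (cells q)"
  unfolding cells_def by (intro finite_PiE) auto

lemma sets_empty_cell_event [measurable]: "empty_cell_event q i j \<in> sets (PiM (V - {j}) (\<lambda>_. U))"
  unfolding empty_cell_event_def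
proof (intro sets.finite_UN finite_cells sets.sets_Collect_finite_All)
  fix z k assume "k \<in> V - {j}"
  then show "{\<xi> \<in> space (PiM (V - {j}) (\<lambda>_. U)). \<xi> k \<in> (if k = i then near_cell q z else - cell q z)} \<in> sets (PiM (V - {j}) (\<lambda>_. U))"
    by (rule sets_Collect_point) (auto simp: near_cell_def cell_def)
qed simp

text \<open>The number of cells alone would make the union bound useless, as it grows with n.
  Requiring the point \<open>i\<close> to be near the cell contributes a probability that cancels
  this number up to the constant \<open>(1 + 32 * real CARD('d)) ^ CARD('d)\<close>; the emptiness
  of the cell gives the exponential decay in \<open>q\<close>.\<close>

lemma empty_cell_prob:
  assumes ij: "i < n" "j < n" "i \<noteq> j" and q: "1 \<le> q" "real q \<le> real CARD('d) * side"
  shows "emeasure (PiM (V - {j}) (\<lambda>_. U)) (empty_cell_event q i j)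
    \<le> ennreal ((1 + 32 * real CARD('d)) ^ CARD('d) * exp (- (real q / (3 * (8 * real CARD('d)) ^ CARD('d)))))"
proof -
  let ?d = "CARD('d)" and ?s = "cell_side q"
  note g = grid_bounds[OF q]
  interpret J: product_prob_space "\<lambda>_. U" "V - {j}" by (rule product_prob_spaceI) (rule prob_space_U)
  have n0: "0 < real n" using n3 by simp
  have sn: "real (grid q) ^ ?d * ?s ^ ?d = real n"
    using g(1) side_power by (simp add: power_mult_distrib[symmetric] cell_side_def)
  have sd: "?s ^ ?d \<le> real n"
  proof -
    have "1 * ?s ^ ?d \<le> real (grid q) ^ ?d * ?s ^ ?d" using g by (intro mult_right_mono one_le_power) auto
    then show ?thesis unfolding sn by simp
  qed
  have vol_near: "emeasure U (near_cell q z) \<le> ennreal ((?s + 2 * real (q + 1)) ^ ?d / real n)" for z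
  proof -
    have "emeasure U (near_cell q z) = emeasure lborel (cb \<inter> near_cell q z) / ennreal (real n)"
      by (intro emeasure_U) (simp add: near_cell_def)
    also have "\<dots> \<le> emeasure lborel (near_cell q z) / ennreal (real n)"
      by (intro divide_right_mono_ennreal emeasure_mono) (auto simp: near_cell_def)
    also have "emeasure lborel (near_cell q z) = ennreal ((?s + 2 * real (q + 1)) ^ ?d)"
      unfolding near_cell_def using g by (intro emeasure_cbox_cart) (auto simp: algebra_simps)
    also have "\<dots> / ennreal (real n) = ennreal ((?s + 2 * real (q + 1)) ^ ?d / real n)"
      using n0 g by (intro divide_ennreal) auto
    finally show ?thesis .
  qed
  have vol_empty: "emeasure U (- cell q z) = ennreal (1 - ?s ^ ?d / real n)" if z: "z \<in> cells q" for z
  proof -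
    have "emeasure U (cell q z) = emeasure lborel (cell q z) / ennreal (real n)"
      using cell_subset[OF g(1) z] by (subst emeasure_U) (auto simp: cell_def Int_absorb1)
    also have "emeasure lborel (cell q z) = ennreal (?s ^ ?d)"
      unfolding cell_def using g by (intro emeasure_cbox_cart) (auto simp: algebra_simps)
    also have "\<dots> / ennreal (real n) = ennreal (?s ^ ?d / real n)" using n0 g by (intro divide_ennreal) auto
    finally have c: "emeasure U (cell q z) = ennreal (?s ^ ?d / real n)" .
    have m: "measure U (cell q z) = ?s ^ ?d / real n" using c g n0 by (simp add: measure_def)
    have "measure U (space U - cell q z) = 1 - measure U (cell q z)"
      by (intro prob_space.prob_compl[OF prob_space_U]) (simp add: cell_def)
    then show ?thesis using m by (simp add: M.emeasure_eq_measure Compl_eq_Diff_UNIV)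
  qed
  let ?b = "((?s + 2 * real (q + 1)) ^ ?d / real n) * (1 - ?s ^ ?d / real n) ^ (n - 2)"
  have p0: "0 \<le> 1 - ?s ^ ?d / real n" using sd n0 by simp
  have b0: "0 \<le> ?b" using p0 g by (intro mult_nonneg_nonneg) auto
  have one: "emeasure (PiM (V - {j}) (\<lambda>_. U)) {\<xi> \<in> space (PiM (V - {j}) (\<lambda>_. U)).
     \<forall>k\<in>V - {j}. \<xi> k \<in> (if k = i then near_cell q z else - cell q z)} \<le> ennreal ?b" if z: "z \<in> cells q" for z
  proof -
    have "emeasure (PiM (V - {j}) (\<lambda>_. U)) {\<xi> \<in> space (PiM (V - {j}) (\<lambda>_. U)).
       \<forall>k\<in>V - {j}. \<xi> k \<in> (if k = i then near_cell q z else - cell q z)}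
      = (\<Prod>k\<in>V - {j}. emeasure U (if k = i then near_cell q z else - cell q z))"
      by (rule J.emeasure_PiM_Collect) (auto simp: near_cell_def cell_def)
    also have "\<dots> = emeasure U (near_cell q z) * (\<Prod>k\<in>V - {j} - {i}. emeasure U (if k = i then near_cell q z else - cell q z))"
      using ij by (subst prod.remove[of _ i]) auto
    also have "(\<Prod>k\<in>V - {j} - {i}. emeasure U (if k = i then near_cell q z else - cell q z)) = (\<Prod>k\<in>V - {j} - {i}. ennreal (1 - ?s ^ ?d / real n))"
      using vol_empty[OF z] by (intro prod.cong) auto
    also have "\<dots> = ennreal ((1 - ?s ^ ?d / real n) ^ (n - 2))"
      using ij p0 by (simp add: card_Diff_subset ennreal_power numeral_2_eq_2)
    also have "emeasure U (near_cell q z) * ennreal ((1 - ?s ^ ?d / real n) ^ (n - 2)) \<le> ennreal ((?s + 2 * real (q + 1)) ^ ?d / real n) * ennreal ((1 - ?s ^ ?d / real n) ^ (n - 2))"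
      by (intro mult_right_mono vol_near) simp
    also have "\<dots> = ennreal ?b" using p0 g n0 by (intro ennreal_mult[symmetric]) auto
    finally show ?thesis .
  qed
  have "emeasure (PiM (V - {j}) (\<lambda>_. U)) (empty_cell_event q i j) \<le> (\<Sum>z\<in>cells q. ennreal ?b)"
  proof -
    have "emeasure (PiM (V - {j}) (\<lambda>_. U)) (empty_cell_event q i j) \<le> (\<Sum>z\<in>cells q. emeasure (PiM (V - {j}) (\<lambda>_. U)) {\<xi> \<in> space (PiM (V - {j}) (\<lambda>_. U)).
     \<forall>k\<in>V - {j}. \<xi> k \<in> (if k = i then near_cell q z else - cell q z)})"
      unfolding empty_cell_event_def
    proof (intro emeasure_subadditive_finite finite_cells image_subsetI sets.sets_Collect_finite_All)
      fix z k assume "k \<in> V - {j}"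
      then show "{\<xi> \<in> space (PiM (V - {j}) (\<lambda>_. U)). \<xi> k \<in> (if k = i then near_cell q z else - cell q z)} \<in> sets (PiM (V - {j}) (\<lambda>_. U))"
    by (rule sets_Collect_point) (auto simp: near_cell_def cell_def)
    qed simp
    also have "\<dots> \<le> (\<Sum>z\<in>cells q. ennreal ?b)" by (intro sum_mono one)
    finally show ?thesis .
  qed
  also have "\<dots> = ennreal (real (card (cells q)) * ?b)"
    unfolding sum_constant ennreal_of_nat_eq_real_of_nat by (rule ennreal_mult[symmetric]) (use b0 in simp_all)
  also have "\<dots> \<le> ennreal ((1 + 32 * real ?d) ^ ?d * exp (- (real q / (3 * (8 * real ?d) ^ ?d))))"
  proof (intro ennreal_leI)
    have "real (card (cells q)) * ?b = ((?s + 2 * real (q + 1)) / ?s) ^ ?d * (1 - ?s ^ ?d / real n) ^ (n - 2)"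
    proof -
      have "real (card (cells q)) * ?b = (real (grid q) ^ ?d / real n) * ((?s + 2 * real (q + 1)) ^ ?d * (1 - ?s ^ ?d / real n) ^ (n - 2))"
        by (simp add: cells_def card_PiE)
      also have "real (grid q) ^ ?d / real n = 1 / ?s ^ ?d" using sn g n0 by (simp add: field_simps)
      also have "1 / ?s ^ ?d * ((?s + 2 * real (q + 1)) ^ ?d * (1 - ?s ^ ?d / real n) ^ (n - 2))
          = ((?s + 2 * real (q + 1)) / ?s) ^ ?d * (1 - ?s ^ ?d / real n) ^ (n - 2)"
        by (simp add: power_divide)
      finally show ?thesis .
    qed
    also have "\<dots> \<le> (1 + 32 * real ?d) ^ ?d * exp (- (real q / (3 * (8 * real ?d) ^ ?d)))"
    proof (intro mult_mono power_mono)
      have "2 * real (q + 1) \<le> 4 * real q" using q by simp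
      also have "\<dots> \<le> 32 * real ?d * ?s" using g(2) by (simp add: field_simps)
      finally show "(?s + 2 * real (q + 1)) / ?s \<le> 1 + 32 * real ?d" using g(4) by (simp add: field_simps)
      let ?t = "?s ^ ?d / real n"
      have "(1 - ?t) ^ (n - 2) \<le> exp (- ?t) ^ (n - 2)"
        using exp_ge_add_one_self[of "- ?t"] p0 by (intro power_mono) auto
      also have "\<dots> = exp (- (real (n - 2) * ?t))" by (simp add: exp_of_nat_mult[symmetric])
      also have "\<dots> \<le> exp (- (real q / (3 * (8 * real ?d) ^ ?d)))"
      proof -
        \<comment> \<open>Only a decay linear in \<open>q\<close> is kept, which is ample against a
          polynomial.\<close>
        have "real q / (8 * real ?d) ^ ?d \<le> real q ^ ?d / (8 * real ?d) ^ ?d"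
          using q by (intro divide_right_mono self_le_power) auto
        also have "\<dots> = (real q / (8 * real ?d)) ^ ?d" by (simp add: power_divide)
        also have "\<dots> \<le> ?s ^ ?d" using g by (intro power_mono) auto
        finally have a: "real q / (8 * real ?d) ^ ?d \<le> ?s ^ ?d" .
        \<comment> \<open>\<open>n - 2\<close> other points remain, at least a third of all because
          \<open>n \<ge> 3\<close>.\<close>
        have "real n \<le> 3 * real (n - 2)" using n3 by linarith
        then have "1 / 3 \<le> real (n - 2) / real n" using n0 by (simp add: field_simps)
        then have "1 / 3 * ?s ^ ?d \<le> real (n - 2) / real n * ?s ^ ?d"
          by (rule mult_right_mono) (use g(4) in simp)
        then have b: "1 / 3 * ?s ^ ?d \<le> real (n - 2) * ?t" by simp
        have "real q / (3 * (8 * real ?d) ^ ?d) = 1 / 3 * (real q / (8 * real ?d) ^ ?d)" by simp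
        also have "\<dots> \<le> 1 / 3 * ?s ^ ?d" using a by (rule mult_left_mono) simp
        also note b
        finally show ?thesis by simp
      qed
      finally show "(1 - ?t) ^ (n - 2) \<le> exp (- (real q / (3 * (8 * real ?d) ^ ?d)))" .
    qed (use g p0 in auto)
    finally show "real (card (cells q)) * ?b \<le> (1 + 32 * real ?d) ^ ?d * exp (- (real q / (3 * (8 * real ?d) ^ ?d)))" .
  qed
  finally show ?thesis .
qed

end

lemma power_le_fact_exp:
  fixes y :: real
  assumes "0 \<le> y"
  shows "y ^ d \<le> fact d * exp y"
proof -
  have "y ^ d /\<^sub>R fact d \<le> (\<Sum>k. y ^ k /\<^sub>R fact k)"
    using sum_le_suminf[OF summable_exp_generic[of y], of "{d}"] assms by simp
  then show ?thesis by (simp add: exp_def field_simps)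
qed

text \<open>Half of the exponential absorbs the polynomial and leaves a geometric series.\<close>

lemma summable_poly_exp:
  fixes \<beta> :: real
  assumes \<beta>: "0 < \<beta>"
  shows "summable (\<lambda>q. real (q + 1) ^ d * exp (- (\<beta> * real q)))"
proof (rule summable_comparison_test')
  define C where "C = fact d * (2 / \<beta>) ^ d * exp (\<beta> / 2)"
  show "summable (\<lambda>q. C * exp (- (\<beta> / 2)) ^ q)"
    using \<beta> by (intro summable_mult summable_geometric) simp
  fix q :: nat
  have "(\<beta> / 2 * real (q + 1)) ^ d \<le> fact d * exp (\<beta> / 2 * real (q + 1))"
    using \<beta> by (intro power_le_fact_exp) simp
  then have "(2 / \<beta>) ^ d * (\<beta> / 2 * real (q + 1)) ^ d \<le> (2 / \<beta>) ^ d * (fact d * exp (\<beta> / 2 * real (q + 1)))"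
    using \<beta> by (intro mult_left_mono) auto
  also have "(2 / \<beta>) ^ d * (\<beta> / 2 * real (q + 1)) ^ d = real (q + 1) ^ d"
  proof -
    have "2 / \<beta> * (\<beta> / 2 * real (q + 1)) = real (q + 1)" using \<beta> by (simp add: field_simps)
    then show ?thesis by (simp only: power_mult_distrib[symmetric])
  qed
  finally have "real (q + 1) ^ d * exp (- (\<beta> * real q)) \<le> (2 / \<beta>) ^ d * (fact d * exp (\<beta> / 2 * real (q + 1))) * exp (- (\<beta> * real q))"
    by (intro mult_right_mono) auto
  also have "\<dots> = (2 / \<beta>) ^ d * fact d * (exp (\<beta> / 2 * real (q + 1)) * exp (- (\<beta> * real q)))" by simp
  also have "exp (\<beta> / 2 * real (q + 1)) * exp (- (\<beta> * real q)) = exp (\<beta> / 2) * exp (- (\<beta> / 2)) ^ q"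
    unfolding exp_of_nat_mult[symmetric] exp_add[symmetric] by (simp add: field_simps)
  finally show "norm (real (q + 1) ^ d * exp (- (\<beta> * real q))) \<le> C * exp (- (\<beta> / 2)) ^ q"
    by (simp add: C_def mult_ac)
qed

lemma dist_le_sum_cart:
  fixes x y :: "real ^ 'd::finite"
  assumes "\<And>k. \<bar>x $ k - y $ k\<bar> \<le> s"
  shows "dist x y \<le> real CARD('d) * s"
proof -
  have "dist x y \<le> (\<Sum>k\<in>UNIV. \<bar>(x - y) $ k\<bar>)" unfolding dist_norm by (rule norm_le_l1_cart)
  also have "\<dots> \<le> (\<Sum>k\<in>(UNIV :: 'd set). s)" using assms by (intro sum_mono) simp
  finally show ?thesis by simp
qed

context random_points
begin

lemma dist_cube_le:
  assumes "c \<in> cb" "y \<in> cb"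
  shows "dist c y \<le> real CARD('d) * side"
proof (rule dist_le_sum_cart)
  fix k
  have "0 \<le> c $ k" "c $ k \<le> side" "0 \<le> y $ k" "y $ k \<le> side"
    using assms by (simp_all add: cube_def side_def)
  then show "\<bar>c $ k - y $ k\<bar> \<le> side" by (simp add: abs_le_iff)
qed

lemma euclid_len_update:
  assumes "g \<in> E" "j \<notin> g"
  shows "euclid_len (\<xi>(j := y)) g = euclid_len \<xi> g"
proof -
  obtain a b where "g = {a, b}" using assms(1) unfolding complete_edges_def by blast
  then show ?thesis using assms(2) by (auto simp: euclid_len_pair)
qed

lemma crit_update_lipschitz:
  assumes "i < n" "j < n" "i \<noteq> j"
  shows "\<bar>crit (euclid_len (\<xi>(j := y))) {i, j} - crit (euclid_len (\<xi>(j := z))) {i, j}\<bar> \<le> dist y z"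
proof (rule crit_lipschitz)
  show "{i, j} \<in> E" "bypasses {i, j} \<noteq> {}" using assms bypasses_nonempty by (auto simp: edge_iff)
  fix g assume "g \<in> E"
  then obtain a b where ab: "g = {a, b}" "a \<noteq> b" unfolding complete_edges_def by blast
  show "\<bar>euclid_len (\<xi>(j := y)) g - euclid_len (\<xi>(j := z)) g\<bar> \<le> dist y z"
  proof -
    have d: "\<bar>dist u y - dist u z\<bar> \<le> dist y z" "\<bar>dist y u - dist z u\<bar> \<le> dist y z" for u
      using abs_dist_diff_le[of y u z] by (simp_all add: dist_commute)
    consider "a = j" "b \<noteq> j" | "b = j" "a \<noteq> j" | "a \<noteq> j" "b \<noteq> j" using ab(2) by blast
    then show ?thesis unfolding ab(1) euclid_len_pair using d by cases simp_all
  qed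
qed

text \<open>Turns the event into conditions on the moving point \<open>y\<close>: \<open>L y\<close>
  is close to the distance from \<open>\<xi> i\<close> and lies in a finite set that does not
  involve \<open>y\<close>, as the level set estimate demands.\<close>

lemma tie_event_shell:
  assumes ij: "i < n" "j < n" "i \<noteq> j" and p: "\<xi>(j := y) \<in> tie_event x i j"
  defines "L \<equiv> \<lambda>y. crit (euclid_len (\<xi>(j := y))) {i, j}"
  shows "0 \<le> dist (\<xi> i) y - L y" "dist (\<xi> i) y - L y \<le> x" "L y \<in> euclid_len \<xi> ` {g \<in> E. j \<notin> g}"
    "\<xi> i \<in> cb" "y \<in> cb" "dist (\<xi> i) y - x < L y"
proof -
  have e: "{i, j} \<in> E" using ij by (simp add: edge_iff)
  note bc = bypass_iff_crit[OF e bypasses_nonempty[OF ij]]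
  have w: "euclid_len (\<xi>(j := y)) {i, j} = dist (\<xi> i) y" using ij by (simp add: euclid_len_pair)
  have "{i, j} \<in> near_ties (euclid_len (\<xi>(j := y))) x" using p by (simp add: tie_event_def)
  then have "bypass (euclid_len (\<xi>(j := y))) (euclid_len (\<xi>(j := y)) {i, j}) {i, j}"
    "\<not> bypass (euclid_len (\<xi>(j := y))) (euclid_len (\<xi>(j := y)) {i, j} - x) {i, j}"
    unfolding near_ties_def by blast+
  then show "0 \<le> dist (\<xi> i) y - L y" "dist (\<xi> i) y - x < L y" "dist (\<xi> i) y - L y \<le> x"
    unfolding bc w L_def by auto
  obtain g where g: "g \<in> E" "j \<notin> g" "L y = euclid_len (\<xi>(j := y)) g" using p unfolding tie_event_def L_def by blast
  then show "L y \<in> euclid_len \<xi> ` {g \<in> E. j \<notin> g}" using euclid_len_update[OF g(1,2)] by auto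
  show "\<xi> i \<in> cb" "y \<in> cb" using p ij unfolding tie_event_def by auto
qed

text \<open>A third point in the cell of the midpoint would lie within a quarter of the edge length
  of it, hence within three quarters of that length of both ends. Since the length is at least 1 and
  \<open>x \<le> 1 / 4\<close>, the path through that point would be a bypass at the length minus
  \<open>x\<close>, so the edge would be no near tie.\<close>

lemma tie_event_empty_cell:
  assumes ij: "i < n" "j < n" "i \<noteq> j" and \<xi>: "\<xi> \<in> space (PiM (V - {j}) (\<lambda>_. U))" and p: "\<xi>(j := y) \<in> tie_event x i j"
    and x: "x \<le> 1 / 4" and q: "1 \<le> q" "real q \<le> dist (\<xi> i) y" "dist (\<xi> i) y < real q + 1"
  shows "\<xi> \<in> empty_cell_event q i j" "real q \<le> real CARD('d) * side"
proof -
  let ?c = "\<xi> i" and ?s = "cell_side q"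
  note t = tie_event_shell[OF ij p]
  show qd: "real q \<le> real CARD('d) * side" using q(2) dist_cube_le[OF t(4,5)] by linarith
  note g = grid_bounds[OF q(1) qd]
  define m where "m = (1 / 2) *\<^sub>R (?c + y)"
  have "m \<in> cb"
  proof -
    have "m = (1 - 1 / 2) *\<^sub>R ?c + (1 / 2) *\<^sub>R y" by (simp add: m_def algebra_simps)
    moreover have "convex cb" unfolding cube_eq_cbox by (rule convex_box)
    ultimately show ?thesis using convexD_alt[of cb ?c y "1 / 2"] t(4,5) by simp
  qed
  then obtain z where z: "z \<in> cells q" "m \<in> cell q z" using cell_cover[OF g(1)] by blast
  have dm: "dist ?c m = dist ?c y / 2" "dist m y = dist ?c y / 2"
  proof -
    have "?c - m = (1 / 2) *\<^sub>R (?c - y)" "m - y = (1 / 2) *\<^sub>R (?c - y)"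
      by (simp_all add: m_def vec_eq_iff field_simps)
    then show "dist ?c m = dist ?c y / 2" "dist m y = dist ?c y / 2" by (simp_all add: dist_norm)
  qed
  have "?c \<in> near_cell q z"
    unfolding near_cell_def mem_box_cart
  proof
    fix k
    have "\<bar>?c $ k - m $ k\<bar> \<le> dist ?c m" using component_le_norm_cart[of "?c - m" k] by (simp add: dist_norm)
    then have "\<bar>?c $ k - m $ k\<bar> \<le> real (q + 1)" using dm q by simp
    moreover have "?s * real (z k) \<le> m $ k" "m $ k \<le> ?s * real (z k + 1)" using z(2) by (auto simp: cell_def mem_box_cart)
    ultimately show "(\<chi> k. ?s * real (z k) - real (q + 1)) $ k \<le> ?c $ k \<and> ?c $ k \<le> (\<chi> k. ?s * real (z k + 1) + real (q + 1)) $ k"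
      unfolding abs_le_iff by (simp del: of_nat_add of_nat_Suc)
  qed
  moreover have "\<xi> k \<notin> cell q z" if k: "k \<in> V - {j}" "k \<noteq> i" for k
  proof
    assume kc: "\<xi> k \<in> cell q z"
    have "dist (\<xi> k) m \<le> real CARD('d) * ?s"
    proof (rule dist_le_sum_cart)
      fix a
      have "?s * real (z a) \<le> m $ a" "m $ a \<le> ?s * real (z a + 1)" "?s * real (z a) \<le> \<xi> k $ a" "\<xi> k $ a \<le> ?s * real (z a + 1)"
        using z(2) kc by (auto simp: cell_def mem_box_cart)
      then show "\<bar>\<xi> k $ a - m $ a\<bar> \<le> ?s" by (simp add: abs_le_iff algebra_simps)
    qed
    also have "\<dots> \<le> real q / 4" using g(3) by (simp add: field_simps)
    finally have km: "dist (\<xi> k) m \<le> dist ?c y / 4" using q by linarith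
    have e: "{i, j} \<in> E" using ij by (simp add: edge_iff)
    have b: "{{i, k}, {k, j}} \<in> bypasses {i, j}" using bypasses_third ij k by blast
    let ?w = "euclid_len (\<xi>(j := y))"
    have "dist ?c (\<xi> k) \<le> dist ?c y - x" "dist (\<xi> k) y \<le> dist ?c y - x"
      using dist_triangle[of ?c "\<xi> k" m] dist_triangle[of "\<xi> k" y m] km dm x q by (simp_all add: dist_commute)
    moreover have "?w {i, k} = dist ?c (\<xi> k)" "?w {k, j} = dist (\<xi> k) y" using ij k by (auto simp: euclid_len_pair)
    ultimately have "bypass ?w (dist ?c y - x) {i, j}" unfolding bypass_iff using b by (intro bexI[OF _ b]) auto
    then show False using bypass_iff_crit[OF e bypasses_nonempty[OF ij]] t(6) by fastforce
  qed
  ultimately show "\<xi> \<in> empty_cell_event q i j"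
    unfolding empty_cell_event_def using z(1) \<xi> by auto
qed

end

text \<open>No decay is available for the innermost shell, where the trivial bound 1 stands.\<close>

definition shell_prob :: "nat \<Rightarrow> nat \<Rightarrow> real" where
  "shell_prob d q = (if q = 0 then 1 else (1 + 32 * real d) ^ d * exp (- (real q / (3 * (8 * real d) ^ d))))"

definition tie_const :: "nat \<Rightarrow> real" where
  "tie_const d = 4 * 4 ^ d * unit_ball_vol d * (\<Sum>q. shell_prob d q * real (q + 1) ^ d)"

lemma summable_shell_prob:
  assumes "0 < d"
  shows "summable (\<lambda>q. shell_prob d q * real (q + 1) ^ d)"
proof (rule summable_comparison_test')
  let ?b = "1 / (3 * (8 * real d) ^ d)"
  have "0 < ?b" using assms by simp
  then show "summable (\<lambda>q. (1 + 32 * real d) ^ d * (real (q + 1) ^ d * exp (- (?b * real q))))"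
    by (intro summable_mult summable_poly_exp)
  fix q :: nat
  have "1 \<le> (1 + 32 * real d) ^ d" by (intro one_le_power) simp
  then show "norm (shell_prob d q * real (q + 1) ^ d) \<le> (1 + 32 * real d) ^ d * (real (q + 1) ^ d * exp (- (?b * real q)))"
    by (cases "q = 0") (auto simp: shell_prob_def)
qed

lemma shell_prob_nonneg: "0 \<le> shell_prob d q"
  by (simp add: shell_prob_def)

lemma tie_const_pos:
  assumes "0 < d"
  shows "0 < tie_const d"
proof -
  have "0 < (\<Sum>q. shell_prob d q * real (q + 1) ^ d)"
    by (rule suminf_pos2[where i = 0]) (use summable_shell_prob[OF assms] shell_prob_nonneg in \<open>auto simp: shell_prob_def\<close>)
  then show ?thesis by (simp add: tie_const_def unit_ball_vol_pos)
qed

context random_points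
begin

text \<open>Fix all points but \<open>j\<close> and sort the position of \<open>j\<close> by unit
  shells around \<open>i\<close>. A shell contributes a volume of order
  \<open>x * (q + 1) ^ CARD('d)\<close>, divided by n, and can be visited only if the other points
  lie in \<open>D q\<close>, whose probability makes the sum over the shells converge.\<close>

lemma tie_event_prob:
  assumes d: "2 \<le> CARD('d)" and ij: "i < n" "j < n" "i \<noteq> j" and x: "0 < x" "x \<le> 1 / 4"
  shows "measure P (tie_event x i j) \<le> tie_const CARD('d) * x / real n"
proof -
  let ?d = "CARD('d)" and ?M = "PiM (V - {j}) (\<lambda>_. U)" and ?F = "tie_event x i j"
  define K where "K = 4 * 4 ^ ?d * unit_ball_vol ?d"
  have K: "0 \<le> K" by (simp add: K_def unit_ball_vol_nonneg)
  have n0: "0 < real n" using n3 by simp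
  have V: "insert j (V - {j}) = V" using ij by auto
  have Fm[measurable]: "?F \<in> sets P" by (rule sets_tie_event[OF ij])
  interpret J: prob_space ?M by (intro prob_space_PiM prob_space_U)
  \<comment> \<open>For \<open>q\<close> beyond the bound on the diameter the shell does not meet
    the cube.\<close>
  define D where "D q = (if q = 0 then space ?M else if real q \<le> real ?d * side then empty_cell_event q i j else {})" for q
  have Dm[measurable]: "D q \<in> sets ?M" for q by (simp add: D_def)
  have DP: "emeasure ?M (D q) \<le> ennreal (shell_prob ?d q)" for q
    using empty_cell_prob[OF ij, of q] J.emeasure_space_1 by (auto simp: D_def shell_prob_def)
  define c where "c q = K * x * real (q + 1) ^ ?d" for q
  have c0: "0 \<le> c q" for q using K x by (simp add: c_def)
  have inner: "(\<integral>\<^sup>+ y. indicator ?F (\<xi>(j := y)) \<partial>U) \<le> (\<Sum>q. ennreal (c q / real n) * indicator (D q) \<xi>)"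
    if \<xi>: "\<xi> \<in> space ?M" for \<xi>
  proof -
    define L where "L y = crit (euclid_len (\<xi>(j := y))) {i, j}" for y
    define A where "A = euclid_len \<xi> ` {g \<in> E. j \<notin> g}"
    have finA: "finite A" unfolding A_def using finite_E by simp
    have lip: "\<bar>L y - L z\<bar> \<le> dist y z" for y z unfolding L_def by (rule crit_update_lipschitz[OF ij])
    have [measurable]: "L \<in> borel_measurable borel" using lip by (rule lipschitz_borel)
    have [measurable]: "A \<in> sets borel" using finA by (simp add: finite_imp_closed)
    define S where "S q = {y. real q \<le> dist (\<xi> i) y \<and> dist (\<xi> i) y < real q + 1 \<and> 0 \<le> dist (\<xi> i) y - L y
        \<and> dist (\<xi> i) y - L y \<le> x \<and> L y \<in> A}" for q
    have [measurable]: "S q \<in> sets borel" for q unfolding S_def by measurable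
    have vol: "emeasure lborel (S q) \<le> ennreal (c q)" for q
      using lipschitz_levels_measure_shell[OF _ lip finA x(1), of q "\<xi> i"] d unfolding S_def c_def K_def by simp
    let ?Y = "{y. \<xi>(j := y) \<in> ?F}"
    have Ym: "?Y \<in> sets borel"
    proof -
      have "(\<lambda>y. \<xi>(j := y)) \<in> measurable borel P"
      proof -
        have "(\<lambda>y. (\<lambda>(f, y). f(j := y)) (\<xi>, y)) \<in> measurable U (PiM (insert j (V - {j})) (\<lambda>_. U))"
          by (rule measurable_compose[OF _ measurable_add_dim]) (use \<xi> in measurable)
        then show ?thesis unfolding V by simp
      qed
      from measurable_sets[OF this Fm] show ?thesis by (simp add: vimage_def)
    qed
    have YS: "?Y \<subseteq> (\<Union>q. if \<xi> \<in> D q then S q else {})"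
    proof
      fix y assume "y \<in> ?Y"
      then have p: "\<xi>(j := y) \<in> ?F" by simp
      define q where "q = nat \<lfloor>dist (\<xi> i) y\<rfloor>"
      have q: "real q \<le> dist (\<xi> i) y" "dist (\<xi> i) y < real q + 1" unfolding q_def by (simp_all add: of_nat_nat)
      have "\<xi> \<in> D q"
        using tie_event_empty_cell[OF ij \<xi> p x(2) _ q] \<xi> by (cases "q = 0") (auto simp: D_def)
      moreover have "y \<in> S q" using tie_event_shell(1-3)[OF ij p] q unfolding S_def L_def A_def by simp
      ultimately show "y \<in> (\<Union>q. if \<xi> \<in> D q then S q else {})" by auto
    qed
    have "(\<integral>\<^sup>+ y. indicator ?F (\<xi>(j := y)) \<partial>U) = (\<integral>\<^sup>+ y. indicator ?Y y \<partial>U)"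
      by (intro nn_integral_cong) (simp add: indicator_def)
    also have "\<dots> = emeasure U ?Y" using Ym by (intro nn_integral_indicator) simp
    also have "\<dots> = emeasure lborel (cb \<inter> ?Y) / ennreal (real n)" by (rule emeasure_U[OF Ym])
    also have "\<dots> \<le> emeasure lborel (\<Union>q. if \<xi> \<in> D q then S q else {}) / ennreal (real n)"
      using YS by (intro divide_right_mono_ennreal emeasure_mono) auto
    also have "\<dots> \<le> (\<Sum>q. emeasure lborel (if \<xi> \<in> D q then S q else {})) / ennreal (real n)"
      by (intro divide_right_mono_ennreal emeasure_subadditive_countably) auto
    also have "\<dots> \<le> (\<Sum>q. ennreal (c q) * indicator (D q) \<xi>) / ennreal (real n)"
      using vol by (intro divide_right_mono_ennreal suminf_le) (auto simp: indicator_def)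
    also have "\<dots> = (\<Sum>q. ennreal (c q) * indicator (D q) \<xi> / ennreal (real n))"
      unfolding divide_ennreal_def by (rule ennreal_suminf_multc[symmetric])
    also have "\<dots> = (\<Sum>q. ennreal (c q / real n) * indicator (D q) \<xi>)"
    proof (intro suminf_cong)
      fix q
      show "ennreal (c q) * indicator (D q) \<xi> / ennreal (real n) = ennreal (c q / real n) * indicator (D q) \<xi>"
        using divide_ennreal[OF c0 n0] by (auto simp: indicator_def)
    qed
    finally show ?thesis .
  qed
  have "emeasure P ?F = (\<integral>\<^sup>+ p. indicator ?F p \<partial>PiM (insert j (V - {j})) (\<lambda>_. U))" unfolding V by simp
  also have "\<dots> = (\<integral>\<^sup>+ \<xi>. \<integral>\<^sup>+ y. indicator ?F (\<xi>(j := y)) \<partial>U \<partial>?M)"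
  proof (rule product_nn_integral_insert)
    show "indicator ?F \<in> borel_measurable (PiM (insert j (V - {j})) (\<lambda>_. U))" unfolding V by measurable
  qed auto
  also have "\<dots> \<le> (\<integral>\<^sup>+ \<xi>. (\<Sum>q. ennreal (c q / real n) * indicator (D q) \<xi>) \<partial>?M)"
    by (intro nn_integral_mono inner)
  also have "\<dots> = (\<Sum>q. \<integral>\<^sup>+ \<xi>. ennreal (c q / real n) * indicator (D q) \<xi> \<partial>?M)"
    by (intro nn_integral_suminf) measurable
  also have "\<dots> = (\<Sum>q. ennreal (c q / real n) * emeasure ?M (D q))"
    by (simp add: nn_integral_cmult_indicator)
  also have "\<dots> \<le> (\<Sum>q. ennreal (c q / real n) * ennreal (shell_prob ?d q))"
    by (intro suminf_le mult_left_mono DP) auto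
  also have "\<dots> = (\<Sum>q. ennreal (K * x / real n * (shell_prob ?d q * real (q + 1) ^ ?d)))"
    using K x n0 shell_prob_nonneg by (intro suminf_cong) (simp add: ennreal_mult[symmetric] c_def mult_ac)
  also have "\<dots> = ennreal (K * x / real n * (\<Sum>q. shell_prob ?d q * real (q + 1) ^ ?d))"
    using K x n0 shell_prob_nonneg
    by (intro suminf_ennreal_eq sums_mult summable_sums summable_shell_prob) auto
  also have "K * x / real n * (\<Sum>q. shell_prob ?d q * real (q + 1) ^ ?d) = tie_const ?d * x / real n"
    by (simp add: tie_const_def K_def)
  finally show ?thesis using tie_const_pos[of ?d] x by (simp add: P.emeasure_eq_measure)
qed

lemma card_E_le: "card E \<le> n * n"
proof -
  have "E \<subseteq> (\<lambda>(i, j). {i, j}) ` (V \<times> V)" unfolding complete_edges_def by auto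
  then have "card E \<le> card (V \<times> V)" by (rule surj_card_le[rotated]) simp
  then show ?thesis by simp
qed

text \<open>At most \<open>n * n\<close> pairs, each with probability of order x/n.\<close>

lemma near_ties_prob_sum:
  assumes d: "2 \<le> CARD('d)" and x: "0 < x" "x \<le> 1 / 4"
  shows "(\<Sum>e\<in>E. measure P {p \<in> space P. e \<in> near_ties (euclid_len p) x}) \<le> 2 * tie_const CARD('d) * x * real (card V)"
proof -
  let ?t = "tie_const CARD('d) * x / real n"
  have "measure P {p \<in> space P. e \<in> near_ties (euclid_len p) x} \<le> ?t + ?t" if e: "e \<in> E" for e
  proof -
    obtain i j where ij: "i < n" "j < n" "i \<noteq> j" "e = {i, j}" using e unfolding complete_edges_def by blast
    show ?thesis unfolding ij(4)
      using near_ties_prob_le[OF ij(1-3)] tie_event_prob[OF d ij(1-3) x] tie_event_prob[OF d ij(2,1) not_sym[OF ij(3)] x]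
      by (meson add_mono order_trans)
  qed
  then have "(\<Sum>e\<in>E. measure P {p \<in> space P. e \<in> near_ties (euclid_len p) x}) \<le> real (card E) * (?t + ?t)"
    by (intro sum_bounded_above) auto
  also have "\<dots> \<le> real (n * n) * (?t + ?t)"
    using card_E_le tie_const_pos[of "CARD('d)"] x by (intro mult_right_mono) (auto simp: of_nat_le_iff simp del: of_nat_mult)
  also have "\<dots> = 2 * tie_const CARD('d) * x * real (card V)" using n3 by (simp add: field_simps)
  finally show ?thesis .
qed

section \<open>Far trees, crude bounds and the conclusion of the lower bound\<close>

definition triangle :: "nat \<Rightarrow> nat set" where "triangle j = {3 * j, 3 * j + 1, 3 * j + 2}"

text \<open>Consecutive triples of indices give \<open>n div 3\<close> disjoint triangles, and
  \<open>n \<le> 5 * (n div 3)\<close> for \<open>n \<ge> 3\<close>, with equality at 5.\<close>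

lemma far_tree_exists:
  assumes "\<delta> \<le> 1 / 5"
  shows "\<exists>T0. spanning_tree V E T0 \<and> real (card (T0 - mst V E w)) \<ge> \<delta> * real (card V)"
proof -
  let ?C = "\<lambda>j. {{3 * j, 3 * j + 1}, {3 * j + 1, 3 * j + 2}, {3 * j + 2, 3 * j}}"
  have sp: "spanning_tree V E (mst V E w)" using is_mst_mst by (simp add: is_mst_def)
  have "\<exists>T'. spanning_tree V E T' \<and> card {..<n div 3} \<le> card (T' - mst V E w)"
  proof (rule far_spanning_tree[OF sp, where W = triangle])
    show "cyc (?C j) \<and> ?C j \<subseteq> E \<and> ?C j \<noteq> {} \<and> ?C j \<subseteq> Pow (triangle j)" if "j \<in> {..<n div 3}" for j
      using that cyc_triangle[of "3 * j" "3 * j + 1" "3 * j + 2"] by (auto simp: edge_iff triangle_def)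
    show "triangle i \<inter> triangle j = {}" if "i \<noteq> j" for i j
      using that by (auto simp: triangle_def; presburger)
  qed simp
  then obtain T0 where T0: "spanning_tree V E T0" "n div 3 \<le> card (T0 - mst V E w)" by auto
  have "n \<le> 5 * (n div 3)" using n3 by presburger
  then have "real n \<le> 5 * real (n div 3)" by linarith
  then have "1 / 5 * real n \<le> real (n div 3)" by simp
  moreover have "\<delta> * real n \<le> 1 / 5 * real n" using assms by (intro mult_right_mono) auto
  ultimately have "\<delta> * real (card V) \<le> real (card (T0 - mst V E w))" using T0(2) by simp
  then show ?thesis using T0(1) by blast
qed

text \<open>All spanning trees have the size of the star centred at 0.\<close>

lemma card_spanning_tree_le:
  assumes "spanning_tree V E T"
  shows "card T \<le> n"
proof -
  let ?S = "(\<lambda>k. {k, 0}) ` {1..<n}"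
  have "acyclic_edges ((\<lambda>k. {k, 0::nat}) ` {1..<m})" for m
  proof (induction m)
    case (Suc m)
    show ?case
    proof (cases "1 \<le> m")
      case True
      then have "{1..<Suc m} = insert m {1..<m}" by auto
      moreover have "acyclic_edges (insert {m, 0} ((\<lambda>k. {k, 0::nat}) ` {1..<m}))"
        using True by (intro acyclic_insert_leaf' Suc) auto
      ultimately show ?thesis by simp
    qed (simp add: acyclic_empty)
  qed (simp add: acyclic_empty)
  moreover have "connects V ?S"
  proof -
    have "conn ?S k 0" if "k \<in> V" for k
      using that by (cases "k = 0") (auto intro!: conn_edge)
    then show ?thesis unfolding connects_def by (meson conn_sym conn_trans)
  qed
  moreover have "?S \<subseteq> E" using n3 by (auto simp: edge_iff)
  ultimately have "spanning_tree V E ?S" by (simp add: spanning_tree_def)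
  then have "card T = card ?S" using card_spanning_tree_eq assms by blast
  also have "\<dots> \<le> n" using card_image_le[of "{1..<n}" "\<lambda>k. {k, 0}"] by simp
  finally show ?thesis .
qed

lemma AE_points_in_cube: "AE p in P. \<forall>i\<in>V. p i \<in> cb"
proof -
  have "AE y in U. y \<in> cb" by (rule AE_uniform_measureI) auto
  then have "AE p in P. p i \<in> cb" if "i \<in> V" for i
    using that by (intro AE_PiM_component prob_space_U) auto
  then show ?thesis by (intro AE_finite_allI) auto
qed

lemma eps_le_diameter:
  assumes \<delta>: "\<delta> \<le> 1 / 5" and p: "\<forall>i\<in>V. p i \<in> cb"
  shows "eps V E (euclid_len p) \<delta> \<le> real CARD('d) * side"
proof -
  let ?w = "euclid_len p" and ?D = "real CARD('d) * side"
  obtain T0 where T0: "spanning_tree V E T0" "real (card (T0 - mst V E ?w)) \<ge> \<delta> * real (card V)"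
    using far_tree_exists[OF \<delta>] by blast
  have w: "0 \<le> ?w e" "?w e \<le> ?D" if e: "e \<in> E" for e
  proof -
    obtain i j where "i < n" "j < n" "e = {i, j}" using e unfolding complete_edges_def by blast
    then show "0 \<le> ?w e" "?w e \<le> ?D" using dist_cube_le p by (auto simp: euclid_len_pair)
  qed
  have "tree_len ?w T0 \<le> real (card T0) * ?D"
    unfolding tree_len_def using w spanning_treeD(1)[OF T0(1)] by (intro sum_bounded_above) auto
  also have "\<dots> \<le> real n * ?D" using card_spanning_tree_le[OF T0(1)] side_pos by (intro mult_right_mono) auto
  finally have a: "tree_len ?w T0 \<le> real n * ?D" .
  have b: "0 \<le> tree_len ?w (mst V E ?w)"
    unfolding tree_len_def using w is_mst_mst[of ?w] spanning_treeD(1) by (intro sum_nonneg) (auto simp: is_mst_def)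
  have "eps V E ?w \<delta> \<le> (tree_len ?w T0 - tree_len ?w (mst V E ?w)) / real (card V)" by (rule eps_le[OF T0])
  also have "\<dots> \<le> real n * ?D / real (card V)" using a b by (intro divide_right_mono) auto
  also have "\<dots> = ?D" using n3 by simp
  finally show ?thesis .
qed

lemma expected_eps_ge:
  assumes d: "2 \<le> CARD('d)" and \<delta>: "0 < \<delta>" "\<delta> \<le> 1 / 5" "\<delta> \<le> tie_const CARD('d)"
  shows "\<delta>\<^sup>2 / (8 * tie_const CARD('d)) \<le> (\<integral>p. eps V E (euclid_len p) \<delta> \<partial>P)"
proof -
  let ?C = "2 * tie_const CARD('d)"
  \<comment> \<open>The maximiser again; \<open>\<delta> \<le> tie_const CARD('d)\<close> is what
    keeps \<open>x \<le> 1 / 4\<close>.\<close>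
  define x where "x = \<delta> / (2 * ?C)"
  have t: "0 < tie_const CARD('d)" by (rule tie_const_pos) simp
  have x: "0 < x" "x \<le> 1 / 4" using \<delta> t by (auto simp: x_def field_simps)
  have "x * (\<delta> - ?C * x) \<le> (\<integral>p. eps V E (euclid_len p) \<delta> \<partial>P)"
  proof (rule expected_eps_lower[where Z = "\<lambda>_. real CARD('d) * side"])
    show "(\<Sum>e\<in>E. measure P {\<omega> \<in> space P. e \<in> near_ties (euclid_len \<omega>) x}) \<le> ?C * x * real (card V)"
      using near_ties_prob_sum[OF d x] by simp
    show "AE p in P. eps V E (euclid_len p) \<delta> \<le> real CARD('d) * side"
      using AE_points_in_cube by eventually_elim (rule eps_le_diameter[OF \<delta>(2)])
    show "prob_space P" by (rule P.prob_space_axioms)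
    show "V \<noteq> {}" using n3 by (simp add: lessThan_empty_iff)
  qed (use x far_tree_exists[OF \<delta>(2)] in auto)
  moreover have "x * (\<delta> - ?C * x) = \<delta>\<^sup>2 / (8 * tie_const CARD('d))"
    using t unfolding x_def by (simp add: field_simps power2_eq_square)
  ultimately show ?thesis by simp
qed

end

section \<open>The random Euclidean model: upper bound\<close>

context random_points
begin

text \<open>Chosen so that \<open>CARD('d) * (4 * (CARD('d) * tau)) = 1 / 5\<close>: distances
  within a configuration then stay at most \<open>1 / 5\<close>, below the \<open>3 / 10\<close>
  that separates it from everything outside its unit box.\<close>

definition tau :: real where "tau = 1 / (20 * (real CARD('d))\<^sup>2)"

definition boxes :: "('d \<Rightarrow> nat) set" where "boxes = Pi\<^sub>E UNIV (\<lambda>_. {..<nat \<lfloor>side\<rfloor>})"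

definition unit_box :: "('d \<Rightarrow> nat) \<Rightarrow> (real ^ 'd) set" where
  "unit_box z = {y. \<forall>k. real (z k) \<le> y $ k \<and> y $ k < real (z k) + 1}"

definition apex_box :: "('d \<Rightarrow> nat) \<Rightarrow> (real ^ 'd) set" where
  "apex_box z = cbox (\<chi> k. real (z k) + 1 / 2) (\<chi> k. real (z k) + 1 / 2 + tau)"

text \<open>The shift by \<open>3 * CARD('d) * tau\<close> in every coordinate puts every base point
  at least as far from the apex as two base points can be from each other, namely
  \<open>CARD('d) * tau\<close>. Two longest sides of the triangle thus meet at the apex.\<close>

definition base_box :: "('d \<Rightarrow> nat) \<Rightarrow> (real ^ 'd) set" where
  "base_box z = cbox (\<chi> k. real (z k) + 1 / 2 + 3 * real CARD('d) * tau) (\<chi> k. real (z k) + 1 / 2 + 3 * real CARD('d) * tau + tau)"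

lemma tau: "0 < tau" "real CARD('d) * real CARD('d) * tau = 1 / 20" "real CARD('d) * tau \<le> 1 / 20" "tau \<le> real CARD('d) * tau"
proof -
  have d: "1 \<le> real CARD('d)" by (simp add: Suc_leI)
  show t: "0 < tau" by (simp add: tau_def)
  show dd: "real CARD('d) * real CARD('d) * tau = 1 / 20" by (simp add: tau_def power2_eq_square)
  show "tau \<le> real CARD('d) * tau" using mult_right_mono[OF d, of tau] t by simp
  show "real CARD('d) * tau \<le> 1 / 20"
  proof -
    have "1 * (real CARD('d) * tau) \<le> real CARD('d) * (real CARD('d) * tau)"
      using d t by (intro mult_right_mono) auto
    also have "\<dots> = 1 / 20" using dd by (simp only: mult.assoc)
    finally show ?thesis by simp
  qed
qed

lemma finite_boxes: "finite boxes"
  unfolding boxes_def by (intro finite_PiE) auto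

lemma unit_box_eq_Inter: "unit_box z = (\<Inter>k. {y. real (z k) \<le> y $ k} \<inter> {y. y $ k < real (z k) + 1})"
  by (auto simp: unit_box_def)

lemma sets_boxes [measurable]:
  "unit_box z \<in> sets borel" "apex_box z \<in> sets borel" "base_box z \<in> sets borel"
proof -
  have "{y :: real ^ 'd. real (z k) \<le> y $ k} \<in> sets borel" "{y :: real ^ 'd. y $ k < real (z k) + 1} \<in> sets borel" for k
    by measurable
  then show "unit_box z \<in> sets borel"
    unfolding unit_box_eq_Inter by (intro sets.finite_INT) auto
qed (auto simp: apex_box_def base_box_def)

lemma unit_box_disjoint: "z \<noteq> z' \<Longrightarrow> unit_box z \<inter> unit_box z' = {}"
proof (rule ccontr)
  assume "z \<noteq> z'" "unit_box z \<inter> unit_box z' \<noteq> {}"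
  then obtain y k where y: "y \<in> unit_box z" "y \<in> unit_box z'" "z k \<noteq> z' k" by blast
  then have "real (z k) < real (z' k) + 1" "real (z' k) < real (z k) + 1"
    unfolding unit_box_def mem_Collect_eq by (meson order_le_less_trans)+
  then show False using y(3) by linarith
qed

lemma box_coords:
  "y \<in> apex_box z \<Longrightarrow> real (z k) + 1 / 2 \<le> y $ k \<and> y $ k \<le> real (z k) + 1 / 2 + tau"
  "y \<in> base_box z \<Longrightarrow> real (z k) + 1 / 2 + 3 * (real CARD('d) * tau) \<le> y $ k \<and> y $ k \<le> real (z k) + 1 / 2 + 3 * (real CARD('d) * tau) + tau"
  by (simp_all add: apex_box_def base_box_def mem_box_cart mult.assoc)

lemma inner_box_coords:
  assumes "y \<in> apex_box z \<union> base_box z"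
  shows "real (z k) + 1 / 2 \<le> y $ k" "y $ k \<le> real (z k) + 7 / 10"
proof -
  have "real (z k) + 1 / 2 \<le> y $ k \<and> y $ k \<le> real (z k) + 1 / 2 + 3 * (real CARD('d) * tau) + tau"
    using assms
  proof
    assume "y \<in> apex_box z"
    then show ?thesis using box_coords(1)[of y z k] tau by linarith
  next
    assume "y \<in> base_box z"
    then show ?thesis using box_coords(2)[of y z k] tau by linarith
  qed
  then show "real (z k) + 1 / 2 \<le> y $ k" "y $ k \<le> real (z k) + 7 / 10" using tau by linarith+
qed

lemma inner_boxes_subset: "apex_box z \<union> base_box z \<subseteq> unit_box z"
proof
  fix y assume y: "y \<in> apex_box z \<union> base_box z"
  have "real (z k) \<le> y $ k \<and> y $ k < real (z k) + 1" for k
    using inner_box_coords[OF y, of k] by linarith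
  then show "y \<in> unit_box z" by (simp add: unit_box_def)
qed

lemma unit_box_subset_cb:
  assumes "z \<in> boxes"
  shows "unit_box z \<subseteq> cb"
proof
  fix y assume y: "y \<in> unit_box z"
  have "0 \<le> y $ k \<and> y $ k \<le> side" for k
  proof -
    have "z k < nat \<lfloor>side\<rfloor>" using assms by (auto simp: boxes_def)
    then have "real (z k) + 1 \<le> side" using side_pos by linarith
    moreover have "real (z k) \<le> y $ k \<and> y $ k < real (z k) + 1" using y by (simp add: unit_box_def)
    moreover have "0 \<le> real (z k)" by simp
    ultimately show ?thesis by linarith
  qed
  then show "y \<in> cb" by (simp add: cube_def side_def)
qed

lemma dist_outside:
  assumes "y \<in> apex_box z \<union> base_box z" "u \<notin> unit_box z"
  shows "3 / 10 \<le> dist y u"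
proof -
  obtain k where k: "u $ k < real (z k) \<or> real (z k) + 1 \<le> u $ k" using assms(2) by (auto simp: unit_box_def not_le not_less)
  have "\<bar>y $ k - u $ k\<bar> \<le> dist y u" using component_le_norm_cart[of "y - u" k] by (simp add: dist_norm)
  then show ?thesis using inner_box_coords[OF assms(1), of k] k by linarith
qed

lemma dist_apex_base:
  assumes "a \<in> apex_box z" "b \<in> base_box z" "b' \<in> base_box z"
  shows "dist a b \<le> 1 / 5" "dist b b' \<le> dist a b"
proof -
  let ?d = "real CARD('d)"
  have "dist a b \<le> ?d * (4 * (?d * tau))"
  proof (rule dist_le_sum_cart)
    fix k show "\<bar>a $ k - b $ k\<bar> \<le> 4 * (?d * tau)"
      using box_coords(1)[OF assms(1), of k] box_coords(2)[OF assms(2), of k] tau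
      unfolding abs_le_iff by linarith
  qed
  also have "\<dots> = 1 / 5" using tau(2) by (simp add: mult.assoc mult.left_commute)
  finally show "dist a b \<le> 1 / 5" .
  have "dist b b' \<le> ?d * tau"
  proof (rule dist_le_sum_cart)
    fix k show "\<bar>b $ k - b' $ k\<bar> \<le> tau"
      using box_coords(2)[OF assms(2), of k] box_coords(2)[OF assms(3), of k] by (simp add: abs_le_iff)
  qed
  also have "\<dots> \<le> dist a b"
  proof -
    fix k :: 'd
    have "\<bar>a $ k - b $ k\<bar> \<le> dist a b" using component_le_norm_cart[of "a - b" k] by (simp add: dist_norm)
    then show ?thesis using box_coords(1)[OF assms(1), of k] box_coords(2)[OF assms(2), of k] tau by linarith
  qed
  finally show "dist b b' \<le> dist a b" .
qed

section \<open>Good triples and their probability\<close>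

definition third :: nat where "third = n div 3"

definition good3 :: "real \<Rightarrow> ('d \<Rightarrow> nat) \<Rightarrow> nat \<Rightarrow> nat \<Rightarrow> nat \<Rightarrow> (nat \<Rightarrow> real ^ 'd) \<Rightarrow> bool" where
  "good3 h z i j k p \<longleftrightarrow> p i \<in> apex_box z \<and> p j \<in> base_box z \<and> p k \<in> base_box z
     \<and> \<bar>dist (p i) (p j) - dist (p i) (p k)\<bar> \<le> h \<and> (\<forall>l\<in>V - {i, j, k}. p l \<in> - unit_box z)"

text \<open>The apex and the two base points come from separate thirds of the indices. The set of
  points in a box therefore determines their roles, and distinct triples give disjoint events for
  the same box.\<close>

definition triples :: "(nat \<times> nat \<times> nat) set" where
  "triples = {..<third} \<times> {third..<2 * third} \<times> {2 * third..<3 * third}"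

definition good :: "real \<Rightarrow> ('d \<Rightarrow> nat) \<Rightarrow> (nat \<Rightarrow> real ^ 'd) \<Rightarrow> bool" where
  "good h z p \<longleftrightarrow> (\<exists>(i, j, k)\<in>triples. good3 h z i j k p)"

lemma triplesD:
  assumes "(i, j, k) \<in> triples"
  shows "i < n" "j < n" "k < n" "i \<noteq> j" "j \<noteq> k" "i \<noteq> k"
  using assms by (auto simp: triples_def third_def)

lemma good3_members:
  assumes "(i, j, k) \<in> triples" "good3 h z i j k p"
  shows "{l \<in> V. p l \<in> unit_box z} = {i, j, k}"
proof -
  have "p i \<in> unit_box z" "p j \<in> unit_box z" "p k \<in> unit_box z"
    using assms(2) inner_boxes_subset[of z] by (auto simp: good3_def)
  then show ?thesis using assms(2) triplesD[OF assms(1)] by (auto simp: good3_def)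
qed

lemma good_update:
  assumes "p l \<notin> unit_box z" "y \<notin> unit_box z" "l < n"
  shows "good h z (p(l := y)) \<longleftrightarrow> good h z p"
proof -
  have "good h z (q(l := u))" if g: "good h z q" and q: "q l \<notin> unit_box z" and u: "u \<notin> unit_box z" for q u
  proof -
    obtain i j k where t: "(i, j, k) \<in> triples" "good3 h z i j k q" using g by (auto simp: good_def)
    have "l \<notin> {l \<in> V. q l \<in> unit_box z}" using q by simp
    then have l: "l \<noteq> i" "l \<noteq> j" "l \<noteq> k" unfolding good3_members[OF t] by auto
    have "good3 h z i j k (q(l := u))" using t(2) l u by (simp add: good3_def)
    then show ?thesis using t(1) by (auto simp: good_def)
  qed
  from this[of p y] this[of "p(l := y)" "p l"] show ?thesis using assms by auto
qed

lemma eps_le_good: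
  assumes h: "0 \<le> h" and c: "\<delta> * real (card V) \<le> real c" "c \<le> card {z \<in> boxes. good h z p}"
  shows "eps V E (euclid_len p) \<delta> \<le> h * real c / real (card V)"
proof -
  let ?w = "euclid_len p"
  obtain K where K: "K \<subseteq> {z \<in> boxes. good h z p}" "card K = c" "finite K"
    using obtain_subset_with_card_n[OF c(2)] by blast
  define W where "W z = {l \<in> V. p l \<in> unit_box z}" for z
  \<comment> \<open>Defined without reference to a chosen triple; \<open>Ceq\<close> identifies it
    with the triangle.\<close>
  define C where "C z = {e \<in> E. e \<subseteq> W z}" for z
  have ex: "\<exists>i j k. (i, j, k) \<in> triples \<and> good3 h z i j k p" if "z \<in> K" for z
  proof -
    have "good h z p" using that K(1) by blast
    then obtain t where "t \<in> triples" "case t of (i, j, k) \<Rightarrow> good3 h z i j k p" unfolding good_def by blast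
    then show ?thesis by (cases t) auto
  qed
  have Ceq: "C z = {{i, j}, {j, k}, {k, i}}" if "(i, j, k) \<in> triples" "good3 h z i j k p" for i j k z
  proof -
    have "W z = {i, j, k}" using good3_members[OF that] by (simp add: W_def)
    moreover have "{{i, j}, {j, k}, {k, i}} \<subseteq> E" using triplesD[OF that(1)] by (simp add: edge_iff)
    moreover have "e \<in> {{i, j}, {j, k}, {k, i}}" if e: "e \<in> E" "e \<subseteq> {i, j, k}" for e
    proof -
      obtain a b where "e = {a, b}" "a \<noteq> b" using e(1) unfolding complete_edges_def by blast
      then show ?thesis using e(2) by (auto simp: doubleton_eq_iff)
    qed
    ultimately show ?thesis unfolding C_def by auto
  qed
  have len: "?w {i, j} \<le> 1 / 5" "?w {k, i} \<le> 1 / 5" "?w {j, k} \<le> ?w {i, j}" "\<bar>?w {i, j} - ?w {k, i}\<bar> \<le> h"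
    if "(i, j, k) \<in> triples" "good3 h z i j k p" for i j k z
    using that(2) dist_apex_base[of "p i" z "p j" "p k"] dist_apex_base[of "p i" z "p k" "p j"]
    by (auto simp: euclid_len_pair good3_def dist_commute)
  have "eps V E ?w \<delta> \<le> h * real (card K) / real (card V)"
  proof (rule eps_upper[where C = C and W = W])
    show "finite K" "\<delta> * real (card V) \<le> real (card K)" using K c by auto
    show "W z \<inter> W z' = {}" if "z \<noteq> z'" for z z'
      using unit_box_disjoint[OF that] unfolding W_def by auto
    show "C z \<subseteq> E" "C z \<subseteq> Pow (W z)" for z by (auto simp: C_def)
    fix z assume z: "z \<in> K"
    obtain i j k where t: "(i, j, k) \<in> triples" "good3 h z i j k p" using ex[OF z] by blast
    note td = triplesD[OF t(1)] and l = len[OF t]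
    show "cyc (C z)" unfolding Ceq[OF t] using td by (intro cyc_triangle) simp
    show "C z \<noteq> {}" unfolding Ceq[OF t] by simp
    show "e \<in> C z \<or> (\<forall>c\<in>C z. ?w c < ?w e)" if e: "e \<in> E" "e \<inter> W z \<noteq> {}" for e
    proof (cases "e \<subseteq> W z")
      case True
      then show ?thesis using e by (simp add: C_def)
    next
      case False
      obtain a b where ab: "e = {a, b}" "a \<in> W z" "b < n" "b \<notin> W z"
      proof -
        obtain a where a: "a \<in> e" "a \<in> W z" using e(2) by blast
        obtain b where b: "b \<in> e" "b \<notin> W z" using False by blast
        obtain s t where st: "s < n" "t < n" "e = {s, t}" using e(1) unfolding complete_edges_def by blast
        have "e = {a, b}" using a b st(3) by auto
        moreover have "b < n" using b(1) st by auto
        ultimately show ?thesis using that a(2) b(2) by blast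
      qed
      have "a \<in> {l \<in> V. p l \<in> unit_box z}" using ab(2) by (simp add: W_def)
      then have "a \<in> {i, j, k}" unfolding good3_members[OF t] .
      then have "p a \<in> apex_box z \<union> base_box z" using t(2) by (auto simp: good3_def)
      moreover have "p b \<notin> unit_box z" using ab(3,4) by (simp add: W_def)
      ultimately have "3 / 10 \<le> ?w e" unfolding ab(1) euclid_len_pair by (rule dist_outside)
      moreover have "?w c \<le> 1 / 5" if "c \<in> C z" for c using that l unfolding Ceq[OF t] by auto
      ultimately show ?thesis by fastforce
    qed
    show "\<exists>c\<in>C z. c \<noteq> e \<and> ?w e \<le> ?w c + h" if e: "e \<in> C z" for e
    proof -
      have d: "{i, j} \<noteq> {k, i}" "{i, j} \<noteq> {j, k}" using td by (auto simp: doubleton_eq_iff)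
      have m: "{i, j} \<in> C z" "{k, i} \<in> C z" unfolding Ceq[OF t] by auto
      from e consider "e = {i, j}" | "e = {j, k}" | "e = {k, i}" unfolding Ceq[OF t] by blast
      then show ?thesis
      proof cases
        case 1 then show ?thesis using l d m by (intro bexI[of _ "{k, i}"]) auto
      next
        case 2 then show ?thesis using l d m h by (intro bexI[of _ "{i, j}"]) auto
      next
        case 3 then show ?thesis using l d m by (intro bexI[of _ "{i, j}"]) auto
      qed
    qed
  qed
  then show ?thesis using K by simp
qed

lemma sets_good3:
  assumes "i < n" "j < n" "k < n"
  shows "{p \<in> space P. good3 h z i j k p} \<in> sets P"
proof -
  note [measurable] = assms[THEN measurable_point]
  have "{p \<in> space P. \<forall>l\<in>V - {i, j, k}. p l \<in> - unit_box z} \<in> sets P"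
    by (intro sets.sets_Collect_finite_All sets_Collect_point) auto
  then have [measurable]: "Measurable.pred P (\<lambda>p. \<forall>l\<in>V - {i, j, k}. p l \<in> - unit_box z)" by (simp add: pred_def)
  show ?thesis unfolding good3_def by measurable
qed

lemma finite_triples: "finite triples"
  by (simp add: triples_def)

lemma sets_good: "{p \<in> space P. good h z p} \<in> sets P"
proof -
  have "{p \<in> space P. good h z p} = (\<Union>(i, j, k)\<in>triples. {p \<in> space P. good3 h z i j k p})"
    by (auto simp: good_def)
  also have "\<dots> \<in> sets P"
    using sets_good3 triplesD by (intro sets.finite_UN finite_triples) (auto split: prod.split)
  finally show ?thesis .
qed

lemma measure_U:
  assumes "A \<subseteq> cb" "A \<in> sets borel" "emeasure lborel A = ennreal v" "0 \<le> v"
  shows "measure U A = v / real n"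
proof -
  have "emeasure U A = ennreal v / ennreal (real n)"
    using emeasure_U[OF assms(2)] assms(1,3) by (simp only: Int_absorb1)
  also have "\<dots> = ennreal (v / real n)" using assms(4) n3 by (intro divide_ennreal) auto
  finally show ?thesis using assms(4) by (simp add: measure_def)
qed

lemma box_measures:
  assumes z: "z \<in> boxes"
  shows "measure U (apex_box z) = tau ^ CARD('d) / real n" "measure U (base_box z) = tau ^ CARD('d) / real n"
    "measure U (- unit_box z) \<ge> 1 - 1 / real n"
proof -
  have sub: "apex_box z \<subseteq> cb" "base_box z \<subseteq> cb" using inner_boxes_subset[of z] unit_box_subset_cb[OF z] by auto
  show "measure U (apex_box z) = tau ^ CARD('d) / real n"
    using tau(1) by (intro measure_U sub sets_boxes) (auto simp: apex_box_def intro!: emeasure_cbox_cart)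
  show "measure U (base_box z) = tau ^ CARD('d) / real n"
    using tau(1) by (intro measure_U sub sets_boxes) (auto simp: base_box_def intro!: emeasure_cbox_cart)
  let ?B = "cbox (\<chi> k. real (z k)) (\<chi> k. real (z k) + 1) :: (real ^ 'd) set"
  have "emeasure U (unit_box z) = emeasure lborel (cb \<inter> unit_box z) / ennreal (real n)" by (intro emeasure_U) simp
  also have "\<dots> \<le> emeasure lborel ?B / ennreal (real n)"
  proof (intro divide_right_mono_ennreal emeasure_mono subsetI)
    fix y assume "y \<in> cb \<inter> unit_box z"
    then have "real (z k) \<le> y $ k \<and> y $ k < real (z k) + 1" for k by (simp add: unit_box_def)
    then show "y \<in> ?B" by (simp add: mem_box_cart less_imp_le)
  qed simp
  also have "emeasure lborel ?B = ennreal (1 ^ CARD('d))" by (intro emeasure_cbox_cart) auto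
  also have "\<dots> / ennreal (real n) = ennreal (1 / real n)" using n3 divide_ennreal[of 1 "real n"] by simp
  finally have "measure U (unit_box z) \<le> 1 / real n" by (simp add: M.emeasure_eq_measure)
  moreover have "measure U (space U - unit_box z) = 1 - measure U (unit_box z)"
    by (intro prob_space.prob_compl[OF prob_space_U]) simp
  ultimately show "measure U (- unit_box z) \<ge> 1 - 1 / real n" by (simp add: Compl_eq_Diff_UNIV)
qed

text \<open>Given the apex, sort the base points into distance classes of width $h$; by Cauchy-Schwarz two independent base
  points share a class with probability at least one over the number of classes.\<close>

lemma base_pair_prob:
  assumes z: "z \<in> boxes" and a: "a \<in> apex_box z" and h: "0 < h" "h \<le> 1"
  shows "(\<integral>\<^sup>+ y. \<integral>\<^sup>+ y'. indicator {(y, y'). y \<in> base_box z \<and> y' \<in> base_box z \<and> \<bar>dist a y - dist a y'\<bar> \<le> h} (y, y') \<partial>U \<partial>U)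
    \<ge> ennreal ((tau ^ CARD('d) / real n)\<^sup>2 * h / 3)"
proof -
  \<comment> \<open>Distances from the apex to base points are at most \<open>1 / 5\<close>, so more
    than \<open>1 / h\<close> classes suffice; \<open>h \<le> 1\<close> bounds their number by
    \<open>3 / h\<close>.\<close>
  define N where "N = nat \<lceil>1 / h\<rceil> + 1"
  have N: "0 < N" "1 / h < real N" "real N \<le> 3 / h"
  proof -
    have "0 < 1 / h" using h by simp
    then have r: "real N = of_int \<lceil>1 / h\<rceil> + 1" unfolding N_def by simp
    then show "1 / h < real N" by linarith
    have "real N \<le> 1 / h + 2" unfolding r by linarith
    also have "\<dots> \<le> 3 / h" using h by (simp add: field_simps)
    finally show "real N \<le> 3 / h" .
    show "0 < N" by (simp add: N_def)
  qed
  define b where "b l = {y \<in> base_box z. real l * h \<le> dist a y \<and> dist a y < real (Suc l) * h}" for l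
  have bm[measurable]: "b l \<in> sets borel" for l unfolding b_def by measurable
  have cover: "base_box z = (\<Union>l\<in>{..<N}. b l)"
  proof
    show "base_box z \<subseteq> (\<Union>l\<in>{..<N}. b l)"
    proof
      fix y assume y: "y \<in> base_box z"
      define l where "l = nat \<lfloor>dist a y / h\<rfloor>"
      have "0 \<le> dist a y / h" using h by simp
      then have "real l = of_int \<lfloor>dist a y / h\<rfloor>" by (simp add: l_def)
      then have l: "real l \<le> dist a y / h" "dist a y / h < real l + 1" by linarith+
      have "dist a y / h \<le> 1 / h" using dist_apex_base(1)[OF a y y] h by (intro divide_right_mono) auto
      then have "real l < real N" using l N(2) by linarith
      moreover have "y \<in> b l" using l y h unfolding b_def by (simp add: field_simps)
      ultimately show "y \<in> (\<Union>l\<in>{..<N}. b l)" by auto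
    qed
  qed (auto simp: b_def)
  have disj: "disjoint_family_on b {..<N}"
    unfolding disjoint_family_on_def
  proof (intro ballI impI)
    fix l l' :: nat assume ne: "l \<noteq> l'"
    have "b l \<inter> b l' = {}" if "l < l'" for l l'
    proof -
      have "real (Suc l) * h \<le> real l' * h" using that h by (intro mult_right_mono) auto
      then show ?thesis unfolding b_def by auto
    qed
    then show "b l \<inter> b l' = {}" using ne by (metis Int_commute linorder_neqE_nat)
  qed
  define u where "u l = measure U (b l)" for l
  have usum: "(\<Sum>l<N. u l) = tau ^ CARD('d) / real n"
    unfolding u_def box_measures(2)[OF z, symmetric] cover
    using disj by (intro finite_measure.finite_measure_finite_Union[symmetric] prob_space.finite_measure prob_space_U) auto
  \<comment> \<open>For \<open>y\<close> in class \<open>l\<close>, every \<open>y'\<close> of the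
    same class has a distance from the apex within \<open>h\<close> of that of \<open>y\<close>, so
    the inner integral is at least \<open>u l\<close>.\<close>
  have pt: "ennreal (\<Sum>l<N. u l * indicator (b l) y)
      \<le> (\<integral>\<^sup>+ y'. indicator {(y, y'). y \<in> base_box z \<and> y' \<in> base_box z \<and> \<bar>dist a y - dist a y'\<bar> \<le> h} (y, y') \<partial>U)" (is "_ \<le> ?R y") for y
  proof (cases "y \<in> base_box z")
    case True
    then obtain l where l: "l < N" "y \<in> b l" unfolding cover by auto
    have "(\<Sum>l'<N. u l' * indicator (b l') y) = (\<Sum>l'\<in>{l}. u l' * indicator (b l') y)"
    proof (rule sum.mono_neutral_right)
      show "\<forall>l'\<in>{..<N} - {l}. u l' * indicator (b l') y = 0"
      proof
        fix l' assume l': "l' \<in> {..<N} - {l}"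
        then have "b l' \<inter> b l = {}" using disj l(1) unfolding disjoint_family_on_def by auto
        then show "u l' * indicator (b l') y = 0" using l(2) by (auto simp: indicator_def)
      qed
    qed (use l in auto)
    then have "ennreal (\<Sum>l<N. u l * indicator (b l) y) = emeasure U (b l)"
      using l(2) by (simp add: u_def M.emeasure_eq_measure)
    also have "\<dots> = (\<integral>\<^sup>+ y'. indicator (b l) y' \<partial>U)" by simp
    also have "\<dots> \<le> ?R y"
    proof (intro nn_integral_mono)
      fix y'
      show "indicator (b l) y' \<le> (indicator {(y, y'). y \<in> base_box z \<and> y' \<in> base_box z \<and> \<bar>dist a y - dist a y'\<bar> \<le> h} (y, y') :: ennreal)"
      proof (cases "y' \<in> b l")
        case y': True
        have "\<bar>dist a y - dist a y'\<bar> \<le> h" using l(2) y' unfolding b_def by (auto simp: abs_le_iff algebra_simps)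
        then show ?thesis using True y' unfolding b_def by simp
      qed simp
    qed
    finally show ?thesis .
  next
    case False
    then have "(\<Sum>l<N. u l * indicator (b l) y) = 0" by (intro sum.neutral) (auto simp: b_def)
    then show ?thesis by simp
  qed
  have "(tau ^ CARD('d) / real n)\<^sup>2 = (\<Sum>l<N. u l)\<^sup>2" by (simp only: usum)
  also have "\<dots> \<le> (\<Sum>l<N. (u l)\<^sup>2) * real (card {..<N})" by (rule sum_squared_le_sum_of_squares)
  finally have cs: "(tau ^ CARD('d) / real n)\<^sup>2 \<le> (\<Sum>l<N. (u l)\<^sup>2) * real N" by simp
  have "(tau ^ CARD('d) / real n)\<^sup>2 * h / 3 \<le> (\<Sum>l<N. (u l)\<^sup>2)"
  proof -
    have "(\<Sum>l<N. (u l)\<^sup>2) * real N \<le> (\<Sum>l<N. (u l)\<^sup>2) * (3 / h)"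
      using N by (intro mult_left_mono) (auto intro: sum_nonneg)
    then have "(tau ^ CARD('d) / real n)\<^sup>2 \<le> (\<Sum>l<N. (u l)\<^sup>2) * (3 / h)" using cs by linarith
    moreover have "A * h / 3 \<le> B" if "A \<le> B * (3 / h)" for A B :: real
      using that h by (simp add: field_simps)
    ultimately show ?thesis by blast
  qed
  then have "ennreal ((tau ^ CARD('d) / real n)\<^sup>2 * h / 3) \<le> ennreal (\<Sum>l<N. (u l)\<^sup>2)" by (rule ennreal_leI)
  also have "\<dots> = (\<Sum>l<N. ennreal (u l) * emeasure U (b l))"
    by (simp add: u_def M.emeasure_eq_measure power2_eq_square ennreal_mult flip: sum_ennreal)
  also have "\<dots> = (\<Sum>l<N. \<integral>\<^sup>+ y. ennreal (u l) * indicator (b l) y \<partial>U)"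
    by (intro sum.cong refl nn_integral_cmult_indicator[symmetric]) simp
  also have "\<dots> = (\<integral>\<^sup>+ y. (\<Sum>l<N. ennreal (u l) * indicator (b l) y) \<partial>U)"
    by (rule nn_integral_sum[symmetric]) (intro borel_measurable_times_ennreal borel_measurable_const borel_measurable_indicator; simp)
  also have "\<dots> = (\<integral>\<^sup>+ y. ennreal (\<Sum>l<N. u l * indicator (b l) y) \<partial>U)"
    by (intro nn_integral_cong) (simp add: u_def ennreal_mult ennreal_indicator flip: sum_ennreal)
  also have "\<dots> \<le> (\<integral>\<^sup>+ y. ?R y \<partial>U)" by (intro nn_integral_mono pt)
  finally show ?thesis .
qed

text \<open>Integrate over \<open>k\<close> first and then over \<open>j\<close>, with the apex and
  all other points fixed; these two integrals are \<open>base_pair_prob\<close>. What remains is the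
  factor \<open>c\<close> for the apex and \<open>n - 3\<close> points avoiding a box of volume at
  most 1, which costs no more than a factor \<open>exp (- 1)\<close>.\<close>

lemma good3_prob:
  assumes z: "z \<in> boxes" and t: "(i, j, k) \<in> triples" and h: "0 < h" "h \<le> 1"
  shows "measure P {p \<in> space P. good3 h z i j k p} \<ge> (tau ^ CARD('d) / real n) ^ 3 * (h / 3) * exp (- 1)"
proof -
  note td = triplesD[OF t]
  let ?S = "{p \<in> space P. good3 h z i j k p}"
  let ?V2 = "V - {k} - {j}"
  let ?M1 = "PiM (V - {k}) (\<lambda>_. U)" and ?M2 = "PiM ?V2 (\<lambda>_. U)"
  define c where "c = tau ^ CARD('d) / real n"
  have c: "0 \<le> c" using tau by (simp add: c_def)
  have [measurable]: "?S \<in> sets P" by (rule sets_good3[OF td(1-3)])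
  have Vk: "insert k (V - {k}) = V" and Vj: "insert j ?V2 = V - {k}" using td by auto
  define G where "G \<xi> = (\<integral>\<^sup>+ y'. indicator ?S (\<xi>(k := y')) \<partial>U)" for \<xi>
  have Gm: "G \<in> borel_measurable ?M1"
  proof -
    have "(\<lambda>(\<xi>, y). indicator ?S (\<xi>(k := y)) :: ennreal) \<in> borel_measurable (?M1 \<Otimes>\<^sub>M U)"
      using measurable_compose[OF measurable_add_dim[of k "V - {k}" "\<lambda>_. U"], of "indicator ?S" borel] unfolding Vk
      by (simp add: split_beta')
    then show ?thesis unfolding G_def
      by (rule sigma_finite_measure.borel_measurable_nn_integral[OF prob_space_imp_sigma_finite[OF prob_space_U]])
  qed
  let ?Q = "{\<xi> \<in> space ?M2. \<forall>l\<in>?V2. \<xi> l \<in> (if l = i then apex_box z else - unit_box z)}"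
  interpret J: product_prob_space "\<lambda>_. U" ?V2 by (rule product_prob_spaceI) (rule prob_space_U)
  have inner: "ennreal (c\<^sup>2 * h / 3) * indicator ?Q \<xi> \<le> (\<integral>\<^sup>+ y. G (\<xi>(j := y)) \<partial>U)" if \<xi>: "\<xi> \<in> space ?M2" for \<xi>
  proof (cases "\<xi> \<in> ?Q")
    case True
    have iV: "i \<in> ?V2" using td by auto
    have all: "\<forall>l\<in>?V2. \<xi> l \<in> (if l = i then apex_box z else - unit_box z)" using True by simp
    have a: "\<xi> i \<in> apex_box z" using bspec[OF all iV] by simp
    have "ennreal (c\<^sup>2 * h / 3) \<le> (\<integral>\<^sup>+ y. \<integral>\<^sup>+ y'. indicator {(y, y'). y \<in> base_box z \<and> y' \<in> base_box z \<and> \<bar>dist (\<xi> i) y - dist (\<xi> i) y'\<bar> \<le> h} (y, y') \<partial>U \<partial>U)"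
      unfolding c_def by (rule base_pair_prob[OF z a h])
    also have "\<dots> \<le> (\<integral>\<^sup>+ y. G (\<xi>(j := y)) \<partial>U)"
      unfolding G_def
    proof (intro nn_integral_mono)
      fix y y'
      show "indicator {(y, y'). y \<in> base_box z \<and> y' \<in> base_box z \<and> \<bar>dist (\<xi> i) y - dist (\<xi> i) y'\<bar> \<le> h} (y, y')
        \<le> (indicator ?S (\<xi>(j := y, k := y')) :: ennreal)"
      proof (cases "y \<in> base_box z \<and> y' \<in> base_box z \<and> \<bar>dist (\<xi> i) y - dist (\<xi> i) y'\<bar> \<le> h")
        case yy: True
        have "\<xi>(j := y, k := y') \<in> space P"
          using \<xi> td by (auto simp: space_PiM PiE_iff extensional_def)
        moreover have "\<forall>l\<in>V - {i, j, k}. \<xi> l \<in> - unit_box z"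
        proof
          fix l assume "l \<in> V - {i, j, k}"
          then have "l \<in> ?V2" "l \<noteq> i" by auto
          then show "\<xi> l \<in> - unit_box z" using bspec[OF all, of l] by simp
        qed
        ultimately have "\<xi>(j := y, k := y') \<in> ?S" using yy a td by (simp add: good3_def)
        then show ?thesis by (simp add: indicator_def)
      qed simp
    qed
    finally show ?thesis using True by simp
  qed simp
  have Qm[measurable]: "?Q \<in> sets ?M2"
    by (intro sets.sets_Collect_finite_All sets_Collect_point) auto
  have Q: "emeasure ?M2 ?Q \<ge> ennreal (c * exp (- 1))"
  proof -
    have "emeasure ?M2 ?Q = (\<Prod>l\<in>?V2. emeasure U (if l = i then apex_box z else - unit_box z))"
      by (rule J.emeasure_PiM_Collect) auto
    also have "\<dots> = ennreal (\<Prod>l\<in>?V2. measure U (if l = i then apex_box z else - unit_box z))"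
      by (simp add: M.emeasure_eq_measure prod_ennreal)
    also have "(\<Prod>l\<in>?V2. measure U (if l = i then apex_box z else - unit_box z))
        = c * (measure U (- unit_box z)) ^ (n - 3)"
    proof -
      have "card (?V2 - {i}) = n - 3" using td by (simp add: card_Diff_singleton_if)
      then show ?thesis using td
        by (subst prod.remove[of _ i]) (auto simp: box_measures(1)[OF z] c_def)
    qed
    finally have eq: "emeasure ?M2 ?Q = ennreal (c * (measure U (- unit_box z)) ^ (n - 3))" .
    have "c * exp (- 1) \<le> c * (measure U (- unit_box z)) ^ (n - 3)"
    proof (rule mult_left_mono[OF _ c])
      have n1: "0 < real (n - 1)" using n3 by simp
      \<comment> \<open>The bound \<open>exp (- (1 / (n - 1))) \<le> 1 - 1 / n\<close> is sharp
        enough for the power to stay above \<open>exp (- 1)\<close> uniformly in n.\<close>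
      have "1 - 1 / real n = 1 / (1 + 1 / real (n - 1))" using n3 by (simp add: field_simps of_nat_diff)
      also have "\<dots> \<ge> 1 / exp (1 / real (n - 1))"
        using n1 exp_ge_add_one_self[of "1 / real (n - 1)"] by (intro divide_left_mono mult_pos_pos) (auto intro: add_pos_pos)
      finally have e: "exp (- (1 / real (n - 1))) \<le> 1 - 1 / real n" by (simp add: exp_minus field_simps)
      have "exp (- 1) = exp (- (1 / real (n - 1))) ^ (n - 1)" using n1 by (simp add: exp_of_nat_mult[symmetric])
      also have "\<dots> \<le> exp (- (1 / real (n - 1))) ^ (n - 3)" using n1 by (intro power_decreasing) auto
      also have "\<dots> \<le> (measure U (- unit_box z)) ^ (n - 3)"
        using e box_measures(3)[OF z] by (intro power_mono) auto
      finally show "exp (- 1) \<le> (measure U (- unit_box z)) ^ (n - 3)" .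
    qed
    then show ?thesis unfolding eq by (rule ennreal_leI)
  qed
  have "ennreal (c ^ 3 * (h / 3) * exp (- 1)) = ennreal (c\<^sup>2 * h / 3) * ennreal (c * exp (- 1))"
    using c h by (subst ennreal_mult[symmetric]) (auto simp: power2_eq_square power3_eq_cube mult_ac)
  also have "\<dots> \<le> ennreal (c\<^sup>2 * h / 3) * emeasure ?M2 ?Q" by (intro mult_left_mono Q) simp
  also have "\<dots> = (\<integral>\<^sup>+ \<xi>. ennreal (c\<^sup>2 * h / 3) * indicator ?Q \<xi> \<partial>?M2)"
    by (rule nn_integral_cmult_indicator[OF Qm, symmetric])
  also have "\<dots> \<le> (\<integral>\<^sup>+ \<xi>. \<integral>\<^sup>+ y. G (\<xi>(j := y)) \<partial>U \<partial>?M2)" by (intro nn_integral_mono inner)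
  also have "\<dots> = (\<integral>\<^sup>+ \<xi>. G \<xi> \<partial>PiM (insert j ?V2) (\<lambda>_. U))"
    by (rule product_nn_integral_insert[symmetric]) (use Gm Vj in auto)
  also have "\<dots> = (\<integral>\<^sup>+ \<xi>. \<integral>\<^sup>+ y. indicator ?S (\<xi>(k := y)) \<partial>U \<partial>?M1)" unfolding Vj G_def ..
  also have "\<dots> = (\<integral>\<^sup>+ p. indicator ?S p \<partial>PiM (insert k (V - {k})) (\<lambda>_. U))"
  proof (rule product_nn_integral_insert[symmetric])
    show "indicator ?S \<in> borel_measurable (PiM (insert k (V - {k})) (\<lambda>_. U))" unfolding Vk by measurable
  qed auto
  also have "\<dots> = emeasure P ?S" unfolding Vk by simp
  finally show ?thesis by (simp add: P.emeasure_eq_measure c_def)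
qed

text \<open>At least \<open>(n / 5) ^ 3\<close> triples, each of probability at least
  \<open>(tau ^ CARD('d) / n) ^ 3 * (h / 3) * exp (- 1)\<close>, produce the 375. The power of 2
  makes up for the number of boxes, guaranteed only to be at least
  \<open>n / 2 ^ CARD('d)\<close>.\<close>

definition good_const :: real where
  "good_const = (tau ^ CARD('d)) ^ 3 * exp (- 1) / (375 * 2 ^ CARD('d))"

lemma good_const_pos: "0 < good_const"
  using tau by (simp add: good_const_def)

lemma good_prob:
  assumes z: "z \<in> boxes" and h: "0 < h" "h \<le> 1"
  shows "measure P {p \<in> space P. good h z p} \<ge> 2 ^ CARD('d) * good_const * h"
proof -
  let ?S = "\<lambda>(i, j, k). {p \<in> space P. good3 h z i j k p}"
  have n0: "0 < real n" using n3 by simp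
  have "n \<le> 5 * third" using n3 unfolding third_def by presburger
  then have th: "real n / 5 \<le> real third" by linarith
  have "2 ^ CARD('d) * good_const * h = (real n / 5) ^ 3 * ((tau ^ CARD('d) / real n) ^ 3 * (h / 3) * exp (- 1))"
    using n0 by (simp add: good_const_def field_simps power3_eq_cube)
  also have "\<dots> \<le> real third ^ 3 * ((tau ^ CARD('d) / real n) ^ 3 * (h / 3) * exp (- 1))"
    using th h tau(1) n0 by (intro mult_right_mono power_mono) auto
  also have "\<dots> = real (card triples) * ((tau ^ CARD('d) / real n) ^ 3 * (h / 3) * exp (- 1))"
    by (simp add: triples_def card_cartesian_product power3_eq_cube)
  also have "\<dots> \<le> (\<Sum>t\<in>triples. measure P (?S t))"
    using good3_prob[OF z _ h] by (intro sum_bounded_below) auto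
  also have "\<dots> = measure P (\<Union>t\<in>triples. ?S t)"
  proof (rule P.finite_measure_finite_Union[symmetric])
    show "finite triples" by (rule finite_triples)
    show "?S ` triples \<subseteq> sets P" using sets_good3 triplesD by auto
    show "disjoint_family_on ?S triples"
      unfolding disjoint_family_on_def
    proof (intro ballI impI)
      fix t t' assume tt: "t \<in> triples" "t' \<in> triples" "t \<noteq> t'"
      obtain i j k where t: "t = (i, j, k)" by (cases t)
      obtain i' j' k' where t': "t' = (i', j', k')" by (cases t')
      show "?S t \<inter> ?S t' = {}"
      proof (rule ccontr)
        assume "?S t \<inter> ?S t' \<noteq> {}"
        then obtain p where "good3 h z i j k p" "good3 h z i' j' k' p" using t t' by auto
        then have "{i, j, k} = {i', j', k'}"
          using good3_members[of i j k h z p] good3_members[of i' j' k' h z p] tt t t' by simp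
        then have "i' \<in> {i, j, k}" "j' \<in> {i, j, k}" "k' \<in> {i, j, k}" by auto
        then show False using tt t t' unfolding triples_def by auto
      qed
    qed
  qed
  also have "(\<Union>t\<in>triples. ?S t) = {p \<in> space P. good h z p}" by (auto simp: good_def)
  finally show ?thesis .
qed

section \<open>Counting good boxes and the conclusion of the upper bound\<close>

lemma card_boxes_ge: "real n \<le> 2 ^ CARD('d) * real (card boxes)"
proof -
  have "1 \<le> side"
    unfolding side_def using n3 by (intro ge_one_powr_ge_zero) auto
  then have "1 \<le> \<lfloor>side\<rfloor>" by (simp add: le_floor_iff)
  then have "side / 2 \<le> of_int \<lfloor>side\<rfloor>" by linarith
  then have "side / 2 \<le> real (nat \<lfloor>side\<rfloor>)" using \<open>1 \<le> \<lfloor>side\<rfloor>\<close> by simp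
  then have "(side / 2) ^ CARD('d) \<le> real (nat \<lfloor>side\<rfloor>) ^ CARD('d)" using side_pos by (intro power_mono) auto
  also have "\<dots> = real (card boxes)" by (simp add: boxes_def card_PiE)
  finally show ?thesis using side_power by (simp add: power_divide field_simps)
qed

text \<open>With this \<open>h\<close> the mean number of good boxes is at least
  \<open>4 * \<delta> * n\<close>, twice the threshold. Moving one point affects at most the box it
  leaves and the box it enters.\<close>

lemma bad_prob:
  assumes \<delta>: "0 < \<delta>" "\<delta> \<le> good_const / 4" and h: "h = 4 * \<delta> / good_const"
  shows "measure P {p \<in> space P. real (card {z \<in> boxes. good h z p}) < 2 * \<delta> * real n} \<le> 1 / (\<delta>\<^sup>2 * real n)"
proof -
  let ?N = "\<lambda>p. real (card {z \<in> boxes. good h z p})"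
  have n0: "0 < real n" using n3 by simp
  have hp: "0 < h" "h \<le> 1" using \<delta> good_const_pos unfolding h by (auto simp: field_simps)
  have Nm: "?N \<in> borel_measurable P" and EN: "P.expectation ?N = (\<Sum>z\<in>boxes. P.prob {p \<in> space P. good h z p})"
    using P.expectation_card[of boxes "\<lambda>z p. good h z p"] finite_boxes sets_good by auto
  have "4 * \<delta> * real n = real n * (good_const * h)" using good_const_pos by (simp add: h)
  also have "\<dots> \<le> (2 ^ CARD('d) * real (card boxes)) * (good_const * h)"
    using card_boxes_ge good_const_pos hp by (intro mult_right_mono) auto
  also have "\<dots> = real (card boxes) * (2 ^ CARD('d) * good_const * h)" by simp
  also have "\<dots> \<le> P.expectation ?N"
    unfolding EN using good_prob[OF _ hp] by (intro sum_bounded_below) auto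
  finally have mean: "2 * (2 * \<delta> * real n) \<le> P.expectation ?N" by simp
  have "measure P {p \<in> space P. ?N p < 2 * \<delta> * real n} \<le> real (card V) * 2\<^sup>2 / (2 * \<delta> * real n)\<^sup>2"
  proof (rule bounded_differences_lower_tail[where K = "real (card boxes)"])
    show "\<bar>?N p\<bar> \<le> real (card boxes)" for p
      using finite_boxes by (simp add: card_mono)
    show "\<bar>?N (\<xi>(l := y)) - ?N \<xi>\<bar> \<le> 2" if l: "l \<in> V" for l \<xi> y
    proof -
      have "\<bar>?N (\<xi>(l := y)) - ?N \<xi>\<bar> \<le> real 2"
      proof (rule card_filter_diff_le[where K = "{z \<in> boxes. {\<xi> l, y} \<inter> unit_box z \<noteq> {}}"])
        have "card {z \<in> boxes. {\<xi> l, y} \<inter> unit_box z \<noteq> {}} \<le> card {\<xi> l, y}"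
          by (rule card_disjoint_touching) (use finite_boxes unit_box_disjoint in auto)
        also have "\<dots> \<le> 2" by (simp add: card_insert_if)
        finally show "card {z \<in> boxes. {\<xi> l, y} \<inter> unit_box z \<noteq> {}} \<le> 2" .
        show "good h z (\<xi>(l := y)) \<longleftrightarrow> good h z \<xi>" if "z \<in> boxes - {z \<in> boxes. {\<xi> l, y} \<inter> unit_box z \<noteq> {}}" for z
          using that l by (intro good_update) auto
      qed (use finite_boxes in auto)
      then show ?thesis by simp
    qed
  qed (use Nm mean \<delta> n0 prob_space_U in auto)
  also have "\<dots> = 1 / (\<delta>\<^sup>2 * real n)"
    using n0 \<delta> by (simp add: field_simps power2_eq_square)
  finally show ?thesis .
qed

text \<open>On the bad event the diameter bound replaces the swaps: order \<open>side\<close> times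
  a probability of order 1/n.\<close>

lemma expected_eps_le:
  assumes \<delta>: "0 < \<delta>" "\<delta> \<le> 1 / 5" "\<delta> \<le> good_const / 4" and n: "1 / \<delta> \<le> real n"
  shows "(\<integral>p. eps V E (euclid_len p) \<delta> \<partial>P) \<le> 8 / good_const * \<delta>\<^sup>2 + real CARD('d) * side / (\<delta>\<^sup>2 * real n)"
proof -
  let ?D = "real CARD('d) * side"
  define h where "h = 4 * \<delta> / good_const"
  define A where "A = {p \<in> space P. real (card {z \<in> boxes. good h z p}) < 2 * \<delta> * real n}"
  have hp: "0 \<le> h" using \<delta> good_const_pos by (simp add: h_def)
  have np: "0 < real n" using n3 by simp
  have Am[measurable]: "A \<in> sets P"
  proof -
    have [measurable]: "(\<lambda>p. real (card {z \<in> boxes. good h z p})) \<in> borel_measurable P"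
      using P.expectation_card(1)[of boxes "\<lambda>z p. good h z p"] finite_boxes sets_good by auto
    show ?thesis unfolding A_def by measurable
  qed
  have g0: "0 \<le> 8 / good_const * \<delta>\<^sup>2" using good_const_pos by simp
  have pt: "eps V E (euclid_len p) \<delta> \<le> 8 / good_const * \<delta>\<^sup>2 + ?D * indicator A p"
    if p: "p \<in> space P" "\<forall>i\<in>V. p i \<in> cb" for p
  proof (cases "p \<in> A")
    case True
    then show ?thesis using eps_le_diameter[OF \<delta>(2) p(2)] g0 by simp
  next
    case False
    define c where "c = nat \<lceil>\<delta> * real n\<rceil>"
    have c1: "\<delta> * real n \<le> real c" unfolding c_def by linarith
    have "real c \<le> \<delta> * real n + 1" using \<delta> np unfolding c_def by (simp add: of_nat_nat ceiling_le_iff)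
    moreover have "1 \<le> \<delta> * real n" using n \<delta> by (simp add: field_simps)
    ultimately have c2: "real c \<le> 2 * \<delta> * real n" by simp
    have "2 * \<delta> * real n \<le> real (card {z \<in> boxes. good h z p})" using False p(1) by (simp add: A_def)
    then have "c \<le> card {z \<in> boxes. good h z p}" using c2 by linarith
    then have "eps V E (euclid_len p) \<delta> \<le> h * real c / real (card V)" using c1 by (intro eps_le_good[OF hp]) auto
    also have "\<dots> \<le> h * (2 * \<delta> * real n) / real n" unfolding card_lessThan using c2 hp by (intro divide_right_mono mult_left_mono) auto
    also have "\<dots> = 8 / good_const * \<delta>\<^sup>2" using np by (simp add: h_def power2_eq_square)
    finally show ?thesis using False by simp
  qed
  have iA: "integrable P (\<lambda>p. ?D * indicator A p)"
    by (intro integrable_mult_right integrable_real_indicator) (auto simp: P.emeasure_eq_measure)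
  have "(\<integral>p. eps V E (euclid_len p) \<delta> \<partial>P) \<le> (\<integral>p. 8 / good_const * \<delta>\<^sup>2 + ?D * indicator A p \<partial>P)"
  proof (rule integral_mono_AE')
    show "AE p in P. eps V E (euclid_len p) \<delta> \<le> 8 / good_const * \<delta>\<^sup>2 + ?D * indicator A p"
      using AE_points_in_cube AE_space by eventually_elim (rule pt)
    show "AE p in P. 0 \<le> 8 / good_const * \<delta>\<^sup>2 + ?D * indicator A p"
      using g0 side_pos by (intro AE_I2 add_nonneg_nonneg) auto
  qed (use iA in auto)
  also have "\<dots> = 8 / good_const * \<delta>\<^sup>2 + ?D * P.prob A"
    using iA by (simp add: P.prob_space A_def Int_absorb2)
  also have "P.prob A \<le> 1 / (\<delta>\<^sup>2 * real n)" using bad_prob[OF \<delta>(1,3) h_def] by (simp add: A_def)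
  finally show ?thesis using side_pos by (simp add: mult_left_mono)
qed

end

lemma random_euclidean_scaling:
  assumes d: "CARD('d::finite) \<ge> 2"
  shows "Limsup (at_right 0) (\<lambda>\<delta>::real. ereal (1 / \<delta>\<^sup>2) *
      limsup (\<lambda>n. ereal (expected_eps2 TYPE('d) n \<delta>))) < \<infinity>"
    and "Liminf (at_right 0) (\<lambda>\<delta>::real. ereal (1 / \<delta>\<^sup>2) *
      liminf (\<lambda>n. ereal (expected_eps2 TYPE('d) n \<delta>))) > 0"
proof -
  have rp: "random_points n" if "3 \<le> n" for n using that by unfold_locales
  define g where "g = random_points.good_const TYPE('d)"
  have g: "0 < g" unfolding g_def by (rule random_points.good_const_pos[OF rp[of 3]]) simp
  show "Limsup (at_right 0) (\<lambda>\<delta>::real. ereal (1 / \<delta>\<^sup>2) * limsup (\<lambda>n. ereal (expected_eps2 TYPE('d) n \<delta>))) < \<infinity>"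
  proof (rule Limsup_scaled_finite)
    show "0 < min (1 / 5) (g / 4)" using g by simp
    fix \<delta> :: real assume \<delta>: "0 < \<delta>" "\<delta> < min (1 / 5) (g / 4)"
    \<comment> \<open>The square yields \<open>sqrt n \<ge> CARD('d) / \<delta> ^ 4\<close>, which
      absorbs the error term into \<open>\<delta>\<^sup>2\<close>.\<close>
    obtain n0 :: nat where n0: "max (1 / \<delta>) ((real CARD('d) / \<delta>\<^sup>2 / \<delta>\<^sup>2)\<^sup>2) \<le> real n0" using real_arch_simple by blast
    show "\<forall>\<^sub>F n in sequentially. expected_eps2 TYPE('d) n \<delta> \<le> (8 / g + 1) * \<delta>\<^sup>2"
      using eventually_ge_at_top[of "max 3 n0"]
    proof eventually_elim
      case (elim n)
      have n3: "3 \<le> n" and nn: "real n0 \<le> real n" using elim by auto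
      let ?side = "real n powr (1 / real CARD('d))"
      have "expected_eps2 TYPE('d) n \<delta> \<le> 8 / g * \<delta>\<^sup>2 + real CARD('d) * ?side / (\<delta>\<^sup>2 * real n)"
        unfolding expected_eps2_def points_measure_def
        using random_points.expected_eps_le[where ?'d = 'd, OF rp[OF n3], of \<delta>] \<delta> n0 nn
        unfolding g_def[symmetric] random_points.side_def[where ?'d = 'd, OF rp[OF n3]] by simp
      moreover have "real CARD('d) * ?side / (\<delta>\<^sup>2 * real n) \<le> \<delta>\<^sup>2"
      proof -
        \<comment> \<open>Dimension at least two enters: the side is at most \<open>sqrt n\<close>,
          so the diameter divided by n tends to 0.\<close>
        have "?side \<le> real n powr (1 / 2)"
          using d n3 by (intro powr_mono) (auto simp: field_simps)
        also have "\<dots> = sqrt (real n)" by (simp add: powr_half_sqrt)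
        finally have s: "?side \<le> sqrt (real n)" .
        have "real CARD('d) / \<delta>\<^sup>2 / \<delta>\<^sup>2 \<le> sqrt (real n)"
          using n0 nn by (intro real_le_rsqrt) simp
        then have "real CARD('d) \<le> \<delta>\<^sup>2 * \<delta>\<^sup>2 * sqrt (real n)" using \<delta> by (simp add: field_simps)
        then have "real CARD('d) * ?side \<le> (\<delta>\<^sup>2 * \<delta>\<^sup>2 * sqrt (real n)) * sqrt (real n)"
          using s by (intro mult_mono) auto
        then have "real CARD('d) * ?side \<le> \<delta>\<^sup>2 * (\<delta>\<^sup>2 * real n)" by (simp add: mult.assoc)
        then show ?thesis using \<delta> n3 by (subst pos_divide_le_eq) auto
      qed
      ultimately show ?case by (simp add: algebra_simps)
    qed
  qed
  show "Liminf (at_right 0) (\<lambda>\<delta>::real. ereal (1 / \<delta>\<^sup>2) * liminf (\<lambda>n. ereal (expected_eps2 TYPE('d) n \<delta>))) > 0"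
  proof (rule Liminf_scaled_pos)
    have t: "0 < tie_const CARD('d)" by (rule tie_const_pos) simp
    show "0 < min (1 / 5) (tie_const CARD('d))" using t by simp
    show "0 < 1 / (8 * tie_const CARD('d))" using t by simp
    fix \<delta> :: real assume \<delta>: "0 < \<delta>" "\<delta> < min (1 / 5) (tie_const CARD('d))"
    show "\<forall>\<^sub>F n in sequentially. 1 / (8 * tie_const CARD('d)) * \<delta>\<^sup>2 \<le> expected_eps2 TYPE('d) n \<delta>"
      using eventually_ge_at_top[of 3]
    proof eventually_elim
      case (elim n)
      show ?case unfolding expected_eps2_def points_measure_def
        using random_points.expected_eps_ge[OF rp[OF elim] d, of \<delta>] \<delta> by simp
    qed
  qed
qed

theorem theorem1:
  assumes "CARD('d::finite) \<ge> 2"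
  shows "(\<forall>f. edge_density f \<longrightarrow>
            Limsup (at_right 0) (\<lambda>\<delta>::real. ereal (1 / \<delta>\<^sup>2) *
               limsup (\<lambda>m. ereal (expected_eps1 TYPE('d) f m \<delta>))) < \<infinity> \<and>
            Liminf (at_right 0) (\<lambda>\<delta>::real. ereal (1 / \<delta>\<^sup>2) *
               liminf (\<lambda>m. ereal (expected_eps1 TYPE('d) f m \<delta>))) > 0)
       \<and> Limsup (at_right 0) (\<lambda>\<delta>::real. ereal (1 / \<delta>\<^sup>2) *
               limsup (\<lambda>n. ereal (expected_eps2 TYPE('d) n \<delta>))) < \<infinity>
       \<and> Liminf (at_right 0) (\<lambda>\<delta>::real. ereal (1 / \<delta>\<^sup>2) *
               liminf (\<lambda>n. ereal (expected_eps2 TYPE('d) n \<delta>))) > 0"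
  using disordered_lattice_scaling[OF assms] random_euclidean_scaling[OF assms] by blast

end
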